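(* The following are equivalent over $\mathsf{RCA}_0$: (i) any finite monotone $\mathsf{PO}$-dilator is a $\mathsf{WPO}$-dilator; (ii) if $X$ is a well partial order, then so is $X^n$ for every $n\in\mathbb N$, where $X^n$ carries the product order, i.e. $\langle x_0,\ldots,x_{n-1}\rangle\leq\langle x_0',\ldots,x_{n-1}'\rangle$ holds precisely when $x_i\leq_X x_i'$ for all $i<n$.
   Context: A function $f:X\to Y$ between partial orders is a quasi embedding if $f(x)\leq_Y f(x')$ implies $x\leq_X x'$; it is an embedding if the converse implication holds as well. $\mathsf{PO}$ is the category of partial orders with quasi embeddings as morphisms. A functor $W:\mathsf{PO}\to\mathsf{PO}$ preserves embeddings if $W(f)$ is an embedding whenever $f$ is. $[X]^{<\omega}$ is the set of finite subsets of $X$, and $[f]^{<\omega}(a)=\{f(x)\mid x\in a\}$. A partial order $X$ is a well partial order if every infinite sequence $x_0,x_1,\ldots$ in $X$ admits $i<j$ with $x_i\leq_X x_j$. A $\mathsf{PO}$-dilator consists of a functor $W:\mathsf{PO}\to\mathsf{PO}$ that preserves embeddings and a natural transformation $\operatorname{supp}:W\Rightarrow[\cdot]^{<\omega}$ such that, for every embedding $f:X\to Y$ and every $\sigma\in W(Y)$, $\operatorname{supp}_Y(\sigma)\subseteq\operatorname{rng}(f)$ implies $\sigma\in\operatorname{rng}(W(f))$. It is a $\mathsf{WPO}$-dilator if $W(X)$ is a well partial order whenever $X$ is. It is monotone if, for all quasi embeddings $f,g:X\to Y$ with $f(x)\leq_Y g(x)$ for all $x\in X$, we have $W(f)(\sigma)\leq_{W(Y)}W(g)(\sigma)$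 for all $\sigma\in W(X)$. Formalization in second order arithmetic: Let $\mathsf{PO}_0\subseteq\mathsf{PO}$ be the full subcategory containing exactly one representative of each isomorphism class of finite partial orders. For each finite partial order $a$ fix an isomorphism $\operatorname{en}_a:|a|\to a$ with $|a|\in\mathsf{PO}_0$. A $\mathsf{PO}$-dilator is determined up to isomorphism by its restriction to $\mathsf{PO}_0$, and it is coded by (a subset of $\mathbb N$ representing) this restriction. Its trace is $\operatorname{Tr}(W)=\{(c,\rho)\mid c\in\mathsf{PO}_0,\ \rho\in W(c),\ \operatorname{supp}_c(\rho)=c\}$, and $W$ is called finite if $\operatorname{Tr}(W)$ is finite. For a countable partial order $X$, the elements of $W(X)$ are represented by pairs $(a,\sigma)$ with $a\in[X]^{<\omega}$ (with the induced order) and $(|a|,\sigma)\in\operatorname{Tr}(W)$; the pair stands for the element $W(\operatorname{en}_a^X)(\sigma)$ with support $a$, where $\operatorname{en}^X_a:|a|\to X$ is $\operatorname{en}_a$ followed by the inclusion. Pairs $(a,\sigma),(b,\tau)$ are compared by comparing, in $W(|a\cup b|)$, the images of $\sigma$ and $\tau$ under the morphisms $|a|\to|a\cup b|$ and $|b|\to|a\cup b|$ induced by the inclusions; a quasi embedding $f:X\to Y$ acts by restricting it to $a\to f[a]$ and applying $W$ to the induced morphism $|a|\to|f[a]|$. *)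

theory Defs
  imports Main
begin

section \<open>Second order arithmetic\<close>

text \<open>
  Structures for the two-sorted language of second order arithmetic (Henkin semantics): the number
  sort is the whole type, the set sort ranges over a collection of subsets of it.
  ``Over RCA0'' is read as ``in every model of RCA0'', where models are
  arbitrary: numbers may be nonstandard and only the sets in the second sort exist.
\<close>

record 'm l2 =
  zer :: 'm
  one :: 'm
  add :: "'m \<Rightarrow> 'm \<Rightarrow> 'm"
  mul :: "'m \<Rightarrow> 'm \<Rightarrow> 'm"
  lt :: "'m \<Rightarrow> 'm \<Rightarrow> bool"
  sets :: "'m set set"

datatype tm = Var nat | Zero | One | Plus tm tm | Times tm tm

datatype fm = Eq tm tm | Less tm tm | In tm nat | Neg fm | Conj fm fm | All nat fm | AllSet nat fm

fun tm_vars :: "tm \<Rightarrow> nat set" where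
  "tm_vars (Var i) = {i}"
| "tm_vars Zero = {}"
| "tm_vars One = {}"
| "tm_vars (Plus s t) = tm_vars s \<union> tm_vars t"
| "tm_vars (Times s t) = tm_vars s \<union> tm_vars t"

fun val :: "'m l2 \<Rightarrow> (nat \<Rightarrow> 'm) \<Rightarrow> tm \<Rightarrow> 'm" where
  "val M e (Var i) = e i"
| "val M e Zero = zer M"
| "val M e One = one M"
| "val M e (Plus s t) = add M (val M e s) (val M e t)"
| "val M e (Times s t) = mul M (val M e s) (val M e t)"

fun sat :: "'m l2 \<Rightarrow> (nat \<Rightarrow> 'm) \<Rightarrow> (nat \<Rightarrow> 'm set) \<Rightarrow> fm \<Rightarrow> bool" where
  "sat M e E (Eq s t) \<longleftrightarrow> val M e s = val M e t"
| "sat M e E (Less s t) \<longleftrightarrow> lt M (val M e s) (val M e t)"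
| "sat M e E (In t X) \<longleftrightarrow> val M e t \<in> E X"
| "sat M e E (Neg p) \<longleftrightarrow> \<not> sat M e E p"
| "sat M e E (Conj p q) \<longleftrightarrow> sat M e E p \<and> sat M e E q"
| "sat M e E (All i p) \<longleftrightarrow> (\<forall>a. sat M (e(i := a)) E p)"
| "sat M e E (AllSet X p) \<longleftrightarrow> (\<forall>A\<in>sets M. sat M e (E(X := A)) p)"

definition Imp :: "fm \<Rightarrow> fm \<Rightarrow> fm" where "Imp p q = Neg (Conj p (Neg q))"
definition Ex :: "nat \<Rightarrow> fm \<Rightarrow> fm" where "Ex i p = Neg (All i (Neg p))"

inductive delta00 :: "fm \<Rightarrow> bool" where
  "delta00 (Eq s t)"
| "delta00 (Less s t)"
| "delta00 (In t X)"
| "delta00 p \<Longrightarrow> delta00 (Neg p)"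
| "delta00 p \<Longrightarrow> delta00 q \<Longrightarrow> delta00 (Conj p q)"
| "delta00 p \<Longrightarrow> i \<notin> tm_vars t \<Longrightarrow> delta00 (All i (Imp (Less (Var i) t) p))"

definition sigma01 :: "fm \<Rightarrow> bool" where "sigma01 p \<longleftrightarrow> (\<exists>i q. delta00 q \<and> p = Ex i q)"
definition pi01 :: "fm \<Rightarrow> bool" where "pi01 p \<longleftrightarrow> (\<exists>i q. delta00 q \<and> p = All i q)"

context
  fixes M :: "'m l2"
begin

definition basic_axioms :: bool where
  "basic_axioms \<longleftrightarrow>
    (\<forall>n. add M n (one M) \<noteq> zer M) \<and>
    (\<forall>m n. add M m (one M) = add M n (one M) \<longrightarrow> m = n) \<and>
    (\<forall>m. add M m (zer M) = m) \<and>
    (\<forall>m n. add M m (add M n (one M)) = add M (add M m n) (one M)) \<and>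
    (\<forall>m. mul M m (zer M) = zer M) \<and>
    (\<forall>m n. mul M m (add M n (one M)) = add M (mul M m n) m) \<and>
    (\<forall>m. \<not> lt M m (zer M)) \<and>
    (\<forall>m n. lt M m (add M n (one M)) \<longleftrightarrow> lt M m n \<or> m = n)"

text \<open>In both schemes number and set parameters are allowed, through the assignments.\<close>

definition sigma01_induction :: bool where
  "sigma01_induction \<longleftrightarrow>
    (\<forall>p i e E. sigma01 p \<and> (\<forall>X. E X \<in> sets M) \<and>
       sat M (e(i := zer M)) E p \<and>
       (\<forall>n. sat M (e(i := n)) E p \<longrightarrow> sat M (e(i := add M n (one M))) E p) \<longrightarrow>
       (\<forall>n. sat M (e(i := n)) E p))"

definition delta01_comprehension :: bool where
  "delta01_comprehension \<longleftrightarrow>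
    (\<forall>p q i e E. sigma01 p \<and> pi01 q \<and> (\<forall>X. E X \<in> sets M) \<and>
       (\<forall>n. sat M (e(i := n)) E p \<longleftrightarrow> sat M (e(i := n)) E q) \<longrightarrow>
       (\<exists>A\<in>sets M. \<forall>n. n \<in> A \<longleftrightarrow> sat M (e(i := n)) E p))"

definition model_RCA0 :: bool where
  "model_RCA0 \<longleftrightarrow>
    sets M \<noteq> {} \<and> basic_axioms \<and> sigma01_induction \<and> delta01_comprehension"


section \<open>Pairs, finite sets and functions inside a model\<close>

text \<open>
  Everything below is relative to the model: all quantifiers range over numbers of the model or
  over members of \<open>sets M\<close>. Arguments of type \<^typ>\<open>'m set\<close> are used as classes, so
  that the same notions apply to members of \<open>sets M\<close>, to sets coded by a number, and to
  definable classes; membership in \<open>sets M\<close> is required explicitly where a set is meant.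
  A definite description denotes a definable element, which exists in models of RCA0
  whenever the arguments are as intended.
\<close>

definition pr :: "'m \<Rightarrow> 'm \<Rightarrow> 'm" where
  "pr i j = add M (mul M (add M i j) (add M i j)) i"

definition dvides :: "'m \<Rightarrow> 'm \<Rightarrow> bool" where
  "dvides d n \<longleftrightarrow> (\<exists>q. n = mul M d q)"

text \<open>
  Finite sets are coded as in Simpson's book: for every finite set there are \<open>k, m, n\<close> such that its
  elements are the \<open>i < k\<close> for which \<open>m (i + 1) + 1\<close> divides \<open>n\<close>; its code is the least number
  \<open>(k, (m, n))\<close> with this property.
\<close>

definition elems :: "'m \<Rightarrow> 'm set" where
  "elems c = {i. \<exists>k m n. c = pr k (pr m n) \<and> lt M i k \<and>
     dvides (add M (mul M m (add M i (one M))) (one M)) n}"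

definition triple :: "'m \<Rightarrow> bool" where
  "triple c \<longleftrightarrow> (\<exists>k m n. c = pr k (pr m n))"

definition fin_code :: "'m \<Rightarrow> bool" where
  "fin_code c \<longleftrightarrow> triple c \<and> (\<forall>c'. lt M c' c \<and> triple c' \<longrightarrow> elems c' \<noteq> elems c)"

definition code_of :: "'m set \<Rightarrow> 'm" where
  "code_of A = (THE c. fin_code c \<and> elems c = A)"

definition fun_on :: "'m set \<Rightarrow> 'm set \<Rightarrow> 'm set \<Rightarrow> bool" where
  "fun_on F A B \<longleftrightarrow>
    (\<forall>z\<in>F. \<exists>x\<in>A. \<exists>y\<in>B. z = pr x y) \<and> (\<forall>x\<in>A. \<exists>!y. pr x y \<in> F)"

definition ap :: "'m set \<Rightarrow> 'm \<Rightarrow> 'm" where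
  "ap F x = (THE y. pr x y \<in> F)"

definition idf :: "'m set \<Rightarrow> 'm set" where
  "idf A = {z. \<exists>x\<in>A. z = pr x x}"

definition compf :: "'m set \<Rightarrow> 'm set \<Rightarrow> 'm set" where
  "compf G F = {w. \<exists>x y z. pr x y \<in> F \<and> pr y z \<in> G \<and> w = pr x z}"

definition invf :: "'m set \<Rightarrow> 'm set" where
  "invf F = {z. \<exists>x y. pr x y \<in> F \<and> z = pr y x}"

text \<open>\<open>col A k\<close> is the \<open>k\<close>-th member of the sequence of sets coded by \<open>A\<close>.\<close>

definition col :: "'m set \<Rightarrow> 'm \<Rightarrow> 'm set" where
  "col A k = {z. pr k z \<in> A}"


section \<open>Partial orders\<close>

text \<open>
  A partial order is given by its (reflexive) order relation, from which the underlying set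
  \<open>fld R\<close> can be read off.
\<close>

definition fld :: "'m set \<Rightarrow> 'm set" where
  "fld R = {x. pr x x \<in> R}"

definition po :: "'m set \<Rightarrow> bool" where
  "po R \<longleftrightarrow>
    (\<forall>z\<in>R. \<exists>x\<in>fld R. \<exists>y\<in>fld R. z = pr x y) \<and>
    (\<forall>x y. pr x y \<in> R \<and> pr y x \<in> R \<longrightarrow> x = y) \<and>
    (\<forall>x y z. pr x y \<in> R \<and> pr y z \<in> R \<longrightarrow> pr x z \<in> R)"

definition partial_order :: "'m set \<Rightarrow> bool" where
  "partial_order X \<longleftrightarrow> X \<in> sets M \<and> po X"

definition fin_po :: "'m \<Rightarrow> bool" where
  "fin_po a \<longleftrightarrow> fin_code a \<and> po (elems a)"

definition quasi_emb :: "'m set \<Rightarrow> 'm set \<Rightarrow> 'm set \<Rightarrow> bool" where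
  "quasi_emb F X Y \<longleftrightarrow> fun_on F (fld X) (fld Y) \<and>
    (\<forall>x\<in>fld X. \<forall>x'\<in>fld X. pr (ap F x) (ap F x') \<in> Y \<longrightarrow> pr x x' \<in> X)"

definition emb :: "'m set \<Rightarrow> 'm set \<Rightarrow> 'm set \<Rightarrow> bool" where
  "emb F X Y \<longleftrightarrow> quasi_emb F X Y \<and>
    (\<forall>x\<in>fld X. \<forall>x'\<in>fld X. pr x x' \<in> X \<longrightarrow> pr (ap F x) (ap F x') \<in> Y)"

definition po_iso :: "'m set \<Rightarrow> 'm set \<Rightarrow> 'm set \<Rightarrow> bool" where
  "po_iso F X Y \<longleftrightarrow> emb F X Y \<and> ap F ` fld X = fld Y"

definition wpo :: "'m set \<Rightarrow> bool" where
  "wpo X \<longleftrightarrow> partial_order X \<and>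
    (\<forall>F\<in>sets M. fun_on F UNIV (fld X) \<longrightarrow> (\<exists>i j. lt M i j \<and> pr (ap F i) (ap F j) \<in> X))"

text \<open>\<open>is_seq A n s\<close>: the number \<open>s\<close> codes a sequence of length \<open>n\<close> with entries in \<open>A\<close>.\<close>

definition is_seq :: "'m set \<Rightarrow> 'm \<Rightarrow> 'm \<Rightarrow> bool" where
  "is_seq A n s \<longleftrightarrow> fin_code s \<and> fun_on (elems s) {i. lt M i n} A"

definition fin_power :: "'m set \<Rightarrow> 'm \<Rightarrow> 'm set" where
  "fin_power X n = {z. \<exists>s t. z = pr s t \<and> is_seq (fld X) n s \<and> is_seq (fld X) n t \<and>
     (\<forall>i. lt M i n \<longrightarrow> pr (ap (elems s) i) (ap (elems t) i) \<in> X)}"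

end


section \<open>Skeletons of the category of finite partial orders\<close>

text \<open>
  The choices on which the coding of dilators depends: the objects of the skeleton, the function
  sending (the code of) a finite partial order \<open>a\<close> to its representative \<open>|a|\<close>, and the function
  sending \<open>a\<close> to (the code of) an isomorphism from \<open>|a|\<close> to \<open>a\<close>.
\<close>

record 'm skel =
  obj :: "'m set"
  repr :: "'m set"
  enum :: "'m set"

definition skeleton :: "'m l2 \<Rightarrow> 'm skel \<Rightarrow> bool" where
  "skeleton M K \<longleftrightarrow>
    obj K \<in> sets M \<and> repr K \<in> sets M \<and> enum K \<in> sets M \<and>
    (\<forall>c\<in>obj K. fin_po M c) \<and>
    (\<forall>c\<in>obj K. \<forall>d\<in>obj K.
       (\<exists>f. fin_code M f \<and> po_iso M (elems M f) (elems M c) (elems M d)) \<longrightarrow> c = d) \<and>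
    fun_on M (repr K) {a. fin_po M a} (obj K) \<and>
    fun_on M (enum K) {a. fin_po M a} {f. fin_code M f} \<and>
    (\<forall>a. fin_po M a \<longrightarrow>
       po_iso M (elems M (ap M (enum K) a)) (elems M (ap M (repr K) a)) (elems M a))"


section \<open>Coded dilators\<close>

text \<open>
  A functor on the skeleton with support functions, as three coded families of sets: the order of
  \<open>W(c)\<close>, the graph of \<open>W(f)\<close> for a morphism \<open>f\<close> from \<open>c\<close> to \<open>d\<close>, and the graph of the support
  function on \<open>W(c)\<close> (with values codes of finite sets).
\<close>

record 'm dil =
  d_ord :: "'m set"
  d_map :: "'m set"
  d_supp :: "'m set"

context
  fixes M :: "'m l2" and K :: "'m skel"
begin

definition mor :: "'m \<Rightarrow> 'm \<Rightarrow> 'm \<Rightarrow> bool" where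
  "mor c d f \<longleftrightarrow> c \<in> obj K \<and> d \<in> obj K \<and> fin_code M f \<and>
     quasi_emb M (elems M f) (elems M c) (elems M d)"

definition W_ord :: "'m dil \<Rightarrow> 'm \<Rightarrow> 'm set" where
  "W_ord W c = col M (d_ord W) c"

definition W_map :: "'m dil \<Rightarrow> 'm \<Rightarrow> 'm \<Rightarrow> 'm \<Rightarrow> 'm set" where
  "W_map W c d f = col M (d_map W) (pr M (pr M c d) f)"

definition W_supp :: "'m dil \<Rightarrow> 'm \<Rightarrow> 'm set" where
  "W_supp W c = col M (d_supp W) c"

definition dil_functor :: "'m dil \<Rightarrow> bool" where
  "dil_functor W \<longleftrightarrow>
    (\<forall>c\<in>obj K. po M (W_ord W c)) \<and>
    (\<forall>c d f. mor c d f \<longrightarrow> quasi_emb M (W_map W c d f) (W_ord W c) (W_ord W d)) \<and>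
    (\<forall>c\<in>obj K. \<forall>x\<in>fld M (W_ord W c).
       ap M (W_map W c c (code_of M (idf M (fld M (elems M c))))) x = x) \<and>
    (\<forall>b c d f g. mor b c f \<and> mor c d g \<longrightarrow>
       (\<forall>x\<in>fld M (W_ord W b).
          ap M (W_map W b d (code_of M (compf M (elems M g) (elems M f)))) x =
          ap M (W_map W c d g) (ap M (W_map W b c f) x)))"

definition preserves_embs :: "'m dil \<Rightarrow> bool" where
  "preserves_embs W \<longleftrightarrow>
    (\<forall>c d f. mor c d f \<and> emb M (elems M f) (elems M c) (elems M d) \<longrightarrow>
       emb M (W_map W c d f) (W_ord W c) (W_ord W d))"

definition supp_natural :: "'m dil \<Rightarrow> bool" where
  "supp_natural W \<longleftrightarrow>
    (\<forall>c\<in>obj K. fun_on M (W_supp W c) (fld M (W_ord W c))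
       {s. fin_code M s \<and> elems M s \<subseteq> fld M (elems M c)}) \<and>
    (\<forall>c d f. mor c d f \<longrightarrow>
       (\<forall>x\<in>fld M (W_ord W c).
          elems M (ap M (W_supp W d) (ap M (W_map W c d f) x)) =
          ap M (elems M f) ` elems M (ap M (W_supp W c) x)))"

definition supp_condition :: "'m dil \<Rightarrow> bool" where
  "supp_condition W \<longleftrightarrow>
    (\<forall>c d f. mor c d f \<and> emb M (elems M f) (elems M c) (elems M d) \<longrightarrow>
       (\<forall>y\<in>fld M (W_ord W d).
          elems M (ap M (W_supp W d) y) \<subseteq> ap M (elems M f) ` fld M (elems M c) \<longrightarrow>
          (\<exists>x\<in>fld M (W_ord W c). ap M (W_map W c d f) x = y)))"

definition PO_dilator :: "'m dil \<Rightarrow> bool" where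
  "PO_dilator W \<longleftrightarrow>
    d_ord W \<in> sets M \<and> d_map W \<in> sets M \<and> d_supp W \<in> sets M \<and>
    dil_functor W \<and> preserves_embs W \<and> supp_natural W \<and> supp_condition W"

definition trace :: "'m dil \<Rightarrow> 'm set" where
  "trace W = {z. \<exists>c\<in>obj K. \<exists>x\<in>fld M (W_ord W c).
     z = pr M c x \<and> elems M (ap M (W_supp W c) x) = fld M (elems M c)}"

definition finite_dilator :: "'m dil \<Rightarrow> bool" where
  "finite_dilator W \<longleftrightarrow> (\<exists>t. fin_code M t \<and> elems M t = trace W)"


section \<open>Extension to infinite partial orders\<close>

text \<open>The finite subset coded by \<open>a\<close> with the order induced from \<open>X\<close>.\<close>

definition induced :: "'m set \<Rightarrow> 'm \<Rightarrow> 'm" where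
  "induced X a = code_of M {z \<in> X. \<exists>x\<in>elems M a. \<exists>y\<in>elems M a. z = pr M x y}"

text \<open>
  The morphism from \<open>|p|\<close> to \<open>|q|\<close> induced by a function \<open>F\<close> that maps \<open>p\<close> into \<open>q\<close>. As \<open>compf\<close>
  composes relations, \<open>F\<close> need not be restricted to \<open>p\<close> beforehand.
\<close>

definition ind_mor :: "'m set \<Rightarrow> 'm \<Rightarrow> 'm \<Rightarrow> 'm" where
  "ind_mor F p q = code_of M
     (compf M (invf M (elems M (ap M (enum K) q))) (compf M F (elems M (ap M (enum K) p))))"

text \<open>\<open>W_ind W F p q\<close> is the value of \<open>W\<close> at this morphism.\<close>

definition W_ind :: "'m dil \<Rightarrow> 'm set \<Rightarrow> 'm \<Rightarrow> 'm \<Rightarrow> 'm set" where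
  "W_ind W F p q = W_map W (ap M (repr K) p) (ap M (repr K) q) (ind_mor F p q)"

definition ext_elem :: "'m dil \<Rightarrow> 'm set \<Rightarrow> 'm \<Rightarrow> 'm \<Rightarrow> bool" where
  "ext_elem W X a \<sigma> \<longleftrightarrow> fin_code M a \<and> elems M a \<subseteq> fld M X \<and>
     pr M (ap M (repr K) (induced X a)) \<sigma> \<in> trace W"

definition ext_le :: "'m dil \<Rightarrow> 'm set \<Rightarrow> 'm \<Rightarrow> 'm \<Rightarrow> 'm \<Rightarrow> 'm \<Rightarrow> bool" where
  "ext_le W X a \<sigma> b \<tau> \<longleftrightarrow>
    (let p = induced X a; q = induced X b;
         r = induced X (code_of M (elems M a \<union> elems M b))
     in pr M (ap M (W_ind W (idf M (fld M X)) p r) \<sigma>) (ap M (W_ind W (idf M (fld M X)) q r) \<tau>)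
          \<in> W_ord W (ap M (repr K) r))"

text \<open>The partial order \<open>W(X)\<close>.\<close>

definition ext :: "'m dil \<Rightarrow> 'm set \<Rightarrow> 'm set" where
  "ext W X = {z. \<exists>a \<sigma> b \<tau>. z = pr M (pr M a \<sigma>) (pr M b \<tau>) \<and>
     ext_elem W X a \<sigma> \<and> ext_elem W X b \<tau> \<and> ext_le W X a \<sigma> b \<tau>}"

text \<open>The value of \<open>W(F)\<close>, for \<open>F\<close> from \<open>X\<close> to \<open>Y\<close>, at the element \<open>(a, \<sigma>)\<close> of \<open>W(X)\<close>.\<close>

definition ext_map :: "'m dil \<Rightarrow> 'm set \<Rightarrow> 'm set \<Rightarrow> 'm set \<Rightarrow> 'm \<Rightarrow> 'm \<Rightarrow> 'm" where
  "ext_map W X Y F a \<sigma> =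
    (let b = code_of M (ap M F ` elems M a)
     in pr M b (ap M (W_ind W F (induced X a) (induced Y b)) \<sigma>))"

definition monotone_dilator :: "'m dil \<Rightarrow> bool" where
  "monotone_dilator W \<longleftrightarrow>
    (\<forall>X Y. \<forall>F\<in>sets M. \<forall>G\<in>sets M.
       partial_order M X \<and> partial_order M Y \<and> quasi_emb M F X Y \<and> quasi_emb M G X Y \<and>
       (\<forall>x\<in>fld M X. pr M (ap M F x) (ap M G x) \<in> Y) \<longrightarrow>
       (\<forall>a \<sigma>. ext_elem W X a \<sigma> \<longrightarrow>
          pr M (ext_map W X Y F a \<sigma>) (ext_map W X Y G a \<sigma>) \<in> ext W Y))"

definition WPO_dilator :: "'m dil \<Rightarrow> bool" where
  "WPO_dilator W \<longleftrightarrow> PO_dilator W \<and> (\<forall>X. wpo M X \<longrightarrow> wpo M (ext W X))"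

end

end

theory Submission
  imports Defs
begin

text \<open>
  (ii) \<open>\<Longrightarrow>\<close> (i): Let \<open>W\<close> be finite and monotone. Adding two incomparable points to a well partial order \<open>X\<close>
  yields a well partial order \<open>Y\<close>. An element \<open>(a, \<sigma>)\<close> of \<open>W(X)\<close> is turned into a vector over \<open>Y\<close>, of a length that
  depends on the trace only, which marks the trace element \<open>(|a|, \<sigma>)\<close> by means of the new points and lists the
  values of \<open>en_a\<close>. If the vector of \<open>(a, \<sigma>)\<close> is below that of \<open>(b, \<tau>)\<close>, then both have the same trace element
  and \<open>en_a \<le> en_b\<close> pointwise, so monotonicity yields \<open>(a, \<sigma>) \<le> (b, \<tau>)\<close>. The marks replace the infinite
  pigeonhole principle, which RCA0 does not prove for a nonstandard number of colours.

  (i) \<open>\<Longrightarrow>\<close> (ii): \<open>X \<mapsto> X\<^sup>n\<close> is a finite monotone dilator, whose trace consists of the orders enumerated by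
  a sequence of length \<open>n\<close>.
\<close>

section \<open>Arithmetic in a model\<close>

text \<open>A model may be nonstandard, so neither induction on \<open>nat\<close> nor HOL
  finiteness applies to its numbers: an induction needs a Sigma formula, a set needs matching Sigma
  and Pi forms, and a finite set is one that has a code. Hence every function and order that occurs
  must be shown to be a member of \<open>sets M\<close>, uniformly in its parameters. From (ii) to
  (i), the vectors have length t + t for a code t of the trace. Codes exceed their elements, so t
  bounds the trace elements as well as the points of their orders, and both can serve as positions
  directly. Two new points suffice for any number of trace elements, because the same incomparable
  pair is used at every position. From (i) to (ii), the delicate point is that the trace is finite
  when n is nonstandard: the codes of all orders on subsets of n have to be bounded within RCA0, and
  collection transfers the bound to their representatives. A point of X^n is then presented as its
  range together with the names of its entries in the enumeration of that range.\<close>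

definition Disj :: "fm \<Rightarrow> fm \<Rightarrow> fm" where "Disj p q = Neg (Conj (Neg p) (Neg q))"
definition BAll :: "nat \<Rightarrow> tm \<Rightarrow> fm \<Rightarrow> fm" where "BAll i t p = All i (Imp (Less (Var i) t) p)"
definition BEx :: "nat \<Rightarrow> tm \<Rightarrow> fm \<Rightarrow> fm" where "BEx i t p = Neg (BAll i t (Neg p))"
definition Prt :: "tm \<Rightarrow> tm \<Rightarrow> tm" where
  "Prt s t = Plus (Times (Plus s t) (Plus s t)) s"

lemma val_upd [simp]: "j \<notin> tm_vars t \<Longrightarrow> val M (e(j := a)) t = val M e t"
  by (induction t) auto

lemma tm_vars_Prt [simp]: "tm_vars (Prt s t) = tm_vars s \<union> tm_vars t"
  by (auto simp: Prt_def)

lemma val_Prt [simp]: "val M e (Prt s t) = pr M (val M e s) (val M e t)"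
  by (simp add: Prt_def pr_def)

lemma sat_Imp [simp]: "sat M e E (Imp p q) \<longleftrightarrow> (sat M e E p \<longrightarrow> sat M e E q)"
  by (simp add: Imp_def)

lemma sat_Disj [simp]: "sat M e E (Disj p q) \<longleftrightarrow> sat M e E p \<or> sat M e E q"
  by (auto simp add: Disj_def)

lemma sat_Ex [simp]: "sat M e E (Ex i p) \<longleftrightarrow> (\<exists>a. sat M (e(i := a)) E p)"
  by (simp add: Ex_def)

lemma sat_BAll [simp]: "i \<notin> tm_vars t \<Longrightarrow>
    sat M e E (BAll i t p) \<longleftrightarrow> (\<forall>a. lt M a (val M e t) \<longrightarrow> sat M (e(i := a)) E p)"
  by (simp add: BAll_def)

lemma sat_BEx [simp]: "i \<notin> tm_vars t \<Longrightarrow>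
    sat M e E (BEx i t p) \<longleftrightarrow> (\<exists>a. lt M a (val M e t) \<and> sat M (e(i := a)) E p)"
  by (simp add: BEx_def)

lemma delta00_Imp: "delta00 p \<Longrightarrow> delta00 q \<Longrightarrow> delta00 (Imp p q)"
  by (simp add: Imp_def delta00.intros)

lemma delta00_Disj: "delta00 p \<Longrightarrow> delta00 q \<Longrightarrow> delta00 (Disj p q)"
  by (simp add: Disj_def delta00.intros)

lemma delta00_BAll: "delta00 p \<Longrightarrow> i \<notin> tm_vars t \<Longrightarrow> delta00 (BAll i t p)"
  by (simp add: BAll_def delta00.intros)

lemma delta00_BEx: "delta00 p \<Longrightarrow> i \<notin> tm_vars t \<Longrightarrow> delta00 (BEx i t p)"
  by (simp add: BEx_def delta00.intros delta00_BAll)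

lemmas d00 = delta00.intros(1-5) delta00_Imp delta00_Disj delta00_BAll delta00_BEx

locale rca =
  fixes M :: "'m l2"
  assumes model: "model_RCA0 M"
begin

abbreviation plus' (infixl "\<oplus>" 65) where "x \<oplus> y \<equiv> add M x y"
abbreviation times' (infixl "\<otimes>" 70) where "x \<otimes> y \<equiv> mul M x y"
abbreviation less' (infix "\<prec>" 50) where "x \<prec> y \<equiv> lt M x y"
abbreviation zero' ("\<zero>") where "\<zero> \<equiv> zer M"
abbreviation one' ("\<one>") where "\<one> \<equiv> one M"
abbreviation pair' ("\<langle>_,/ _\<rangle>") where "\<langle>x, y\<rangle> \<equiv> pr M x y"
definition le' (infix "\<preceq>" 50) where "x \<preceq> y \<longleftrightarrow> x \<prec> y \<or> x = y"

lemma basic: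
  "n \<oplus> \<one> \<noteq> \<zero>" "m \<oplus> \<one> = n \<oplus> \<one> \<Longrightarrow> m = n" "m \<oplus> \<zero> = m"
  "m \<oplus> (n \<oplus> \<one>) = (m \<oplus> n) \<oplus> \<one>" "m \<otimes> \<zero> = \<zero>" "m \<otimes> (n \<oplus> \<one>) = m \<otimes> n \<oplus> m"
  "\<not> m \<prec> \<zero>" "m \<prec> n \<oplus> \<one> \<longleftrightarrow> m \<prec> n \<or> m = n"
  using model by (auto simp: model_RCA0_def basic_axioms_def)

text \<open>
  In the formulas below variable 0 is the distinguished number variable and variable 9 the one bound by
  the outermost unbounded quantifier.
\<close>

lemma sigma_induct:
  assumes "sigma01 p" "\<And>X. E X \<in> sets M" "\<And>n. sat M (e(0 := n)) E p = P n"
    and "P \<zero>" "\<And>n. P n \<Longrightarrow> P (n \<oplus> \<one>)"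
  shows "P n"
proof -
  have "sigma01_induction M" using model by (simp add: model_RCA0_def)
  from this[unfolded sigma01_induction_def, rule_format, of p E e 0 n]
  show ?thesis using assms by auto
qed

lemma delta_comprehension:
  assumes "delta00 p" "delta00 q" "\<And>X. E X \<in> sets M"
    and "\<And>n. (\<exists>a. sat M (e(0 := n, 9 := a)) E p) = P n"
    and "\<And>n. (\<forall>a. sat M (e(0 := n, 9 := a)) E q) = P n"
  shows "{n. P n} \<in> sets M"
proof -
  have "delta01_comprehension M" using model by (simp add: model_RCA0_def)
  moreover have "sigma01 (Ex 9 p)" "pi01 (All 9 q)" using assms by (auto simp: sigma01_def pi01_def)
  ultimately obtain A where "A \<in> sets M" "\<forall>n. n \<in> A \<longleftrightarrow> sat M (e(0 := n)) E (Ex 9 p)"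
    using assms unfolding delta01_comprehension_def
    by (metis (no_types, lifting) sat.simps(6) sat_Ex)
  moreover from this have "A = {n. P n}" using assms by auto
  ultimately show ?thesis by simp
qed

text \<open>Here and in the induction rule below, the quantifier over variable 9 is vacuous: the
  truth value of \<open>p\<close> is required to be the same for every \<open>a\<close>.\<close>

lemma delta0_comprehension:
  assumes "delta00 p" "\<And>X. E X \<in> sets M" "\<And>n a. sat M (e(0 := n, 9 := a)) E p = P n"
  shows "{n. P n} \<in> sets M"
  by (rule delta_comprehension[of p p E e]) (use assms in auto)

lemma delta0_induct:
  assumes "delta00 p" "\<And>X. E X \<in> sets M" "\<And>n a. sat M (e(0 := n, 9 := a)) E p = P n"
    and "P \<zero>" "\<And>n. P n \<Longrightarrow> P (n \<oplus> \<one>)"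
  shows "P n"
  by (rule sigma_induct[of "Ex 9 p" E e]) (use assms in \<open>auto simp: sigma01_def\<close>)

text \<open>Assignments must send every set variable to a member of \<open>sets M\<close>; this
  member fills the variables that a formula does not mention.\<close>

definition some_set where "some_set = (SOME A. A \<in> sets M)"

lemma some_set: "some_set \<in> sets M"
  using model unfolding some_set_def by (auto simp: model_RCA0_def some_in_eq)

text \<open>Equations between terms are bounded formulas, so an arithmetic law can be proved by
  induction on one variable while the others are parameters in \<open>e\<close>.\<close>

lemma eq_induct:
  assumes "\<And>n a. val M (e(0 := n, 9 := a)) s = f n" "\<And>n a. val M (e(0 := n, 9 := a)) t = g n"
    and "f \<zero> = g \<zero>" "\<And>n. f n = g n \<Longrightarrow> f (n \<oplus> \<one>) = g (n \<oplus> \<one>)"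
  shows "f n = g n"
  by (rule delta0_induct[of "Eq s t" "\<lambda>_. some_set" e]) (use assms some_set in \<open>auto intro: d00\<close>)

section \<open>The ordered semiring of the numbers\<close>

abbreviation "env3 x y z \<equiv> (\<lambda>_. \<zero>)(Suc 0 := x, 2 := y, 3 := z)"

lemma add_assoc': "(a \<oplus> b) \<oplus> n = a \<oplus> (b \<oplus> n)"
  by (rule eq_induct[of "env3 a b b" "Plus (Plus (Var 1) (Var 2)) (Var 0)" _ "Plus (Var 1) (Plus (Var 2) (Var 0))"])
    (auto simp: basic(1,3-8))

lemma zero_add': "\<zero> \<oplus> n = n"
  by (rule eq_induct[of "env3 \<zero> \<zero> \<zero>" "Plus Zero (Var 0)" _ "Var 0"]) (auto simp: basic(1,3-8))

lemma one_add': "\<one> \<oplus> n = n \<oplus> \<one>"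
  by (rule eq_induct[of "env3 \<zero> \<zero> \<zero>" "Plus One (Var 0)" _ "Plus (Var 0) One"])
    (auto simp: basic(1,3-8) zero_add')

lemma add_commute': "a \<oplus> n = n \<oplus> a"
  by (rule eq_induct[of "env3 a \<zero> \<zero>" "Plus (Var 1) (Var 0)" _ "Plus (Var 0) (Var 1)"], simp, simp,
    simp add: basic zero_add') (metis add_assoc' one_add')

lemma add_left_commute': "a \<oplus> (b \<oplus> c) = b \<oplus> (a \<oplus> c)"
  by (metis add_assoc' add_commute')

lemmas add_ac' = add_assoc' add_commute' add_left_commute'

lemma distrib': "(a \<oplus> b) \<otimes> n = a \<otimes> n \<oplus> b \<otimes> n"
  by (rule eq_induct[of "env3 a b \<zero>" "Times (Plus (Var 1) (Var 2)) (Var 0)" _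
      "Plus (Times (Var 1) (Var 0)) (Times (Var 2) (Var 0))"], simp, simp,
    simp add: basic(3,5)) (simp add: basic(6) add_ac')

lemma zero_mul': "\<zero> \<otimes> n = \<zero>"
  by (rule eq_induct[of "env3 \<zero> \<zero> \<zero>" "Times Zero (Var 0)" _ "Zero"]) (simp_all add: basic(3,5,6))

lemma one_mul': "\<one> \<otimes> n = n"
  by (rule eq_induct[of "env3 \<zero> \<zero> \<zero>" "Times One (Var 0)" _ "Var 0"]) (simp_all add: basic(5,6))

lemma mul_commute': "a \<otimes> n = n \<otimes> a"
  by (rule eq_induct[of "env3 a \<zero> \<zero>" "Times (Var 1) (Var 0)" _ "Times (Var 0) (Var 1)"])
    (simp_all add: basic(5,6) zero_mul' distrib' one_mul')

lemma distrib_left': "a \<otimes> (b \<oplus> n) = a \<otimes> b \<oplus> a \<otimes> n"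
  by (simp add: distrib' mul_commute'[of a])

lemma mul_assoc': "(a \<otimes> b) \<otimes> n = a \<otimes> (b \<otimes> n)"
  by (rule eq_induct[of "env3 a b b" "Times (Times (Var 1) (Var 2)) (Var 0)" _
      "Times (Var 1) (Times (Var 2) (Var 0))"], simp, simp, simp add: basic(5))
    (simp add: distrib_left' one_mul' mul_commute'[of _ "\<one>"])

lemma add_cancel': "a \<oplus> n = b \<oplus> n \<Longrightarrow> a = b"
proof -
  have "a \<oplus> n = b \<oplus> n \<longrightarrow> a = b"
  proof (rule delta0_induct[of "Imp (Eq (Plus (Var 1) (Var 0)) (Plus (Var 2) (Var 0))) (Eq (Var 1) (Var 2))"
      "\<lambda>_. some_set" "env3 a b \<zero>" "\<lambda>n. a \<oplus> n = b \<oplus> n \<longrightarrow> a = b"], goal_cases)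
    case (5 n) then show ?case using basic(2,4) by metis
  qed (auto simp: basic(3) some_set intro!: d00)
  then show "a \<oplus> n = b \<oplus> n \<Longrightarrow> a = b" by blast
qed

lemma zero_or_suc: "n = \<zero> \<or> (\<exists>k. n = k \<oplus> \<one>)"
  by (rule sigma_induct[of "Ex 1 (Disj (Eq (Var 0) Zero) (Eq (Var 0) (Plus (Var 1) One)))"
      "\<lambda>_. some_set" "env3 \<zero> \<zero> \<zero>" "\<lambda>n. n = \<zero> \<or> (\<exists>k. n = k \<oplus> \<one>)"])
    (auto simp: some_set sigma01_def intro!: d00)

text \<open>The axioms describe the order only by recursion on its right argument; differences give
  it an algebraic form. In the induction the quantifier stands in front of the implication, so that
  the formula is Sigma.\<close>

lemma less_imp_ex: "m \<prec> n \<Longrightarrow> \<exists>k. n = m \<oplus> (k \<oplus> \<one>)"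
proof -
  have "\<exists>k. m \<prec> n \<longrightarrow> n = m \<oplus> (k \<oplus> \<one>)"
  proof (rule sigma_induct[of "Ex 2 (Imp (Less (Var 1) (Var 0)) (Eq (Var 0) (Plus (Var 1) (Plus (Var 2) One))))"
      "\<lambda>_. some_set" "env3 m \<zero> \<zero>" "\<lambda>n. \<exists>k. m \<prec> n \<longrightarrow> n = m \<oplus> (k \<oplus> \<one>)"], goal_cases)
    case (5 n) then show ?case using basic(3,4,8) by metis
  qed (auto simp: some_set sigma01_def basic(7) intro!: d00)
  then show "m \<prec> n \<Longrightarrow> \<exists>k. n = m \<oplus> (k \<oplus> \<one>)" by blast
qed

lemma less_add': "m \<prec> m \<oplus> (k \<oplus> \<one>)"
proof (rule delta0_induct[of "Less (Var 1) (Plus (Var 1) (Plus (Var 0) One))"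
      "\<lambda>_. some_set" "env3 m \<zero> \<zero>" "\<lambda>k. m \<prec> m \<oplus> (k \<oplus> \<one>)"], goal_cases)
  case 4 then show ?case using basic(3,4,8) by metis
next
  case (5 n) then show ?case using basic(4,8) by metis
qed (auto simp: some_set intro!: d00)

lemma less_iff: "m \<prec> n \<longleftrightarrow> (\<exists>k. n = m \<oplus> (k \<oplus> \<one>))"
  using less_imp_ex less_add' by blast

text \<open>In the induction step only n < m needs thought: for a difference k + 1, either k = 0 and
  n + 1 = m, or k is a successor and n + 1 < m.\<close>

lemma linear': "m \<preceq> n \<or> n \<preceq> m"
proof -
  have "m \<prec> n \<or> m = n \<or> n \<prec> m"
  proof (rule delta0_induct[of "Disj (Less (Var 1) (Var 0)) (Disj (Eq (Var 1) (Var 0)) (Less (Var 0) (Var 1)))"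
      "\<lambda>_. some_set" "env3 m \<zero> \<zero>" "\<lambda>n. m \<prec> n \<or> m = n \<or> n \<prec> m"], goal_cases)
    case 4
    then show ?case using zero_or_suc[of m] by (auto simp: less_iff basic(1,3-8) zero_add')
  next
    case (5 n)
    then show ?case
    proof (elim disjE)
      assume "n \<prec> m"
      then obtain k where k: "m = n \<oplus> (k \<oplus> \<one>)" using less_iff by blast
      from zero_or_suc[of k] show ?case
      proof (elim disjE exE)
        assume "k = \<zero>" then show ?case using k zero_add' by simp
      next
        fix l assume "k = l \<oplus> \<one>"
        then have "m = (n \<oplus> \<one>) \<oplus> (l \<oplus> \<one>)" using k by (simp add: add_ac')
        then show ?case using less_iff by blast
      qed
    qed (auto simp: basic(8))
  qed (auto simp: some_set intro!: d00)
  then show ?thesis by (auto simp: le'_def)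
qed

lemma le_iff: "m \<preceq> n \<longleftrightarrow> (\<exists>k. n = m \<oplus> k)"
  unfolding le'_def less_iff by (metis basic(3) zero_or_suc)

text \<open>Subtraction is truncated, as required for an instance of \<^locale>\<open>linordered_semidom\<close>.\<close>

definition minus' (infixl "\<ominus>" 65) where "a \<ominus> b = (if b \<preceq> a then SOME c. a = b \<oplus> c else \<zero>)"

lemma minus_add': "(a \<oplus> b) \<ominus> a = b"
proof -
  have "a \<preceq> a \<oplus> b" using le_iff by blast
  moreover have "(SOME c. a \<oplus> b = a \<oplus> c) = b"
    by (rule some_equality) (simp, metis add_cancel' add_commute')
  ultimately show ?thesis by (simp add: minus'_def)
qed

lemma minus_0': "\<not> b \<preceq> a \<Longrightarrow> a \<ominus> b = \<zero>" by (simp add: minus'_def)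

lemma less_le': "a \<prec> b \<longleftrightarrow> a \<preceq> b \<and> \<not> b \<preceq> a"
proof -
  have irr: "\<not> x \<prec> x" for x
    using less_iff[of x x] by (metis add_cancel' add_commute' basic(1,3))
  have tr: "x \<prec> y \<Longrightarrow> y \<prec> z \<Longrightarrow> x \<prec> z" for x y z
    by (auto simp: less_iff add_assoc') (metis add_assoc')
  show ?thesis using irr tr unfolding le'_def by metis
qed

lemma le_antisym': "x \<preceq> y \<Longrightarrow> y \<preceq> x \<Longrightarrow> x = y"
  using less_le' le'_def by metis

lemma le_trans': "x \<preceq> y \<Longrightarrow> y \<preceq> z \<Longrightarrow> x \<preceq> z"
  by (auto simp: le_iff add_assoc')

lemma add_left_cancel': "a \<oplus> b = a \<oplus> c \<longleftrightarrow> b = c"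
  using add_cancel' add_commute' by metis

lemma diff_diff': "a \<ominus> b \<ominus> c = a \<ominus> (b \<oplus> c)"
proof (cases "b \<preceq> a")
  case True
  then obtain k where a: "a = b \<oplus> k" using le_iff by blast
  have iff: "c \<preceq> k \<longleftrightarrow> b \<oplus> c \<preceq> b \<oplus> k" by (auto simp: le_iff add_assoc' add_left_cancel')
  have "k \<ominus> c = (b \<oplus> k) \<ominus> (b \<oplus> c)"
  proof (cases "c \<preceq> k")
    case True
    then obtain l where l: "k = c \<oplus> l" using le_iff by blast
    show ?thesis unfolding l minus_add' by (metis add_assoc' minus_add')
  next
    case False
    then show ?thesis using iff by (simp add: minus_0')
  qed
  then show ?thesis unfolding a minus_add' .
next
  case False
  moreover have "\<not> b \<oplus> c \<preceq> a" using False by (auto simp: le_iff add_assoc')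
  moreover have "\<zero> \<ominus> c = \<zero>"
  proof (cases "c \<preceq> \<zero>")
    case True
    then have "c = \<zero>" unfolding le'_def using basic(7) by blast
    then show ?thesis using minus_add'[of "\<zero>" "\<zero>"] zero_add' by simp
  qed (simp add: minus_0')
  ultimately show ?thesis by (simp add: minus_0')
qed

lemma mul_zero_iff': "a \<otimes> b = \<zero> \<longleftrightarrow> a = \<zero> \<or> b = \<zero>"
  using zero_or_suc[of a] zero_or_suc[of b] by (auto simp: basic(1,3-8) zero_mul' mul_commute' add_ac')
    (metis add_assoc' basic(1) add_commute')+

lemma right_diff': "a \<otimes> (b \<ominus> c) = a \<otimes> b \<ominus> a \<otimes> c"
proof (cases "c \<preceq> b")
  case True
  then obtain k where "b = c \<oplus> k" using le_iff by blast
  then show ?thesis by (simp add: minus_add' distrib_left')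
next
  case False
  then have "b \<preceq> c" using linear' by blast
  then obtain k where c: "c = b \<oplus> k" using le_iff by blast
  have "x \<ominus> (x \<oplus> y) = \<zero>" for x y
  proof (cases "x \<oplus> y \<preceq> x")
    case True
    then have "x \<oplus> y = x" using le_antisym' le_iff by blast
    then show ?thesis using minus_add'[of x "\<zero>"] basic(3) by simp
  qed (simp add: minus_0')
  then show ?thesis unfolding c by (simp add: distrib_left' basic(5))
qed

text \<open>This makes the HOL library of ordered semirings available for the numbers of an
  arbitrary model.\<close>

sublocale N: linordered_semidom where zero = "\<zero>" and one = "\<one>" and times = "(\<otimes>)" and plus = "(\<oplus>)"
  and minus = "(\<ominus>)" and less_eq = "(\<preceq>)" and less = "(\<prec>)"
proof (unfold_locales, goal_cases)
  case (9 a b c) then show ?case unfolding le_iff using add_assoc' by metis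
next
  case (17 a b c)
  then obtain k l where kl: "b = a \<oplus> (k \<oplus> \<one>)" "c = l \<oplus> \<one>" unfolding less_iff zero_add' by blast
  then have "c \<otimes> (k \<oplus> \<one>) \<noteq> \<zero>" using mul_zero_iff' basic(1) by metis
  then obtain t where "c \<otimes> (k \<oplus> \<one>) = t \<oplus> \<one>" using zero_or_suc by metis
  then have "c \<otimes> b = c \<otimes> a \<oplus> (t \<oplus> \<one>)" unfolding kl(1) distrib_left'[of c a] by simp
  then show ?case using less_iff by blast
next
  case 19 then show ?case using basic(1) zero_add' by metis
next
  case 22 then show ?case using mul_zero_iff' by blast
next
  case 23 then show ?case using less_iff zero_add' by metis
next
  case (24 b a) then show ?case unfolding le_iff using minus_add' add_commute' by metis
qed (fact add_assoc' add_commute' minus_add' diff_diff' less_le' le_trans' le_antisym' linear' zero_add'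
  mul_assoc' mul_commute' distrib' zero_mul' basic one_mul' right_diff' distrib_left' | simp add: le'_def)+

lemma less_Suc [simp]: "x \<prec> y \<oplus> \<one> \<longleftrightarrow> x \<preceq> y"
  by (simp add: basic(8) N.le_less)

lemma Suc_le: "x \<oplus> \<one> \<preceq> y \<longleftrightarrow> x \<prec> y"
  using less_Suc[of y x] N.not_le by blast

lemma zero_le [simp]: "\<zero> \<preceq> x" by (simp add: le_iff zero_add')

section \<open>The pairing function and its projections\<close>

lemma le_square: "x \<preceq> x \<otimes> x"
proof (cases "x = \<zero>")
  case False
  then have "\<one> \<preceq> x" using zero_or_suc[of x] by auto
  then show ?thesis using N.mult_left_mono[of "\<one>" x x] by simp
qed (simp add: le_iff)

text \<open>With s = i + j, the code of (i, j) is at least s^2 and below (s + 1)^2, since i \<le> s.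
  The intervals for different sums are disjoint and ordered like the sums, which also yields
  injectivity.\<close>

lemma pr_less: "i \<oplus> j \<prec> k \<oplus> l \<Longrightarrow> \<langle>i, j\<rangle> \<prec> \<langle>k, l\<rangle>"
proof -
  assume "i \<oplus> j \<prec> k \<oplus> l"
  then have "(i \<oplus> j \<oplus> \<one>) \<otimes> (i \<oplus> j \<oplus> \<one>) \<preceq> (k \<oplus> l) \<otimes> (k \<oplus> l)"
    by (intro N.mult_mono) (auto simp: Suc_le)
  moreover have "(i \<oplus> j) \<otimes> (i \<oplus> j) \<oplus> i \<prec> (i \<oplus> j \<oplus> \<one>) \<otimes> (i \<oplus> j \<oplus> \<one>)"
    unfolding less_iff by (rule exI[of _ "i \<oplus> j \<oplus> j"]) (simp add: algebra_simps)
  ultimately show ?thesis unfolding pr_def by (meson N.less_le_trans N.le_add_same_cancel1 zero_le)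
qed

lemma pr_inj [simp]: "\<langle>i, j\<rangle> = \<langle>k, l\<rangle> \<longleftrightarrow> i = k \<and> j = l"
proof
  assume eq: "\<langle>i, j\<rangle> = \<langle>k, l\<rangle>"
  then have "i \<oplus> j = k \<oplus> l" using pr_less[of i j k l] pr_less[of k l i j]
    by (metis N.neq_iff N.less_irrefl)
  then show "i = k \<and> j = l" using eq by (auto simp: pr_def)
qed auto

lemma le_pr1: "i \<preceq> \<langle>i, j\<rangle>" by (simp add: pr_def)

lemma le_pr2: "j \<preceq> \<langle>i, j\<rangle>"
proof -
  have "j \<preceq> i \<oplus> j" by simp
  also have "\<dots> \<preceq> (i \<oplus> j) \<otimes> (i \<oplus> j)" by (rule le_square)
  also have "\<dots> \<preceq> \<langle>i, j\<rangle>" by (simp add: pr_def)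
  finally show ?thesis .
qed

definition is_pair where "is_pair z \<longleftrightarrow> (\<exists>x y. z = \<langle>x, y\<rangle>)"
definition p1 where "p1 z = (if is_pair z then THE x. \<exists>y. z = \<langle>x, y\<rangle> else \<zero>)"
definition p2 where "p2 z = (if is_pair z then THE y. \<exists>x. z = \<langle>x, y\<rangle> else \<zero>)"

lemma p1_pr [simp]: "p1 \<langle>x, y\<rangle> = x" and p2_pr [simp]: "p2 \<langle>x, y\<rangle> = y"
  and is_pair_pr [simp]: "is_pair \<langle>x, y\<rangle>"
  by (auto simp: p1_def p2_def is_pair_def)

lemma p1_le: "p1 z \<preceq> z"
  using le_pr1 by (cases "is_pair z") (auto simp: is_pair_def p1_def)

lemma p_nonpair: "\<not> is_pair z \<Longrightarrow> p1 z = \<zero>" "\<not> is_pair z \<Longrightarrow> p2 z = \<zero>"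
  by (auto simp: p1_def p2_def)

lemma is_pair_eq: "is_pair z \<longleftrightarrow> z = \<langle>p1 z, p2 z\<rangle>"
  by (metis is_pair_def p1_pr p2_pr)

section \<open>Decidable relations and computable functions\<close>

text \<open>
  These two notions hide the formulas: parameters are arbitrary elements of the model, and relations and
  functions of several arguments are reduced to one argument by composing with the projections
  \<open>p1\<close> and \<open>p2\<close>, which are 0 outside the range of the pairing function.
\<close>

definition dec :: "('m \<Rightarrow> bool) \<Rightarrow> bool" where "dec P \<longleftrightarrow> {x. P x} \<in> sets M"
definition rec :: "('m \<Rightarrow> 'm) \<Rightarrow> bool" where "rec f \<longleftrightarrow> {z. \<exists>x. z = \<langle>x, f x\<rangle>} \<in> sets M"

text \<open>Decoding variable 0 as a pair stays bounded because both components are at most the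
  code; \<open>p\<close> sees them as variables 1 and 2.\<close>

definition PEx :: "fm \<Rightarrow> fm" where
  "PEx p = BEx 1 (Plus (Var 0) One) (BEx 2 (Plus (Var 0) One) (Conj (Eq (Var 0) (Prt (Var 1) (Var 2))) p))"

lemma sat_PEx [simp]:
  "sat M e E (PEx p) \<longleftrightarrow> (\<exists>x y. e 0 = \<langle>x, y\<rangle> \<and> sat M (e(1 := x, 2 := y)) E p)"
  unfolding PEx_def using le_pr1 le_pr2 by auto

lemma delta00_PEx: "delta00 p \<Longrightarrow> delta00 (PEx p)"
  by (auto simp: PEx_def intro!: d00)

lemmas d00' = d00 delta00_PEx

abbreviation "senv A B \<equiv> (\<lambda>_. some_set)(0 := A, Suc 0 := B)"

lemma senv: "A \<in> sets M \<Longrightarrow> B \<in> sets M \<Longrightarrow> senv A B X \<in> sets M"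
  by (auto simp: some_set)

lemma dec_delta0:
  assumes "A \<in> sets M" "B \<in> sets M" "delta00 p"
    and "\<And>n a. sat M (e(0 := n, 9 := a)) (senv A B) p = P n"
  shows "dec P"
  unfolding dec_def by (rule delta0_comprehension[of p "senv A B" e]) (use assms senv in auto)

lemma dec_delta1:
  assumes "A \<in> sets M" "B \<in> sets M" "delta00 p" "delta00 q"
    and "\<And>n. (\<exists>a. sat M (e(0 := n, 9 := a)) (senv A B) p) = P n"
    and "\<And>n. (\<forall>a. sat M (e(0 := n, 9 := a)) (senv A B) q) = P n"
  shows "dec P"
  unfolding dec_def by (rule delta_comprehension[of p q "senv A B" e]) (use assms senv in auto)

named_theorems recs

lemma dec_In [recs]: "A \<in> sets M \<Longrightarrow> dec (\<lambda>x. x \<in> A)"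
  by (simp add: dec_def)

lemma dec_not [recs]: "dec P \<Longrightarrow> dec (\<lambda>x. \<not> P x)"
  by (rule dec_delta0[of "{x. P x}" "{x. P x}" "Neg (In (Var 0) 0)"]) (auto simp: dec_def intro: d00)

lemma dec_and [recs]: "dec P \<Longrightarrow> dec Q \<Longrightarrow> dec (\<lambda>x. P x \<and> Q x)"
  by (rule dec_delta0[of "{x. P x}" "{x. Q x}" "Conj (In (Var 0) 0) (In (Var 0) 1)"]) (auto simp: dec_def intro: d00)

lemma dec_const [recs]: "dec (\<lambda>x. C)"
proof (cases C)
  case True then show ?thesis
    by (intro dec_delta0[of some_set some_set "Eq Zero Zero"]) (auto simp: some_set intro: d00)
next
  case False then show ?thesis
    by (intro dec_delta0[of some_set some_set "Neg (Eq Zero Zero)"]) (auto simp: some_set intro: d00)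
qed

lemma dec_or [recs]: assumes "dec P" "dec Q" shows "dec (\<lambda>x. P x \<or> Q x)"
  using dec_not[OF dec_and[OF dec_not[OF assms(1)] dec_not[OF assms(2)]]] by simp

lemma dec_imp [recs]: assumes "dec P" "dec Q" shows "dec (\<lambda>x. P x \<longrightarrow> Q x)"
  unfolding imp_conv_disj by (intro dec_or dec_not assms)

lemma dec_iff [recs]: assumes "dec P" "dec Q" shows "dec (\<lambda>x. P x \<longleftrightarrow> Q x)"
  unfolding iff_conv_conj_imp by (intro dec_and dec_imp assms)

text \<open>As the graph of \<open>f\<close> is total and single-valued, \<open>P (f x)\<close> says
  that some value on the graph satisfies \<open>P\<close>, and equally that every such value does: a
  Sigma and a Pi form.\<close>

lemma dec_comp: assumes "dec P" "rec f" shows "dec (\<lambda>x. P (f x))"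
  by (rule dec_delta1[of "{z. \<exists>x. z = \<langle>x, f x\<rangle>}" "{x. P x}"
      "Conj (In (Prt (Var 0) (Var 9)) 0) (In (Var 9) 1)" "Imp (In (Prt (Var 0) (Var 9)) 0) (In (Var 9) 1)"])
    (use assms in \<open>auto simp: dec_def rec_def intro!: d00\<close>)

lemma rec_comp: assumes "rec g" "rec f" shows "rec (\<lambda>x. g (f x))"
  unfolding rec_def dec_def[symmetric]
  by (rule dec_delta1[of "{z. \<exists>x. z = \<langle>x, f x\<rangle>}" "{z. \<exists>x. z = \<langle>x, g x\<rangle>}"
      "PEx (Conj (In (Prt (Var 1) (Var 9)) 0) (In (Prt (Var 9) (Var 2)) 1))"
      "Conj (PEx (Eq Zero Zero)) (Neg (PEx (Conj (In (Prt (Var 1) (Var 9)) 0) (Neg (In (Prt (Var 9) (Var 2)) 1)))))"])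
    (use assms in \<open>auto simp: rec_def intro!: d00'\<close>)

text \<open>The two values are bounded by the pair they form, so a single bounded formula defines
  the graph.\<close>

lemma rec_pair [recs]: assumes "rec f" "rec g" shows "rec (\<lambda>x. \<langle>f x, g x\<rangle>)"
  unfolding rec_def dec_def[symmetric]
  by (rule dec_delta0[of "{z. \<exists>x. z = \<langle>x, f x\<rangle>}" "{z. \<exists>x. z = \<langle>x, g x\<rangle>}"
      "PEx (BEx 3 (Plus (Var 2) One) (BEx 4 (Plus (Var 2) One) (Conj (Eq (Var 2) (Prt (Var 3) (Var 4)))
        (Conj (In (Prt (Var 1) (Var 3)) 0) (In (Prt (Var 1) (Var 4)) 1)))))"])
    (use assms le_pr1 le_pr2 in \<open>auto simp: rec_def intro!: d00'\<close>)

lemma rec_id [recs]: "rec (\<lambda>x. x)"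
  unfolding rec_def dec_def[symmetric]
  by (rule dec_delta0[of some_set some_set "PEx (Eq (Var 1) (Var 2))"]) (auto simp: some_set intro!: d00')

lemma rec_const [recs]: "rec (\<lambda>x. c)"
  unfolding rec_def dec_def[symmetric]
  by (rule dec_delta0[of some_set some_set "PEx (Eq (Var 2) (Var 3))" "env3 c c c"]) (auto simp: some_set intro!: d00')

text \<open>A term in the variables 3 and 4 defines a binary function, read as a unary one on pairs.
  Both components are found by bounded search below the argument.\<close>

lemma rec_tm:
  assumes "\<And>e x y. val M (e(3 := x, 4 := y)) t = f \<langle>x, y\<rangle>" "\<And>z. \<not> is_pair z \<Longrightarrow> f z = \<zero>"
  shows "rec f"
  unfolding rec_def dec_def[symmetric]
proof (rule dec_delta0[of some_set some_set
     "PEx (Disj (BEx 3 (Plus (Var 1) One) (BEx 4 (Plus (Var 1) One) (Conj (Eq (Var 1) (Prt (Var 3) (Var 4))) (Eq (Var 2) t))))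
       (Conj (Eq (Var 2) Zero) (Neg (BEx 3 (Plus (Var 1) One) (BEx 4 (Plus (Var 1) One) (Eq (Var 1) (Prt (Var 3) (Var 4))))))))"
      "env3 \<zero> \<zero> \<zero>"], goal_cases)
  case (4 n a)
  show ?case
  proof (cases "\<exists>x y. n = \<langle>x, y\<rangle>")
    case True
    then obtain x y where n: "n = \<langle>x, y\<rangle>" by blast
    show ?thesis
    proof (cases "is_pair x")
      case True
      then obtain u v where x: "x = \<langle>u, v\<rangle>" by (auto simp: is_pair_def)
      have ex: "(\<exists>a. a \<preceq> x \<and> (\<exists>b. b \<preceq> x \<and> x = \<langle>a, b\<rangle> \<and> Q a b)) \<longleftrightarrow> Q u v" for Q
        using le_pr1 le_pr2 by (auto simp: x)
      have neg: "(\<forall>a. a \<preceq> \<langle>u, v\<rangle> \<longrightarrow> (\<forall>b. b \<preceq> \<langle>u, v\<rangle> \<longrightarrow> u = a \<longrightarrow> v \<noteq> b)) \<longleftrightarrow> False"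
        using le_pr1 le_pr2 by blast
      show ?thesis by (simp add: n assms(1) ex) (simp add: x neg)
    next
      case False
      then show ?thesis using n by (auto simp: assms(2) is_pair_def)
    qed
  qed auto
qed (auto simp: some_set intro!: d00')

lemma rec_p1': "rec p1" by (rule rec_tm[of "Var 3"]) (simp_all add: p_nonpair)
lemma rec_p2': "rec p2" by (rule rec_tm[of "Var 4"]) (simp_all add: p_nonpair)

lemma rec_p1 [recs]: "rec f \<Longrightarrow> rec (\<lambda>x. p1 (f x))" by (rule rec_comp[OF rec_p1'])
lemma rec_p2 [recs]: "rec f \<Longrightarrow> rec (\<lambda>x. p2 (f x))" by (rule rec_comp[OF rec_p2'])

lemma dec2: "dec (\<lambda>z. P (p1 z) (p2 z)) \<Longrightarrow> rec f \<Longrightarrow> rec g \<Longrightarrow> dec (\<lambda>x. P (f x) (g x))"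
  by (drule dec_comp[where f = "\<lambda>x. \<langle>f x, g x\<rangle>"]) (auto intro: recs)

lemma rec2: "rec (\<lambda>z. h (p1 z) (p2 z)) \<Longrightarrow> rec f \<Longrightarrow> rec g \<Longrightarrow> rec (\<lambda>x. h (f x) (g x))"
  by (drule rec_comp[where f = "\<lambda>x. \<langle>f x, g x\<rangle>"]) (auto intro: recs)

lemma rec_add [recs]: assumes "rec f" "rec g" shows "rec (\<lambda>x. f x \<oplus> g x)"
  by (rule rec2[OF _ assms], rule rec_tm[of "Plus (Var 3) (Var 4)"]) (simp_all add: p_nonpair)

lemma rec_mul [recs]: assumes "rec f" "rec g" shows "rec (\<lambda>x. f x \<otimes> g x)"
  by (rule rec2[OF _ assms], rule rec_tm[of "Times (Var 3) (Var 4)"]) (simp_all add: p_nonpair)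

lemma dec_mem [recs]: "A \<in> sets M \<Longrightarrow> rec f \<Longrightarrow> dec (\<lambda>x. f x \<in> A)"
  by (rule dec_comp[of "\<lambda>x. x \<in> A"]) (rule recs)

lemma dec_less [recs]: assumes "rec f" "rec g" shows "dec (\<lambda>x. f x \<prec> g x)"
proof -
  have "dec (\<lambda>z. \<exists>x y. z = \<langle>x, y\<rangle> \<and> x \<prec> y)"
    by (rule dec_delta0[of some_set some_set "PEx (Less (Var 1) (Var 2))"]) (auto simp: some_set intro!: d00')
  from dec_comp[OF this rec_pair[OF assms]] show ?thesis by simp
qed

lemma dec_eq [recs]: assumes "rec f" "rec g" shows "dec (\<lambda>x. f x = g x)"
proof -
  have "(\<lambda>x. f x = g x) = (\<lambda>x. \<not> f x \<prec> g x \<and> \<not> g x \<prec> f x)" by (auto simp: fun_eq_iff N.neq_iff)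
  then show ?thesis by (simp only:) (intro recs assms)
qed

lemma dec_le [recs]: assumes "rec f" "rec g" shows "dec (\<lambda>x. f x \<preceq> g x)"
  using dec_not[OF dec_less[OF assms(2,1)]] by (simp add: N.not_less)

text \<open>The bound \<open>b x\<close> is not a term of the language. Its value is quantified over
  and pinned down by the graph of \<open>b\<close>, once existentially and once universally.\<close>

lemma dec_ball [recs]:
  assumes "dec (\<lambda>z. Q (p1 z) (p2 z))" "rec b"
  shows "dec (\<lambda>x. \<forall>y. y \<prec> b x \<longrightarrow> Q x y)"
  by (rule dec_delta1[of "{z. \<exists>x. z = \<langle>x, b x\<rangle>}" "{z. Q (p1 z) (p2 z)}"
      "Conj (In (Prt (Var 0) (Var 9)) 0) (BAll 1 (Var 9) (In (Prt (Var 0) (Var 1)) 1))"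
      "Imp (In (Prt (Var 0) (Var 9)) 0) (BAll 1 (Var 9) (In (Prt (Var 0) (Var 1)) 1))"])
    (use assms in \<open>auto simp: dec_def rec_def intro!: d00'\<close>)

lemma dec_bex [recs]:
  assumes "dec (\<lambda>z. Q (p1 z) (p2 z))" "rec b"
  shows "dec (\<lambda>x. \<exists>y. y \<prec> b x \<and> Q x y)"
  using dec_not[OF dec_ball[where Q = "\<lambda>x y. \<not> Q x y", OF dec_not[OF assms(1)] assms(2)]] by simp

lemma dec_is_pair [recs]: assumes "rec f" shows "dec (\<lambda>x. is_pair (f x))"
  unfolding is_pair_eq by (intro recs assms)

text \<open>The usual route to computability: existence and uniqueness of the value may be proved by
  any means, and only the graph has to be decidable.\<close>

lemma rec_graph:
  assumes "dec (\<lambda>z. Q (p1 z) (p2 z))" "\<And>x y. Q x y \<longleftrightarrow> y = f x"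
  shows "rec f"
proof -
  have "dec (\<lambda>z. is_pair z \<and> Q (p1 z) (p2 z))" by (intro recs assms)
  moreover have "{z. is_pair z \<and> Q (p1 z) (p2 z)} = {z. \<exists>x. z = \<langle>x, f x\<rangle>}"
    using assms(2) by (auto simp: is_pair_def)
  ultimately show ?thesis by (simp add: dec_def rec_def)
qed

lemma rec_if [recs]:
  assumes "dec P" "rec f" "rec g" shows "rec (\<lambda>x. if P x then f x else g x)"
proof (rule rec_graph[of "\<lambda>x y. P x \<and> y = f x \<or> \<not> P x \<and> y = g x"])
  have "dec (\<lambda>z. P (p1 z))" "rec (\<lambda>z. f (p1 z))" "rec (\<lambda>z. g (p1 z))"
    using assms dec_comp rec_comp rec_p1' by blast+
  then show "dec (\<lambda>z. P (p1 z) \<and> p2 z = f (p1 z) \<or> \<not> P (p1 z) \<and> p2 z = g (p1 z))"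
    by (intro recs)
qed auto

lemma dec_induct [case_names dec zero suc]:
  assumes "dec P" "P \<zero>" "\<And>n. P n \<Longrightarrow> P (n \<oplus> \<one>)" shows "P n"
  by (rule delta0_induct[of "In (Var 0) 0" "senv {x. P x} {x. P x}" "env3 \<zero> \<zero> \<zero>" P])
    (use assms in \<open>auto simp: dec_def some_set intro!: d00\<close>)

text \<open>Induction on an unbounded existence statement with decidable matrix. It constructs
  objects by recursion without a recursion theorem; several witnesses are packed into one
  pair.\<close>

lemma sigma_induct' [case_names dec zero suc]:
  assumes "dec (\<lambda>z. Q (p1 z) (p2 z))" "\<exists>y. Q \<zero> y" "\<And>n y. Q n y \<Longrightarrow> \<exists>y. Q (n \<oplus> \<one>) y"
  shows "\<exists>y. Q n y"
  by (rule sigma_induct[of "Ex 1 (In (Prt (Var 0) (Var 1)) 0)" "senv {z. Q (p1 z) (p2 z)} some_set" "env3 \<zero> \<zero> \<zero>"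
     "\<lambda>n. \<exists>y. Q n y"])
    (use assms in \<open>auto simp: dec_def some_set sigma01_def intro!: d00\<close>)

text \<open>The least number principle: without a least element, induction shows that
  \<open>P\<close> fails below every number.\<close>

lemma dec_least:
  assumes "dec P" "P n" shows "\<exists>m. P m \<and> (\<forall>k. k \<prec> m \<longrightarrow> \<not> P k)"
proof (rule ccontr)
  assume no: "\<not> ?thesis"
  have "dec (\<lambda>z. P (p2 z))" using assms dec_comp rec_p2' by blast
  then have "dec (\<lambda>n. \<forall>k. k \<prec> n \<longrightarrow> \<not> P k)" by (intro recs)
  then have "\<forall>k. k \<prec> n \<oplus> \<one> \<longrightarrow> \<not> P k"
    by (rule dec_induct) (use no in \<open>auto simp: N.le_less basic(7)\<close>)
  then show False using assms(2) by auto
qed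

section \<open>Decidability of divisibility and of set codes\<close>

lemma pos_iff: "\<zero> \<prec> d \<longleftrightarrow> d \<noteq> \<zero>"
  using zero_le[of d] basic(7) by (auto simp: N.le_less)

lemma less_one [simp]: "j \<prec> \<one> \<longleftrightarrow> j = \<zero>"
  using basic(8)[of j "\<zero>"] basic(7) zero_add' by simp

lemma less_add1: "x \<prec> y \<Longrightarrow> x \<prec> y \<oplus> z" and less_add2: "x \<prec> y \<Longrightarrow> x \<prec> z \<oplus> y"
  and le_add1: "x \<preceq> y \<Longrightarrow> x \<preceq> y \<oplus> z" and le_add2: "x \<preceq> y \<Longrightarrow> x \<preceq> z \<oplus> y"
  by (meson N.less_le_trans N.order_trans N.le_add_same_cancel1 N.le_add_same_cancel2 zero_le)+

text \<open>A bound on the quotient makes divisibility decidable. For d = 0 also n = 0, and the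
  quotient 0 serves; otherwise every quotient is at most n.\<close>

lemma dvides_iff: "dvides M d n \<longleftrightarrow> (\<exists>q. q \<prec> n \<oplus> \<one> \<and> n = d \<otimes> q)"
proof
  assume "dvides M d n"
  then obtain q where q: "n = d \<otimes> q" by (auto simp: dvides_def)
  show "\<exists>q. q \<prec> n \<oplus> \<one> \<and> n = d \<otimes> q"
  proof (cases "d = \<zero>")
    case True
    then show ?thesis using q by (intro exI[of _ "\<zero>"]) simp
  next
    case False
    then obtain k where "d = k \<oplus> \<one>" using zero_or_suc by blast
    then have "n = k \<otimes> q \<oplus> q" using q by (simp add: algebra_simps)
    then have "q \<preceq> n" by simp
    then show ?thesis using q by auto
  qed
qed (auto simp: dvides_def)

lemma dec_dvides [recs]: "rec f \<Longrightarrow> rec g \<Longrightarrow> dec (\<lambda>x. dvides M (f x) (g x))"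
  by (rule dec2) (unfold dvides_iff, intro recs)

lemma dvides_mult: "dvides M d n \<Longrightarrow> dvides M d (n \<otimes> k)" "dvides M d n \<Longrightarrow> dvides M d (k \<otimes> n)"
  "dvides M d d"
  unfolding dvides_def by (metis mul_assoc') (metis mul_assoc' mul_commute', metis N.mult_1_right)

lemma elems_iff: "i \<in> elems M c \<longleftrightarrow> c = \<langle>p1 c, \<langle>p1 (p2 c), p2 (p2 c)\<rangle>\<rangle> \<and> i \<prec> p1 c \<and>
   dvides M (p1 (p2 c) \<otimes> (i \<oplus> \<one>) \<oplus> \<one>) (p2 (p2 c))"
  unfolding elems_def mem_Collect_eq by (metis p1_pr p2_pr)

lemma triple_iff: "triple M c \<longleftrightarrow> c = \<langle>p1 c, \<langle>p1 (p2 c), p2 (p2 c)\<rangle>\<rangle>"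
  unfolding triple_def by (metis p1_pr p2_pr)

lemma elems_less: "i \<in> elems M c \<Longrightarrow> i \<prec> c"
  unfolding elems_iff using p1_le N.less_le_trans by blast

lemma dec_elems [recs]: "rec f \<Longrightarrow> rec g \<Longrightarrow> dec (\<lambda>x. f x \<in> elems M (g x))"
  by (rule dec2) (unfold elems_iff, intro recs)

text \<open>Elements are smaller than their code. So for c' < c both sets lie below c, and comparing
  them is a bounded check.\<close>

lemma fin_code_iff: "fin_code M c \<longleftrightarrow> triple M c \<and>
    (\<forall>c'. c' \<prec> c \<longrightarrow> triple M c' \<longrightarrow> \<not> (\<forall>i. i \<prec> c \<longrightarrow> (i \<in> elems M c' \<longleftrightarrow> i \<in> elems M c)))"
  unfolding fin_code_def set_eq_iff using elems_less N.less_trans by metis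

lemma dec_fin_code [recs]: "rec f \<Longrightarrow> dec (\<lambda>x. fin_code M (f x))"
  by (rule dec_comp) (unfold fin_code_iff triple_iff, intro recs)

section \<open>Coding of finite sets\<close>

text \<open>v n = 1 modulo d, without negative numbers. This replaces coprimality, as it comes with
  an explicit witness and is closed under products.\<close>

definition invertible_mod where "invertible_mod n d \<longleftrightarrow> (\<exists>v u. v \<otimes> n = u \<otimes> d \<oplus> \<one>)"

lemma division: "d \<noteq> \<zero> \<Longrightarrow> \<exists>q r. r \<prec> d \<and> n = q \<otimes> d \<oplus> r"
proof -
  assume d: "d \<noteq> \<zero>"
  have "\<exists>z. p2 z \<prec> d \<and> n = p1 z \<otimes> d \<oplus> p2 z"
  proof (induction n rule: sigma_induct')
    case dec
    show ?case by (intro recs)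
  next
    case zero
    then show ?case using d by (intro exI[of _ "\<langle>\<zero>, \<zero>\<rangle>"]) (simp add: pos_iff)
  next
    case (suc n z)
    show ?case
    proof (cases "p2 z \<oplus> \<one> \<prec> d")
      case True
      then show ?thesis using suc by (intro exI[of _ "\<langle>p1 z, p2 z \<oplus> \<one>\<rangle>"]) (simp add: algebra_simps)
    next
      case False
      then have "p2 z \<oplus> \<one> = d" using suc Suc_le N.not_less le_antisym' by metis
      moreover have "n \<oplus> \<one> = p1 z \<otimes> d \<oplus> (p2 z \<oplus> \<one>)" using suc add_assoc' by metis
      ultimately have "n \<oplus> \<one> = (p1 z \<oplus> \<one>) \<otimes> d \<oplus> \<zero>" by (simp add: distrib')
      moreover have "\<zero> \<prec> d" using d zero_le by (metis N.le_less)
      ultimately show ?thesis by (intro exI[of _ "\<langle>p1 z \<oplus> \<one>, \<zero>\<rangle>"]) simp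
    qed
  qed
  then show ?thesis by blast
qed

text \<open>Bounding the witnesses makes invertibility decidable, so that it may occur in an induction formula.\<close>

lemma invertible_mod_iff:
  assumes "\<one> \<prec> d"
  shows "invertible_mod n d \<longleftrightarrow> (\<exists>v. v \<prec> d \<and> (\<exists>u. u \<prec> v \<otimes> n \<oplus> \<one> \<and> v \<otimes> n = u \<otimes> d \<oplus> \<one>))"
proof
  assume "invertible_mod n d"
  then obtain v u where vu: "v \<otimes> n = u \<otimes> d \<oplus> \<one>" by (auto simp: invertible_mod_def)
  obtain q r where qr: "r \<prec> d" "v = q \<otimes> d \<oplus> r" using division assms by (metis basic(7))
  \<comment> \<open>Reducing v modulo d lowers u by q n, which must not go below zero: otherwise (u
    + 1) d \<le> v n = u d + 1, contrary to d > 1.\<close>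
  have "q \<otimes> n \<preceq> u"
  proof (rule ccontr)
    assume "\<not> ?thesis"
    then have "u \<oplus> \<one> \<preceq> q \<otimes> n" by (simp add: Suc_le N.not_le)
    then have "(u \<oplus> \<one>) \<otimes> d \<preceq> (q \<otimes> n) \<otimes> d" by (intro N.mult_right_mono) auto
    also have "\<dots> \<preceq> v \<otimes> n" by (simp add: qr algebra_simps)
    finally show False using assms vu by (simp add: algebra_simps N.not_less[symmetric])
  qed
  then obtain u' where u': "u = q \<otimes> n \<oplus> u'" using le_iff by blast
  have "q \<otimes> n \<otimes> d \<oplus> r \<otimes> n = q \<otimes> n \<otimes> d \<oplus> (u' \<otimes> d \<oplus> \<one>)"
    using vu unfolding qr u' by (simp add: algebra_simps)
  then have eq: "r \<otimes> n = u' \<otimes> d \<oplus> \<one>" by simp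
  have "u' \<otimes> \<one> \<preceq> u' \<otimes> d" using assms by (intro N.mult_left_mono) auto
  then have "u' \<preceq> r \<otimes> n" unfolding eq by (simp add: le_iff) (metis add_assoc')
  then show "\<exists>v. v \<prec> d \<and> (\<exists>u. u \<prec> v \<otimes> n \<oplus> \<one> \<and> v \<otimes> n = u \<otimes> d \<oplus> \<one>)"
    using eq qr by (intro exI[of _ r] exI[of _ u'] conjI) auto
qed (auto simp: invertible_mod_def)

lemma invertible_mod_mult:
  assumes "invertible_mod n d" "invertible_mod n' d" shows "invertible_mod (n \<otimes> n') d"
proof -
  obtain v u v' u' where e: "v \<otimes> n = u \<otimes> d \<oplus> \<one>" "v' \<otimes> n' = u' \<otimes> d \<oplus> \<one>"
    using assms by (auto simp: invertible_mod_def)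
  have "(v \<otimes> v') \<otimes> (n \<otimes> n') = (v \<otimes> n) \<otimes> (v' \<otimes> n')" by (simp add: algebra_simps)
  also have "\<dots> = (u \<otimes> u' \<otimes> d \<oplus> u \<oplus> u') \<otimes> d \<oplus> \<one>" unfolding e by (simp add: algebra_simps)
  finally show ?thesis unfolding invertible_mod_def by blast
qed

text \<open>Modulo n the equation v n = u d + 1 says that u d = -1. Squaring removes the sign, so u
  u d inverts d.\<close>

lemma invertible_mod_sym:
  assumes "invertible_mod n d" "\<one> \<prec> n" shows "invertible_mod d n"
proof -
  obtain v u where e: "v \<otimes> n = u \<otimes> d \<oplus> \<one>" using assms by (auto simp: invertible_mod_def)
  have "u \<otimes> d \<noteq> \<zero>"
  proof
    assume "u \<otimes> d = \<zero>"
    then have 1: "v \<otimes> n = \<one>" using e by simp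
    then have "v \<noteq> \<zero>" by auto
    then obtain k where "v = k \<oplus> \<one>" using zero_or_suc by blast
    then have "n \<preceq> v \<otimes> n" by (simp add: algebra_simps)
    then show False using 1 assms(2) by (simp add: N.not_less[symmetric])
  qed
  then obtain s where s: "u \<otimes> d = s \<oplus> \<one>" using zero_or_suc by blast
  have "(u \<otimes> u \<otimes> d) \<otimes> d = (u \<otimes> d) \<otimes> (u \<otimes> d)" by (simp add: algebra_simps)
  also have "\<dots> = s \<otimes> (u \<otimes> d \<oplus> \<one>) \<oplus> \<one>" unfolding s by (simp add: algebra_simps del: N.one_add_one)
  also have "\<dots> = (s \<otimes> v) \<otimes> n \<oplus> \<one>" unfolding e[symmetric] by (simp add: algebra_simps)
  finally show ?thesis unfolding invertible_mod_def by blast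
qed

text \<open>Otherwise u d + 1 would be a multiple of d, although it lies strictly between u d and (u
  + 1) d.\<close>

lemma invertible_not_dvides:
  assumes "invertible_mod n d" "\<one> \<prec> d" shows "\<not> dvides M d n"
proof
  assume "dvides M d n"
  then obtain q v u where e: "v \<otimes> (d \<otimes> q) = u \<otimes> d \<oplus> \<one>" using assms by (auto simp: invertible_mod_def dvides_def)
  have "\<not> v \<otimes> q \<preceq> u"
  proof
    assume "v \<otimes> q \<preceq> u"
    then have "(v \<otimes> q) \<otimes> d \<preceq> u \<otimes> d" by (intro N.mult_right_mono) auto
    then have "u \<otimes> d \<oplus> \<one> \<preceq> u \<otimes> d" using e by (simp add: algebra_simps)
    then show False by (simp add: Suc_le)
  qed
  then have "u \<oplus> \<one> \<preceq> v \<otimes> q" by (simp add: Suc_le N.not_le)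
  then have "(u \<oplus> \<one>) \<otimes> d \<preceq> (v \<otimes> q) \<otimes> d" by (intro N.mult_right_mono) auto
  then have "u \<otimes> d \<oplus> d \<preceq> u \<otimes> d \<oplus> \<one>" using e by (simp add: algebra_simps)
  then show False using assms(2) by (simp add: N.not_less[symmetric])
qed

text \<open>
  With \<open>w = m (i + 1)\<close> the modulus is \<open>w + 1\<close>, so that \<open>w \<equiv> -1\<close> and \<open>w\<^sup>2 \<equiv> 1\<close>; for \<open>l = i + E\<close> and
  \<open>m = E q\<close> the inverse of \<open>m (l + 1) + 1 \<equiv> m E\<close> is therefore \<open>q (i + 1)\<^sup>2\<close>.
\<close>

lemma invertible_beta:
  assumes "i \<prec> l" "l \<prec> k" "m \<noteq> \<zero>" "\<And>j. j \<noteq> \<zero> \<Longrightarrow> j \<prec> k \<Longrightarrow> dvides M j m"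
  shows "invertible_mod (m \<otimes> (l \<oplus> \<one>) \<oplus> \<one>) (m \<otimes> (i \<oplus> \<one>) \<oplus> \<one>)"
proof -
  obtain E where E: "l = i \<oplus> E" "E \<noteq> \<zero>" using assms(1) unfolding less_iff by (metis basic(1))
  have "E \<preceq> l" using E by simp
  then obtain q where q: "m = E \<otimes> q" using assms(2,4) E(2) N.le_less_trans unfolding dvides_def by blast
  define w where "w = q \<otimes> E \<otimes> (i \<oplus> \<one>)"
  have "w \<noteq> \<zero>" using assms(3) q by (auto simp: w_def basic(1))
  then obtain w' where w': "w = w' \<oplus> \<one>" using zero_or_suc by blast
  have d: "m \<otimes> (i \<oplus> \<one>) \<oplus> \<one> = w \<oplus> \<one>" by (simp add: w_def q algebra_simps)
  have "(q \<otimes> (i \<oplus> \<one>) \<otimes> (i \<oplus> \<one>)) \<otimes> (m \<otimes> (l \<oplus> \<one>) \<oplus> \<one>)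
     = (q \<otimes> (i \<oplus> \<one>) \<otimes> (i \<oplus> \<one>)) \<otimes> (m \<otimes> (i \<oplus> \<one>) \<oplus> \<one>) \<oplus> (q \<otimes> (i \<oplus> \<one>) \<otimes> (i \<oplus> \<one>)) \<otimes> (m \<otimes> E)"
    by (simp add: E algebra_simps)
  also have "(q \<otimes> (i \<oplus> \<one>) \<otimes> (i \<oplus> \<one>)) \<otimes> (m \<otimes> E) = w \<otimes> w" by (simp add: w_def q algebra_simps)
  also have "w \<otimes> w = w' \<otimes> (w \<oplus> \<one>) \<oplus> \<one>" by (simp add: w' algebra_simps del: N.one_add_one)
  finally have "(q \<otimes> (i \<oplus> \<one>) \<otimes> (i \<oplus> \<one>)) \<otimes> (m \<otimes> (l \<oplus> \<one>) \<oplus> \<one>) =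
     (q \<otimes> (i \<oplus> \<one>) \<otimes> (i \<oplus> \<one>) \<oplus> w') \<otimes> (m \<otimes> (i \<oplus> \<one>) \<oplus> \<one>) \<oplus> \<one>"
    unfolding d by (simp add: algebra_simps)
  then show ?thesis unfolding invertible_mod_def by blast
qed

text \<open>A stand-in for the factorial: Sigma induction multiplies an earlier common multiple by
  the next nonzero number.\<close>

lemma common_multiple: "\<exists>m. m \<noteq> \<zero> \<and> (\<forall>j. j \<prec> k \<longrightarrow> j \<noteq> \<zero> \<longrightarrow> dvides M j m)"
proof (induction k rule: sigma_induct')
  case dec show ?case by (intro recs)
next
  case zero show ?case by (intro exI[of _ "\<one>"]) (simp add: basic(7))
next
  case (suc k m)
  show ?case
  proof (cases "k = \<zero>")
    case True
    then show ?thesis using suc by (intro exI[of _ m]) (auto simp: N.le_less basic(7))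
  next
    case False
    then show ?thesis using suc by (intro exI[of _ "m \<otimes> k"]) (auto simp: N.le_less dvides_mult)
  qed
qed

text \<open>Goedel's beta function: n is the product of the moduli \<open>d i\<close> for the
  members i of A. The induction also carries invertibility of the product modulo all other
  \<open>d i\<close>; this excludes divisibility and, unlike mere non-divisibility, passes to
  products.\<close>

lemma code_exists:
  assumes "A \<in> sets M" "\<And>i. i \<in> A \<Longrightarrow> i \<prec> k"
  shows "\<exists>c. triple M c \<and> elems M c = A"
proof -
  obtain m where m: "m \<noteq> \<zero>" "\<And>j. j \<prec> k \<Longrightarrow> j \<noteq> \<zero> \<Longrightarrow> dvides M j m" using common_multiple by blast
  define d where "d i = m \<otimes> (i \<oplus> \<one>) \<oplus> \<one>" for i
  have d1: "\<one> \<prec> d i" for i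
  proof -
    have "m \<otimes> (i \<oplus> \<one>) \<noteq> \<zero>" using m basic(1) by simp
    then obtain s where "m \<otimes> (i \<oplus> \<one>) = s \<oplus> \<one>" using zero_or_suc by blast
    then show ?thesis unfolding d_def less_iff by (intro exI[of _ s]) (simp add: algebra_simps)
  qed
  define inv where "inv n i \<longleftrightarrow> invertible_mod n (d i)" for n i
  have inv_iff: "inv n i \<longleftrightarrow> (\<exists>v. v \<prec> d i \<and> (\<exists>u. u \<prec> v \<otimes> n \<oplus> \<one> \<and> v \<otimes> n = u \<otimes> d i \<oplus> \<one>))" for n i
    unfolding inv_def by (rule invertible_mod_iff[OF d1])
  have "\<exists>n. \<forall>i. i \<prec> k \<longrightarrow> (i \<prec> l \<and> i \<in> A \<longrightarrow> dvides M (d i) n) \<and> (\<not> (i \<prec> l \<and> i \<in> A) \<longrightarrow> inv n i)" for l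
  proof (induction l rule: sigma_induct')
    case dec show ?case unfolding inv_iff d_def by (intro recs assms)
  next
    case zero
    have "inv \<one> i" for i unfolding inv_def invertible_mod_def by (intro exI[of _ \<one>] exI[of _ \<zero>]) simp
    then show ?case by (intro exI[of _ \<one>]) (simp add: basic(7))
  next
    case (suc l n)
    show ?case
    proof (cases "l \<in> A")
      case True
      then have l: "l \<prec> k" using assms by auto
      have i: "inv (d l) i" if "i \<noteq> l" "i \<prec> k" for i
      proof (cases "i \<prec> l")
        case True
        then show ?thesis unfolding inv_def d_def using l m by (intro invertible_beta[of i l k]) auto
      next
        case False
        then have "l \<prec> i" using that N.neq_iff by blast
        \<comment> \<open>\<open>invertible_beta\<close> inverts the larger modulus modulo the
          smaller one; the other direction needs symmetry.\<close>
        then have "invertible_mod (d i) (d l)" unfolding inv_def d_def using that m by (intro invertible_beta[of l i k]) auto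
        then show ?thesis unfolding inv_def using invertible_mod_sym d1 by blast
      qed
      show ?thesis
      proof (intro exI[of _ "n \<otimes> d l"] allI impI conjI)
        fix i assume "i \<prec> k" "i \<prec> l \<oplus> \<one> \<and> i \<in> A"
        then show "dvides M (d i) (n \<otimes> d l)" using suc by (auto simp: N.le_less intro: dvides_mult)
      next
        fix i assume "i \<prec> k" "\<not> (i \<prec> l \<oplus> \<one> \<and> i \<in> A)"
        then show "inv (n \<otimes> d l) i" using suc i[of i] True invertible_mod_mult unfolding inv_def
          by (auto simp: N.le_less)
      qed
    next
      case False
      then show ?thesis using suc by (intro exI[of _ n]) (auto simp: N.le_less)
    qed
  qed
  from this[of k] obtain n where n: "\<And>i. i \<prec> k \<Longrightarrow> i \<in> A \<Longrightarrow> dvides M (d i) n"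
    "\<And>i. i \<prec> k \<Longrightarrow> i \<notin> A \<Longrightarrow> inv n i" by blast
  have "elems M \<langle>k, \<langle>m, n\<rangle>\<rangle> = A"
  proof (intro set_eqI iffI)
    fix i assume "i \<in> elems M \<langle>k, \<langle>m, n\<rangle>\<rangle>"
    then have "i \<prec> k" "dvides M (d i) n" by (auto simp: elems_iff d_def)
    then show "i \<in> A" using n(2) invertible_not_dvides[OF _ d1] unfolding inv_def by blast
  next
    fix i assume "i \<in> A"
    then show "i \<in> elems M \<langle>k, \<langle>m, n\<rangle>\<rangle>" using n(1) assms by (auto simp: elems_iff d_def)
  qed
  then show ?thesis by (intro exI[of _ "\<langle>k, \<langle>m, n\<rangle>\<rangle>"]) (auto simp: triple_def)
qed

section \<open>Finite sets of the model and their codes\<close>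

definition fin where "fin A \<longleftrightarrow> A \<in> sets M \<and> (\<exists>k. \<forall>i\<in>A. i \<prec> k)"

lemma finI: "dec (\<lambda>x. x \<in> A) \<Longrightarrow> (\<And>x. x \<in> A \<Longrightarrow> x \<prec> k) \<Longrightarrow> fin A"
  by (auto simp: fin_def dec_def)

lemma fin_Collect: "dec P \<Longrightarrow> (\<And>x. P x \<Longrightarrow> x \<prec> k) \<Longrightarrow> fin {x. P x}"
  by (rule finI) auto

lemma fin_empty [simp]: "fin {}"
  by (rule finI) (auto intro: recs)

lemma fin_elems [simp]: "fin (elems M c)"
  by (rule finI[of _ c]) (auto intro: recs elems_less)

lemma fin_code_unique: "fin_code M c \<Longrightarrow> fin_code M c' \<Longrightarrow> elems M c = elems M c' \<Longrightarrow> c = c'"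
  unfolding fin_code_def using N.neq_iff by metis

text \<open>Some triple codes A by the beta function, and the least one is the code required by
  \<open>fin_code\<close>. The least number principle applies since c + k bounds both sets, so that
  \<open>elems M c = A\<close> is decidable.\<close>

lemma fin_code_exists: assumes "fin A" shows "\<exists>c. fin_code M c \<and> elems M c = A"
proof -
  obtain k where k: "\<And>i. i \<in> A \<Longrightarrow> i \<prec> k" and A: "A \<in> sets M" using assms fin_def by auto
  have iff: "triple M c \<and> elems M c = A \<longleftrightarrow> triple M c \<and> (\<forall>i. i \<prec> c \<oplus> k \<longrightarrow> (i \<in> elems M c \<longleftrightarrow> i \<in> A))" for c
    unfolding set_eq_iff using elems_less k by (metis less_add1 less_add2)
  have "dec (\<lambda>c. triple M c \<and> elems M c = A)" unfolding iff unfolding triple_iff by (intro recs A)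
  from dec_least[OF this] code_exists[OF A k] show ?thesis unfolding fin_code_def by metis
qed

lemma code_of: assumes "fin A" shows fin_code_code_of: "fin_code M (code_of M A)" and elems_code_of [simp]: "elems M (code_of M A) = A"
proof -
  obtain c where "fin_code M c \<and> elems M c = A" using assms fin_code_exists by blast
  then have "fin_code M (code_of M A) \<and> elems M (code_of M A) = A"
    unfolding code_of_def by (rule theI[where a = c]) (metis fin_code_unique \<open>fin_code M c \<and> elems M c = A\<close>)
  then show "fin_code M (code_of M A)" "elems M (code_of M A) = A" by auto
qed

lemma code_of_elems [simp]: "fin_code M c \<Longrightarrow> code_of M (elems M c) = c"
  using fin_code_unique code_of fin_elems by metis

text \<open>Set-valued constructions become computable in this way: whether c is the code of the set
  is decided by comparing members below \<open>b x\<close> + c.\<close>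

lemma rec_code_of [recs]:
  assumes "dec (\<lambda>z. P (p1 z) (p2 z))" "rec b"
  shows "rec (\<lambda>x. code_of M {y. y \<prec> b x \<and> P x y})"
proof (rule rec_graph[of "\<lambda>x c. fin_code M c \<and> (\<forall>y. y \<prec> b x \<oplus> c \<longrightarrow> (y \<in> elems M c \<longleftrightarrow> y \<prec> b x \<and> P x y))"])
  have "rec (\<lambda>z. b (p1 z))" using assms(2) rec_comp rec_p1' by blast
  moreover have "dec (\<lambda>u. P (p1 (p1 u)) (p2 u))"
    by (rule dec2[OF assms(1)]) (intro recs)+
  moreover have "rec (\<lambda>z. b (p1 (p1 z)))" using calculation(1) rec_comp rec_p1' by blast
  ultimately show "dec (\<lambda>z. fin_code M (p2 z) \<and> (\<forall>y. y \<prec> b (p1 z) \<oplus> p2 z \<longrightarrow> (y \<in> elems M (p2 z) \<longleftrightarrow> y \<prec> b (p1 z) \<and> P (p1 z) y)))"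
    by (intro recs)
next
  fix x c
  have "dec (\<lambda>y. P x y)" by (rule dec2[OF assms(1)]) (intro recs)+
  then have fin: "fin {y. y \<prec> b x \<and> P x y}" by (intro fin_Collect[of _ "b x"] recs) auto
  have iff: "(\<forall>y. y \<prec> b x \<oplus> c \<longrightarrow> (y \<in> elems M c \<longleftrightarrow> y \<prec> b x \<and> P x y)) \<longleftrightarrow> elems M c = {y. y \<prec> b x \<and> P x y}"
    unfolding set_eq_iff mem_Collect_eq using elems_less by (metis less_add1 less_add2)
  have "fin_code M c \<and> elems M c = A \<longleftrightarrow> c = code_of M A" if "fin A" for A
    using code_of[OF that] code_of_elems by auto
  from this[OF fin]
  show "(fin_code M c \<and> (\<forall>y. y \<prec> b x \<oplus> c \<longrightarrow> (y \<in> elems M c \<longleftrightarrow> y \<prec> b x \<and> P x y))) \<longleftrightarrow> c = code_of M {y. y \<prec> b x \<and> P x y}"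
    unfolding iff .
qed

text \<open>A description operator with default value 0. With a bound on the candidates it is
  computable, because existence and uniqueness can be decided by search.\<close>

definition the0 :: "('m \<Rightarrow> bool) \<Rightarrow> 'm" where "the0 P = (if \<exists>!y. P y then THE y. P y else \<zero>)"

lemma the0_eq: "P y \<Longrightarrow> (\<And>y'. P y' \<Longrightarrow> y' = y) \<Longrightarrow> the0 P = y"
  unfolding the0_def by (metis the_equality)

lemma rec_the0:
  assumes "dec (\<lambda>z. P (p1 z) (p2 z))" "rec b" and less: "\<And>x y. P x y \<Longrightarrow> y \<prec> b x"
  shows "rec (\<lambda>x. the0 (P x))"
proof (rule rec_graph[of "\<lambda>x y. P x y \<and> (\<forall>y'. y' \<prec> b x \<longrightarrow> P x y' \<longrightarrow> y' = y) \<or>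
    y = \<zero> \<and> \<not> (\<exists>y. y \<prec> b x \<and> (P x y \<and> (\<forall>y'. y' \<prec> b x \<longrightarrow> P x y' \<longrightarrow> y' = y)))"])
  have P: "dec (\<lambda>z. P (f z) (g z))" if "rec f" "rec g" for f g by (rule dec2[OF assms(1) that])
  have b: "rec (\<lambda>z. b (f z))" if "rec f" for f using assms(2) that rec_comp by blast
  show "dec (\<lambda>z. P (p1 z) (p2 z) \<and> (\<forall>y'. y' \<prec> b (p1 z) \<longrightarrow> P (p1 z) y' \<longrightarrow> y' = p2 z) \<or>
    p2 z = \<zero> \<and> \<not> (\<exists>y. y \<prec> b (p1 z) \<and> (P (p1 z) y \<and> (\<forall>y'. y' \<prec> b (p1 z) \<longrightarrow> P (p1 z) y' \<longrightarrow> y' = y))))"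
    by (intro recs P b)
next
  fix x y
  show "(P x y \<and> (\<forall>y'. y' \<prec> b x \<longrightarrow> P x y' \<longrightarrow> y' = y) \<or>
    y = \<zero> \<and> \<not> (\<exists>y. y \<prec> b x \<and> (P x y \<and> (\<forall>y'. y' \<prec> b x \<longrightarrow> P x y' \<longrightarrow> y' = y)))) \<longleftrightarrow> y = the0 (P x)"
  proof (cases "\<exists>!y. P x y")
    case True
    then obtain t where t: "P x t" "\<And>y. P x y \<Longrightarrow> y = t" by blast
    then have "the0 (P x) = t" by (intro the0_eq)
    then show ?thesis using t less by metis
  next
    case False
    then have neg: "\<not> (P x y \<and> (\<forall>y'. y' \<prec> b x \<longrightarrow> P x y' \<longrightarrow> y' = y))" for y using less by metis
    show ?thesis unfolding the0_def if_not_P[OF False] using neg by blast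
  qed
qed

text \<open>Collection for computable functions: the bound for n + 1 is the old bound plus the new
  value, plus one.\<close>

lemma bounding: assumes "rec f" shows "\<exists>b. \<forall>i. i \<prec> k \<longrightarrow> f i \<prec> b"
proof (induction k rule: sigma_induct')
  case dec
  have "rec (\<lambda>z. f (p2 z))" using assms rec_comp rec_p2' by blast
  then show ?case by (intro recs)
next
  case zero show ?case by (simp add: basic(7))
next
  case (suc n b)
  have "f i \<prec> b \<oplus> f n \<oplus> \<one>" if "i \<preceq> n" for i
  proof (cases "i = n")
    case False
    then have "f i \<prec> b" using suc that by (auto simp: N.le_less)
    then show ?thesis by (simp add: le_add1 N.less_imp_le)
  qed (simp add: le_add2)
  then show ?case by (intro exI[of _ "b \<oplus> f n \<oplus> \<one>"]) simp
qed

lemma fin_image: assumes "fin A" "rec f" shows "fin (f ` A)"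
proof -
  obtain k where k: "\<And>i. i \<in> A \<Longrightarrow> i \<prec> k" and A: "A \<in> sets M" using assms fin_def by auto
  obtain b where b: "\<And>i. i \<prec> k \<Longrightarrow> f i \<prec> b" using bounding assms by blast
  have "rec (\<lambda>z. f (p2 z))" using assms rec_comp rec_p2' by blast
  then have "dec (\<lambda>y. \<exists>x. x \<prec> k \<and> (x \<in> A \<and> y = f x))" by (intro recs A)
  moreover have "(\<lambda>y. \<exists>x. x \<prec> k \<and> (x \<in> A \<and> y = f x)) = (\<lambda>y. y \<in> f ` A)" using k by auto
  ultimately show ?thesis using b k by (intro finI[of _ b]) auto
qed

lemma fin_insert: assumes "fin A" shows "fin (insert a A)"
proof -
  obtain k where k: "\<And>i. i \<in> A \<Longrightarrow> i \<prec> k" and A: "A \<in> sets M" using assms fin_def by auto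
  have "dec (\<lambda>y. y = a \<or> y \<in> A)" by (intro recs A)
  then show ?thesis by (intro finI[of _ "k \<oplus> a \<oplus> \<one>"])
    (auto intro: le_add1 le_add2 N.less_imp_le k)
qed

text \<open>
  That \<open>b\<close> bounds the codes of all subsets of \<open>k\<close> involves a quantifier over sets. For the induction it is
  replaced by \<open>closed k b\<close>: the codes below \<open>b\<close> include that of the empty set and are closed under
  insertion of elements below \<open>k\<close>.
\<close>

lemma code_bound: "\<exists>b. \<forall>A. fin A \<longrightarrow> (\<forall>i\<in>A. i \<prec> k) \<longrightarrow> code_of M A \<prec> b"
proof -
  define ins where "ins c i = code_of M {y. y \<prec> c \<oplus> i \<oplus> \<one> \<and> (y = i \<or> y \<in> elems M c)}" for c i
  have ins: "ins c i = code_of M (insert i (elems M c))" for c i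
  proof -
    have "{y. y \<prec> c \<oplus> i \<oplus> \<one> \<and> (y = i \<or> y \<in> elems M c)} = insert i (elems M c)"
      by (auto intro: le_add1 le_add2 N.less_imp_le elems_less)
    then show ?thesis by (simp add: ins_def)
  qed
  have rec_ins: "rec (\<lambda>z. ins (f z) (g z))" if "rec f" "rec g" for f g
    by (rule rec2[OF _ that]) (unfold ins_def, intro recs)
  define closed where "closed k b \<longleftrightarrow> code_of M {} \<prec> b \<and> (\<forall>c. c \<prec> b \<longrightarrow> (\<forall>i. i \<prec> k \<longrightarrow>
    fin_code M c \<and> (\<forall>y. y \<prec> c \<longrightarrow> y \<in> elems M c \<longrightarrow> y \<prec> k) \<longrightarrow> ins c i \<prec> b))" for k b
  \<comment> \<open>A is built up through its initial segments below l. Each step inserts at most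
    the number l, and closure keeps the code below b.\<close>
  have closedD: "code_of M A \<prec> b" if cl: "closed k b" and A: "fin A" "\<forall>i\<in>A. i \<prec> k" for k b A
  proof -
    have "code_of M {y. y \<prec> l \<and> y \<in> A} \<prec> b" for l
    proof (induction l rule: dec_induct)
      case dec show ?case using A by (intro recs) (auto simp: fin_def)
    next
      case zero show ?case using cl by (simp add: basic(7) closed_def)
    next
      case (suc l)
      have f: "fin {y. y \<prec> l \<and> y \<in> A}" using A by (intro fin_Collect[of _ l] recs) (auto simp: fin_def)
      show ?case
      proof (cases "l \<in> A")
        case True
        then have "ins (code_of M {y. y \<prec> l \<and> y \<in> A}) l \<prec> b"
          using cl A suc fin_code_code_of[OF f] f unfolding closed_def by auto
        moreover have "{y. y \<prec> l \<oplus> \<one> \<and> y \<in> A} = insert l {y. y \<prec> l \<and> y \<in> A}" using True by (auto simp: N.le_less)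
        ultimately show ?thesis by (simp add: ins f)
      next
        case False
        then have "{y. y \<prec> l \<oplus> \<one> \<and> y \<in> A} = {y. y \<prec> l \<and> y \<in> A}" by (auto simp: N.le_less)
        then show ?thesis using suc by simp
      qed
    qed
    moreover have "{y. y \<prec> k \<and> y \<in> A} = A" using A(2) by auto
    ultimately show ?thesis by metis
  qed
  have "\<exists>b. closed k b"
  proof (induction k rule: sigma_induct')
    case dec show ?case unfolding closed_def by (intro recs rec_ins)
  next
    case zero show ?case by (intro exI[of _ "code_of M {} \<oplus> \<one>"]) (simp add: closed_def basic(7))
  next
    case (suc k b)
    have "rec (\<lambda>c. ins c k)" by (intro rec_ins recs)
    \<comment> \<open>A subset of k + 1 that contains k arises by inserting k into a subset of k,
      whose code is below b. So \<open>b'\<close> bounds the code of the former, and b + b' works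
      for both kinds of subsets.\<close>
    then obtain b' where b': "\<And>c. c \<prec> b \<Longrightarrow> ins c k \<prec> b'" using bounding by blast
    have "code_of M A \<prec> b \<oplus> b'" if A: "fin A" "\<forall>i\<in>A. i \<prec> k \<oplus> \<one>" for A
    proof -
      have f: "fin {y. y \<prec> k \<and> y \<in> A}" using A by (intro fin_Collect[of _ k] recs) (auto simp: fin_def)
      have less: "code_of M {y. y \<prec> k \<and> y \<in> A} \<prec> b" using closedD[OF suc f] by simp
      show ?thesis
      proof (cases "k \<in> A")
        case True
        then have "A = insert k {y. y \<prec> k \<and> y \<in> A}" using A(2) by (auto simp: N.le_less)
        then have "code_of M A = ins (code_of M {y. y \<prec> k \<and> y \<in> A}) k" using ins f by simp
        then show ?thesis using b'[OF less] by (simp add: less_add2)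
      next
        case False
        then have "A = {y. y \<prec> k \<and> y \<in> A}" using A(2) by (auto simp: N.le_less)
        then show ?thesis using less by (simp add: less_add1)
      qed
    qed
    then have "closed (k \<oplus> \<one>) (b \<oplus> b')"
      unfolding closed_def ins using elems_less fin_insert by (auto intro!: finI[of _ \<zero>] recs simp del: less_Suc)
    then show ?case by blast
  qed
  then show ?thesis using closedD by blast
qed

section \<open>Finite functions and partial orders\<close>

abbreviation "fl c \<equiv> fld M (elems M c)"

lemma fld_iff: "x \<in> fld M R \<longleftrightarrow> \<langle>x, x\<rangle> \<in> R"
  by (simp add: fld_def)

text \<open>The bridge between functions of the model, which are graphs, and HOL functions:
  composing and inverting relations turns into composing and inverting \<open>h\<close>.\<close>

definition lam :: "'m set \<Rightarrow> ('m \<Rightarrow> 'm) \<Rightarrow> 'm set" where "lam A h = {z. \<exists>x\<in>A. z = \<langle>x, h x\<rangle>}"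

lemma lam_iff [simp]: "\<langle>x, y\<rangle> \<in> lam A h \<longleftrightarrow> x \<in> A \<and> y = h x"
  by (auto simp: lam_def)

lemma lam_cong: "(\<And>x. x \<in> A \<Longrightarrow> f x = g x) \<Longrightarrow> lam A f = lam A g"
  by (auto simp: lam_def)

lemma fun_on_lam: "(\<And>x. x \<in> A \<Longrightarrow> h x \<in> B) \<Longrightarrow> fun_on M (lam A h) A B"
  by (auto simp: fun_on_def) (auto simp: lam_def)

lemma ap_lam [simp]: "x \<in> A \<Longrightarrow> ap M (lam A h) x = h x"
  by (auto simp: ap_def)

lemma fun_onD:
  assumes "fun_on M F A B"
  shows fun_on_ap: "x \<in> A \<Longrightarrow> ap M F x \<in> B"
    and fun_on_iff: "\<langle>x, y\<rangle> \<in> F \<longleftrightarrow> x \<in> A \<and> y = ap M F x"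
proof -
  have *: "\<langle>x, ap M F x\<rangle> \<in> F" if "x \<in> A" for x
    unfolding ap_def by (rule theI') (use assms that in \<open>auto simp: fun_on_def\<close>)
  show iff: "\<langle>x, y\<rangle> \<in> F \<longleftrightarrow> x \<in> A \<and> y = ap M F x" for x y
    using *[of x] assms unfolding fun_on_def by (metis pr_inj)
  show "x \<in> A \<Longrightarrow> ap M F x \<in> B" using *[of x] assms unfolding fun_on_def by (metis pr_inj)
qed

lemma fun_on_eq_lam: assumes "fun_on M F A B" shows "F = lam A (ap M F)"
proof (intro set_eqI iffI)
  fix z assume z: "z \<in> F"
  then obtain x y where "z = \<langle>x, y\<rangle>" using assms unfolding fun_on_def by blast
  then show "z \<in> lam A (ap M F)" using z fun_on_iff[OF assms] by simp
next
  fix z assume "z \<in> lam A (ap M F)" then show "z \<in> F" using fun_on_iff[OF assms] by (auto simp: lam_def)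
qed

lemma idf_lam: "idf M A = lam A (\<lambda>x. x)" by (simp add: idf_def lam_def)

lemma compf_lam: "f ` A \<subseteq> B \<Longrightarrow> compf M (lam B g) (lam A f) = lam A (\<lambda>x. g (f x))"
  unfolding compf_def by (auto simp: lam_def image_subset_iff)

lemma invf_lam: "(\<And>x. x \<in> A \<Longrightarrow> f x \<in> B \<and> g (f x) = x) \<Longrightarrow> (\<And>y. y \<in> B \<Longrightarrow> g y \<in> A \<and> f (g y) = y)
  \<Longrightarrow> invf M (lam A f) = lam B g"
  unfolding invf_def by (auto simp: lam_def)

lemma fin_lam: assumes "fin A" "rec h" shows "fin (lam A h)"
proof -
  have "lam A h = (\<lambda>x. \<langle>x, h x\<rangle>) ` A" by (auto simp: lam_def)
  then show ?thesis using fin_image[OF assms(1), of "\<lambda>x. \<langle>x, h x\<rangle>"] assms(2) by (simp add: recs)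
qed

text \<open>The code of a finite graph depends computably on a parameter w: that k is this code is
  checked by two bounded inclusions.\<close>

lemma rec_lam:
  assumes "dec (\<lambda>z. p2 z \<in> A (p1 z))" "rec b" "rec (\<lambda>z. h (p1 z) (p2 z))" "\<And>w x. x \<in> A w \<Longrightarrow> x \<prec> b w"
  shows "rec (\<lambda>w. code_of M (lam (A w) (h w)))"
proof (rule rec_graph[of "\<lambda>w k. fin_code M k \<and>
    (\<forall>z. z \<prec> k \<longrightarrow> z \<in> elems M k \<longrightarrow> is_pair z \<and> p1 z \<in> A w \<and> p2 z = h w (p1 z)) \<and>
    (\<forall>x. x \<prec> b w \<longrightarrow> x \<in> A w \<longrightarrow> \<langle>x, h w x\<rangle> \<in> elems M k)"])
  have A: "dec (\<lambda>z. g z \<in> A (f z))" if "rec f" "rec g" for f g using dec2[OF assms(1) that] .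
  have h: "rec (\<lambda>z. h (f z) (g z))" if "rec f" "rec g" for f g using rec2[OF assms(3) that] .
  have b: "rec (\<lambda>z. b (f z))" if "rec f" for f using rec_comp assms(2) that by blast
  show "dec (\<lambda>z. fin_code M (p2 z) \<and>
      (\<forall>za. za \<prec> p2 z \<longrightarrow> za \<in> elems M (p2 z) \<longrightarrow> is_pair za \<and> p1 za \<in> A (p1 z) \<and> p2 za = h (p1 z) (p1 za)) \<and>
      (\<forall>x. x \<prec> b (p1 z) \<longrightarrow> x \<in> A (p1 z) \<longrightarrow> \<langle>x, h (p1 z) x\<rangle> \<in> elems M (p2 z)))"
    by (intro recs A h b)
next
  fix w k
  have "dec (\<lambda>x. x \<in> A w)" by (rule dec2[OF assms(1)]) (intro recs)+
  then have "fin (A w)" by (rule finI) (rule assms(4))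
  moreover have "rec (h w)" using rec2[OF assms(3) rec_const rec_id] .
  ultimately have f: "fin (lam (A w) (h w))" by (rule fin_lam)
  have "(\<forall>z. z \<prec> k \<longrightarrow> z \<in> elems M k \<longrightarrow> is_pair z \<and> p1 z \<in> A w \<and> p2 z = h w (p1 z)) \<and>
    (\<forall>x. x \<prec> b w \<longrightarrow> x \<in> A w \<longrightarrow> \<langle>x, h w x\<rangle> \<in> elems M k) \<longleftrightarrow> elems M k = lam (A w) (h w)" (is "?l \<and> ?r \<longleftrightarrow> _")
  proof (intro iffI conjI)
    assume a: "?l \<and> ?r"
    show "elems M k = lam (A w) (h w)"
    proof (intro set_eqI iffI)
      fix z assume "z \<in> elems M k"
      then have "is_pair z \<and> p1 z \<in> A w \<and> p2 z = h w (p1 z)" using a elems_less by blast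
      then show "z \<in> lam (A w) (h w)" unfolding lam_def is_pair_eq by auto
    next
      fix z assume "z \<in> lam (A w) (h w)" then show "z \<in> elems M k" using a assms(4) by (auto simp: lam_def)
    qed
  qed (auto simp: lam_def)
  moreover have "fin_code M k \<and> elems M k = A \<longleftrightarrow> k = code_of M A" if "fin A" for A
    using code_of[OF that] code_of_elems by auto
  ultimately show "(fin_code M k \<and> ?l \<and> ?r) \<longleftrightarrow> k = code_of M (lam (A w) (h w))" using f by simp
qed

text \<open>Application and inverse application of a coded function. Unlike \<open>ap\<close>, they
  have a default value 0, hence are total and computable in both arguments.\<close>

definition apc where "apc f x = the0 (\<lambda>y. \<langle>x, y\<rangle> \<in> elems M f)"
definition api where "api f y = the0 (\<lambda>x. \<langle>x, y\<rangle> \<in> elems M f)"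

lemma elems_pair_less: "\<langle>x, y\<rangle> \<in> elems M f \<Longrightarrow> x \<prec> f" "\<langle>x, y\<rangle> \<in> elems M f \<Longrightarrow> y \<prec> f"
  using elems_less le_pr1 le_pr2 N.le_less_trans by blast+

lemma fl_less: "x \<in> fl c \<Longrightarrow> x \<prec> c"
  by (auto simp: fld_iff dest: elems_pair_less)

lemma rec_apc [recs]: assumes "rec f" "rec g" shows "rec (\<lambda>x. apc (f x) (g x))"
proof (rule rec2[OF _ assms])
  show "rec (\<lambda>z. apc (p1 z) (p2 z))" unfolding apc_def
    by (rule rec_the0[of _ "\<lambda>z. p1 z"]) (intro recs, intro recs, rule elems_pair_less)
qed

lemma rec_api [recs]: assumes "rec f" "rec g" shows "rec (\<lambda>x. api (f x) (g x))"
proof (rule rec2[OF _ assms])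
  show "rec (\<lambda>z. api (p1 z) (p2 z))" unfolding api_def
    by (rule rec_the0[of _ "\<lambda>z. p1 z"]) (intro recs, intro recs, rule elems_pair_less)
qed

lemma apc_eq: "fun_on M (elems M f) A B \<Longrightarrow> x \<in> A \<Longrightarrow> apc f x = ap M (elems M f) x"
  unfolding apc_def by (rule the0_eq) (simp_all add: fun_on_iff)

lemma api_eq: "fun_on M (elems M f) A B \<Longrightarrow> x \<in> A \<Longrightarrow> (\<And>x'. x' \<in> A \<Longrightarrow> ap M (elems M f) x' = ap M (elems M f) x \<Longrightarrow> x' = x)
  \<Longrightarrow> api f (ap M (elems M f) x) = x"
  unfolding api_def by (rule the0_eq) (metis fun_on_iff)+

lemma fun_on_code_iff:
  assumes "\<And>x. x \<in> A \<Longrightarrow> x \<prec> b"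
  shows "fun_on M (elems M f) A B \<longleftrightarrow> (\<forall>z. z \<prec> f \<longrightarrow> z \<in> elems M f \<longrightarrow> is_pair z \<and> p1 z \<in> A \<and> p2 z \<in> B) \<and>
   (\<forall>x. x \<prec> b \<longrightarrow> x \<in> A \<longrightarrow> (\<exists>y. y \<prec> f \<and> (\<langle>x, y\<rangle> \<in> elems M f \<and> (\<forall>y'. y' \<prec> f \<longrightarrow> \<langle>x, y'\<rangle> \<in> elems M f \<longrightarrow> y' = y))))"
proof -
  have "(\<forall>z\<in>elems M f. \<exists>x\<in>A. \<exists>y\<in>B. z = \<langle>x, y\<rangle>) \<longleftrightarrow> (\<forall>z. z \<prec> f \<longrightarrow> z \<in> elems M f \<longrightarrow> is_pair z \<and> p1 z \<in> A \<and> p2 z \<in> B)"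
    using elems_less unfolding is_pair_def by (metis p1_pr p2_pr)
  moreover have "(\<exists>!y. \<langle>x, y\<rangle> \<in> elems M f) \<longleftrightarrow> (\<exists>y. y \<prec> f \<and> (\<langle>x, y\<rangle> \<in> elems M f \<and> (\<forall>y'. y' \<prec> f \<longrightarrow> \<langle>x, y'\<rangle> \<in> elems M f \<longrightarrow> y' = y)))" for x
    using elems_pair_less(2) by metis
  ultimately show ?thesis unfolding fun_on_def using assms by auto
qed

lemma dec_fun_on:
  assumes "dec (\<lambda>z. p2 z \<in> A (p1 z))" "rec b" "dec (\<lambda>z. p2 z \<in> B (p1 z))" "\<And>w x. x \<in> A w \<Longrightarrow> x \<prec> b w" "rec f"
  shows "dec (\<lambda>w. fun_on M (elems M (f w)) (A w) (B w))"
proof -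
  have A: "dec (\<lambda>z. g z \<in> A (f z))" if "rec f" "rec g" for f g using dec2[OF assms(1) that] .
  have B: "dec (\<lambda>z. g z \<in> B (f z))" if "rec f" "rec g" for f g using dec2[OF assms(3) that] .
  have b: "rec (\<lambda>z. b (g z))" "rec (\<lambda>z. f (g z))" if "rec g" for g using rec_comp assms(2,5) that by blast+
  have "fun_on M (elems M (f w)) (A w) (B w) \<longleftrightarrow>
    (\<forall>z. z \<prec> f w \<longrightarrow> z \<in> elems M (f w) \<longrightarrow> is_pair z \<and> p1 z \<in> A w \<and> p2 z \<in> B w) \<and>
    (\<forall>x. x \<prec> b w \<longrightarrow> x \<in> A w \<longrightarrow> (\<exists>y. y \<prec> f w \<and> (\<langle>x, y\<rangle> \<in> elems M (f w) \<and>
       (\<forall>y'. y' \<prec> f w \<longrightarrow> \<langle>x, y'\<rangle> \<in> elems M (f w) \<longrightarrow> y' = y))))" for w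
    by (rule fun_on_code_iff) (rule assms(4))
  then show ?thesis by (simp only:) (intro recs A B b assms)
qed

section \<open>Quasi embeddings and embeddings as HOL functions\<close>

definition qe where "qe h R S \<longleftrightarrow> (\<forall>x\<in>fld M R. h x \<in> fld M S) \<and>
  (\<forall>x\<in>fld M R. \<forall>x'\<in>fld M R. \<langle>h x, h x'\<rangle> \<in> S \<longrightarrow> \<langle>x, x'\<rangle> \<in> R)"
definition eh where "eh h R S \<longleftrightarrow> qe h R S \<and> (\<forall>x\<in>fld M R. \<forall>x'\<in>fld M R. \<langle>x, x'\<rangle> \<in> R \<longrightarrow> \<langle>h x, h x'\<rangle> \<in> S)"

lemma quasi_emb_lam: "quasi_emb M (lam (fld M R) h) R S \<longleftrightarrow> qe h R S"
proof -
  have "fun_on M (lam (fld M R) h) (fld M R) (fld M S) \<longleftrightarrow> (\<forall>x\<in>fld M R. h x \<in> fld M S)"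
    using fun_on_lam[of "fld M R" h "fld M S"] fun_on_ap[of "lam (fld M R) h" "fld M R" "fld M S"] by auto
  then show ?thesis unfolding quasi_emb_def qe_def by simp
qed

lemma emb_lam: "emb M (lam (fld M R) h) R S \<longleftrightarrow> eh h R S"
  unfolding emb_def eh_def quasi_emb_lam by simp

lemma quasi_embD: assumes "quasi_emb M F R S" shows "F = lam (fld M R) (ap M F)" "qe (ap M F) R S"
proof -
  have "fun_on M F (fld M R) (fld M S)" using assms quasi_emb_def by blast
  from fun_on_eq_lam[OF this] show 1: "F = lam (fld M R) (ap M F)" .
  show "qe (ap M F) R S" using assms quasi_emb_lam 1 by metis
qed

lemma qe_comp: "qe f R S \<Longrightarrow> qe g S T \<Longrightarrow> qe (\<lambda>x. g (f x)) R T" unfolding qe_def by blast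
lemma eh_comp: "eh f R S \<Longrightarrow> eh g S T \<Longrightarrow> eh (\<lambda>x. g (f x)) R T" unfolding eh_def qe_def by blast
lemma eh_qe: "eh f R S \<Longrightarrow> qe f R S" by (simp add: eh_def)
text \<open>If x and y have the same value, reflexivity relates the values in both directions, so x
  and y are related in both directions as well.\<close>

lemma qe_inj: "qe f R S \<Longrightarrow> po M R \<Longrightarrow> x \<in> fld M R \<Longrightarrow> y \<in> fld M R \<Longrightarrow> f x = f y \<Longrightarrow> x = y"
  unfolding qe_def po_def by (metis fld_iff)

lemma poD:
  assumes "po M R"
  shows po_fld: "\<langle>x, y\<rangle> \<in> R \<Longrightarrow> x \<in> fld M R" "\<langle>x, y\<rangle> \<in> R \<Longrightarrow> y \<in> fld M R"
    and po_antisym: "\<langle>x, y\<rangle> \<in> R \<Longrightarrow> \<langle>y, x\<rangle> \<in> R \<Longrightarrow> x = y"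
    and po_trans: "\<langle>x, y\<rangle> \<in> R \<Longrightarrow> \<langle>y, z\<rangle> \<in> R \<Longrightarrow> \<langle>x, z\<rangle> \<in> R"
    and po_refl: "x \<in> fld M R \<Longrightarrow> \<langle>x, x\<rangle> \<in> R"
proof -
  have *: "\<forall>z\<in>R. \<exists>x\<in>fld M R. \<exists>y\<in>fld M R. z = \<langle>x, y\<rangle>"
    and a: "\<forall>x y. \<langle>x, y\<rangle> \<in> R \<and> \<langle>y, x\<rangle> \<in> R \<longrightarrow> x = y"
    and t: "\<forall>x y z. \<langle>x, y\<rangle> \<in> R \<and> \<langle>y, z\<rangle> \<in> R \<longrightarrow> \<langle>x, z\<rangle> \<in> R"
    using assms unfolding po_def by - (elim conjE, assumption)+
  from * have "\<langle>x, y\<rangle> \<in> R \<Longrightarrow> x \<in> fld M R \<and> y \<in> fld M R" by (drule_tac bspec) auto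
  then show "\<langle>x, y\<rangle> \<in> R \<Longrightarrow> x \<in> fld M R" "\<langle>x, y\<rangle> \<in> R \<Longrightarrow> y \<in> fld M R" by auto
  show "\<langle>x, y\<rangle> \<in> R \<Longrightarrow> \<langle>y, x\<rangle> \<in> R \<Longrightarrow> x = y" using a by blast
  show "\<langle>x, y\<rangle> \<in> R \<Longrightarrow> \<langle>y, z\<rangle> \<in> R \<Longrightarrow> \<langle>x, z\<rangle> \<in> R" using t by blast
qed (simp add: fld_iff)

lemma dec_fl [recs]: "rec f \<Longrightarrow> rec g \<Longrightarrow> dec (\<lambda>x. f x \<in> fl (g x))"
  unfolding fld_iff by (intro recs)

lemma dec_fld [recs]: "R \<in> sets M \<Longrightarrow> rec f \<Longrightarrow> dec (\<lambda>x. f x \<in> fld M R)"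
  unfolding fld_iff by (intro recs)

lemma po_code_iff: "po M (elems M a) \<longleftrightarrow>
   (\<forall>z. z \<prec> a \<longrightarrow> z \<in> elems M a \<longrightarrow> is_pair z \<and> p1 z \<in> fl a \<and> p2 z \<in> fl a) \<and>
   (\<forall>x. x \<prec> a \<longrightarrow> (\<forall>y. y \<prec> a \<longrightarrow> \<langle>x, y\<rangle> \<in> elems M a \<and> \<langle>y, x\<rangle> \<in> elems M a \<longrightarrow> x = y)) \<and>
   (\<forall>x. x \<prec> a \<longrightarrow> (\<forall>y. y \<prec> a \<longrightarrow> (\<forall>z. z \<prec> a \<longrightarrow> \<langle>x, y\<rangle> \<in> elems M a \<and> \<langle>y, z\<rangle> \<in> elems M a \<longrightarrow> \<langle>x, z\<rangle> \<in> elems M a)))"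
proof -
  have "(\<forall>z\<in>elems M a. \<exists>x\<in>fl a. \<exists>y\<in>fl a. z = \<langle>x, y\<rangle>) \<longleftrightarrow> (\<forall>z. z \<prec> a \<longrightarrow> z \<in> elems M a \<longrightarrow> is_pair z \<and> p1 z \<in> fl a \<and> p2 z \<in> fl a)"
    using elems_less unfolding is_pair_def by (metis p1_pr p2_pr)
  moreover have "(\<forall>x y. \<langle>x, y\<rangle> \<in> elems M a \<and> \<langle>y, x\<rangle> \<in> elems M a \<longrightarrow> x = y) \<longleftrightarrow>
    (\<forall>x. x \<prec> a \<longrightarrow> (\<forall>y. y \<prec> a \<longrightarrow> \<langle>x, y\<rangle> \<in> elems M a \<and> \<langle>y, x\<rangle> \<in> elems M a \<longrightarrow> x = y))"
    using elems_pair_less by blast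
  moreover have "(\<forall>x y z. \<langle>x, y\<rangle> \<in> elems M a \<and> \<langle>y, z\<rangle> \<in> elems M a \<longrightarrow> \<langle>x, z\<rangle> \<in> elems M a) \<longleftrightarrow>
    (\<forall>x. x \<prec> a \<longrightarrow> (\<forall>y. y \<prec> a \<longrightarrow> (\<forall>z. z \<prec> a \<longrightarrow> \<langle>x, y\<rangle> \<in> elems M a \<and> \<langle>y, z\<rangle> \<in> elems M a \<longrightarrow> \<langle>x, z\<rangle> \<in> elems M a)))"
    using elems_pair_less by blast
  ultimately show ?thesis unfolding po_def by (simp only:)
qed

lemma dec_fin_po [recs]: "rec f \<Longrightarrow> dec (\<lambda>x. fin_po M (f x))"
  by (rule dec_comp) (unfold fin_po_def po_code_iff, intro recs)

lemma quasi_emb_code_iff: "quasi_emb M (elems M f) (elems M c) (elems M d) \<longleftrightarrow> fun_on M (elems M f) (fl c) (fl d) \<and>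
   (\<forall>x. x \<prec> c \<longrightarrow> (\<forall>x'. x' \<prec> c \<longrightarrow> x \<in> fl c \<and> x' \<in> fl c \<and> \<langle>apc f x, apc f x'\<rangle> \<in> elems M d \<longrightarrow> \<langle>x, x'\<rangle> \<in> elems M c))"
proof (cases "fun_on M (elems M f) (fl c) (fl d)")
  case True
  have "(\<forall>x\<in>fl c. \<forall>x'\<in>fl c. \<langle>apc f x, apc f x'\<rangle> \<in> elems M d \<longrightarrow> \<langle>x, x'\<rangle> \<in> elems M c) \<longleftrightarrow>
    (\<forall>x\<in>fl c. \<forall>x'\<in>fl c. \<langle>ap M (elems M f) x, ap M (elems M f) x'\<rangle> \<in> elems M d \<longrightarrow> \<langle>x, x'\<rangle> \<in> elems M c)"
    using apc_eq[OF True] by simp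
  then show ?thesis unfolding quasi_emb_def using True fl_less by blast
qed (simp add: quasi_emb_def)

lemma dec_quasi_emb [recs]:
  assumes "rec f" "rec c" "rec d" shows "dec (\<lambda>x. quasi_emb M (elems M (f x)) (elems M (c x)) (elems M (d x)))"
proof -
  have r: "rec (\<lambda>z. f (g z))" "rec (\<lambda>z. c (g z))" "rec (\<lambda>z. d (g z))" if "rec g" for g using rec_comp assms that by blast+
  have "dec (\<lambda>x. fun_on M (elems M (f x)) (fl (c x)) (fl (d x)))"
    by (rule dec_fun_on[of _ c]) (intro recs r assms fl_less, assumption?)+
  then show ?thesis unfolding quasi_emb_code_iff by (intro recs r assms)
qed

lemma rec_lam_fl [recs]:
  assumes "rec c" "rec (\<lambda>z. h (p1 z) (p2 z))" shows "rec (\<lambda>w. code_of M (lam (fl (c w)) (h w)))"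
proof -
  have r: "rec (\<lambda>z. c (g z))" if "rec g" for g using rec_comp assms that by blast+
  show ?thesis by (rule rec_lam[of _ c]) (intro recs r assms fl_less, assumption?)+
qed

text \<open>Continuing \<open>F\<close> by 0 outside its domain yields a total function; it is
  computable because membership in \<open>A\<close> is decidable.\<close>

lemma total_ap:
  assumes "F \<in> sets M" "fun_on M F A B" "A \<in> sets M"
  obtains f where "rec f" "\<And>x. x \<in> A \<Longrightarrow> f x = ap M F x" "F = lam A f"
proof
  show "rec (\<lambda>x. if x \<in> A then ap M F x else \<zero>)"
  proof (rule rec_graph[of "\<lambda>x y. x \<in> A \<and> \<langle>x, y\<rangle> \<in> F \<or> x \<notin> A \<and> y = \<zero>"])
    show "dec (\<lambda>z. p1 z \<in> A \<and> \<langle>p1 z, p2 z\<rangle> \<in> F \<or> p1 z \<notin> A \<and> p2 z = \<zero>)" by (intro recs assms)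
  qed (auto simp: fun_on_iff[OF assms(2)])
  show "F = lam A (\<lambda>x. if x \<in> A then ap M F x else \<zero>)"
    by (subst fun_on_eq_lam[OF assms(2)], rule lam_cong) simp
qed simp

lemma fin_fl [simp]: "fin (fl c)"
  by (rule finI) (intro recs, rule fl_less)

lemma elems_sets [simp]: "elems M c \<in> sets M"
  using fin_elems fin_def by blast

lemma fin_un: "fin A \<Longrightarrow> fin B \<Longrightarrow> fin (A \<union> B)"
  unfolding fin_def
proof (elim conjE exE, intro conjI exI)
  fix k l assume "A \<in> sets M" "B \<in> sets M"
  then have "dec (\<lambda>x. x \<in> A \<or> x \<in> B)" by (intro recs)
  then show "A \<union> B \<in> sets M" unfolding dec_def Un_def .
  assume "\<forall>i\<in>A. i \<prec> k" "\<forall>i\<in>B. i \<prec> l"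
  then show "\<forall>i\<in>A \<union> B. i \<prec> k \<oplus> l" using less_add1 less_add2 by auto
qed

lemma lam_rec_code: "quasi_emb M (elems M f) R S \<Longrightarrow> elems M f = lam (fld M R) (apc f)"
  using fun_on_eq_lam[of "elems M f" "fld M R" "fld M S"] apc_eq[of f "fld M R" "fld M S"] lam_cong
  unfolding quasi_emb_def by metis

end

section \<open>Skeletons and dilators\<close>

locale skel = rca M for M :: "'m l2" +
  fixes K :: "'m skel"
  assumes skel: "skeleton M K"
begin

text \<open>|a| and en_a, made total so that they can be computable. \<open>E a\<close> is the map
  underlying en_a, and \<open>J a\<close> is its inverse.\<close>

definition rp where "rp a = (if fin_po M a then ap M (repr K) a else \<zero>)"
definition en where "en a = (if fin_po M a then ap M (enum K) a else \<zero>)"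
definition E where "E a x = apc (en a) x"
definition J where "J a y = api (en a) y"

lemma sk: "obj K \<in> sets M" "repr K \<in> sets M" "enum K \<in> sets M" "\<And>c. c \<in> obj K \<Longrightarrow> fin_po M c"
  "fun_on M (repr K) {a. fin_po M a} (obj K)" "fun_on M (enum K) {a. fin_po M a} {f. fin_code M f}"
  using skel by (simp_all add: skeleton_def)

lemma rec_if_ap:
  assumes "F \<in> sets M" "fun_on M F {a. P a} B" "dec P" "rec g" shows "rec (\<lambda>x. if P (g x) then ap M F (g x) else \<zero>)"
proof (rule rec_comp[OF _ assms(4)], rule rec_graph[of "\<lambda>x y. P x \<and> \<langle>x, y\<rangle> \<in> F \<or> \<not> P x \<and> y = \<zero>"])
  have "dec (\<lambda>z. P (p1 z))" using dec_comp assms(3) rec_p1' by blast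
  then show "dec (\<lambda>z. P (p1 z) \<and> \<langle>p1 z, p2 z\<rangle> \<in> F \<or> \<not> P (p1 z) \<and> p2 z = \<zero>)" by (intro recs assms)
qed (auto simp: fun_on_iff[OF assms(2)])

lemma rec_rp [recs]: "rec f \<Longrightarrow> rec (\<lambda>x. rp (f x))"
  unfolding rp_def by (rule rec_if_ap[OF sk(2,5)]) (intro recs)

lemma rec_en [recs]: "rec f \<Longrightarrow> rec (\<lambda>x. en (f x))"
  unfolding en_def by (rule rec_if_ap[OF sk(3,6)]) (intro recs)

lemma rec_E [recs]: "rec f \<Longrightarrow> rec g \<Longrightarrow> rec (\<lambda>x. E (f x) (g x))"
  unfolding E_def by (intro recs)

lemma rec_J [recs]: "rec f \<Longrightarrow> rec g \<Longrightarrow> rec (\<lambda>x. J (f x) (g x))"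
  unfolding J_def by (intro recs)

lemma fin_poD: "fin_po M a \<Longrightarrow> po M (elems M a)" "fin_po M a \<Longrightarrow> fin_code M a"
  by (simp_all add: fin_po_def)

context
  fixes a assumes a: "fin_po M a"
begin

lemma rp_obj: "rp a \<in> obj K" using fun_on_ap[OF sk(5)] a by (simp add: rp_def)
lemma rp_fin_po: "fin_po M (rp a)" using rp_obj sk(4) by blast

lemma en_iso: "po_iso M (elems M (en a)) (elems M (rp a)) (elems M a)"
  using skel a by (simp add: skeleton_def en_def rp_def)

lemma en_fun: "fun_on M (elems M (en a)) (fl (rp a)) (fl a)"
  using en_iso unfolding po_iso_def emb_def quasi_emb_def by blast

lemma E_eq: "x \<in> fl (rp a) \<Longrightarrow> E a x = ap M (elems M (en a)) x"
  unfolding E_def by (rule apc_eq[OF en_fun])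

lemma en_lam: "elems M (en a) = lam (fl (rp a)) (E a)"
  using fun_on_eq_lam[OF en_fun] lam_cong[of "fl (rp a)", OF E_eq] by simp

lemma E_eh: "eh (E a) (elems M (rp a)) (elems M a)"
  using en_iso unfolding po_iso_def en_lam emb_lam by blast

lemma E_image: "E a ` fl (rp a) = fl a"
  using en_iso E_eq unfolding po_iso_def by auto

lemma E_fl: "x \<in> fl (rp a) \<Longrightarrow> E a x \<in> fl a" using E_image by blast

lemma E_inj: "x \<in> fl (rp a) \<Longrightarrow> y \<in> fl (rp a) \<Longrightarrow> E a x = E a y \<Longrightarrow> x = y"
  using qe_inj[OF eh_qe[OF E_eh]] fin_poD(1) rp_fin_po by blast

lemma J_E: "x \<in> fl (rp a) \<Longrightarrow> J a (E a x) = x"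
  unfolding J_def using api_eq[OF en_fun, of x] E_inj E_eq by metis

lemma J_fl: "y \<in> fl a \<Longrightarrow> J a y \<in> fl (rp a)" and E_J: "y \<in> fl a \<Longrightarrow> E a (J a y) = y"
  using E_image J_E by (metis imageE)+

lemma J_eh: "eh (J a) (elems M a) (elems M (rp a))"
  using E_eh J_fl E_J unfolding eh_def qe_def by metis

lemma J_image: "J a ` fl a = fl (rp a)"
  using J_fl E_fl J_E by (metis image_eqI subsetI image_subsetI subset_antisym)

end

text \<open>The skeleton identifies objects that are isomorphic by a coded map; a computable
  isomorphism between finite orders has a code, since its graph is finite.\<close>

lemma iso_eq:
  assumes "c \<in> obj K" "d \<in> obj K" "rec h" "eh h (elems M c) (elems M d)" "h ` fl c = fl d" shows "c = d"
proof -
  let ?f = "code_of M (lam (fl c) h)"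
  have "fin (lam (fl c) h)" using fin_lam assms by simp
  then have "fin_code M ?f" "elems M ?f = lam (fl c) h" using code_of by auto
  moreover have "po_iso M (lam (fl c) h) (elems M c) (elems M d)"
    unfolding po_iso_def emb_lam using assms by simp
  ultimately show ?thesis using skel assms(1,2) unfolding skeleton_def by metis
qed

lemma rp_iso:
  assumes "fin_po M a" "fin_po M b" "rec h" "eh h (elems M a) (elems M b)" "h ` fl a = fl b" shows "rp a = rp b"
proof (rule iso_eq[of _ _ "\<lambda>x. J b (h (E a x))"])
  have "rec (\<lambda>x. h (E a x))" by (rule rec_comp[OF assms(3)]) (intro recs)
  then show "rec (\<lambda>x. J b (h (E a x)))" by (intro recs)
  show "eh (\<lambda>x. J b (h (E a x))) (elems M (rp a)) (elems M (rp b))"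
    using eh_comp[OF eh_comp[OF E_eh[OF assms(1)] assms(4)] J_eh[OF assms(2)]] .
  have "(\<lambda>x. J b (h (E a x))) ` fl (rp a) = J b ` h ` E a ` fl (rp a)" by (simp add: image_image)
  then show "(\<lambda>x. J b (h (E a x))) ` fl (rp a) = fl (rp b)"
    by (simp only: E_image[OF assms(1)] assms(5) J_image[OF assms(2)])
qed (use rp_obj assms in auto)

text \<open>en_c is an isomorphism between two objects of the skeleton, which therefore coincide. It
  need not be the identity.\<close>

lemma rp_obj_eq: "c \<in> obj K \<Longrightarrow> rp c = c"
  by (rule iso_eq[of _ _ "E c"]) (auto simp: rp_obj E_eh E_image sk(4) intro!: recs)

section \<open>Morphisms of the skeleton given by computable functions\<close>

definition mc where "mc c h = code_of M (lam (fl c) h)"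

definition mor' where "mor' c d h \<longleftrightarrow> c \<in> obj K \<and> d \<in> obj K \<and> rec h \<and> qe h (elems M c) (elems M d)"

lemma mc: "rec h \<Longrightarrow> elems M (mc c h) = lam (fl c) h" "rec h \<Longrightarrow> fin_code M (mc c h)"
  unfolding mc_def using code_of[OF fin_lam] by auto

lemma mor'_mor: "mor' c d h \<Longrightarrow> mor M K c d (mc c h)"
  unfolding mor'_def mor_def by (simp add: mc quasi_emb_lam)

lemma mor_mor': assumes "mor M K c d f" shows "mor' c d (apc f)" "f = mc c (apc f)"
proof -
  have q: "quasi_emb M (elems M f) (elems M c) (elems M d)" using assms by (simp add: mor_def)
  have l: "elems M f = lam (fl c) (apc f)" by (rule lam_rec_code[OF q])
  have r: "rec (apc f)" by (intro recs)
  show "mor' c d (apc f)" using assms q r unfolding mor'_def mor_def l quasi_emb_lam by simp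
  show "f = mc c (apc f)" unfolding mc_def l[symmetric] using assms by (simp add: mor_def)
qed

lemma mc_comp: "mor' b c f \<Longrightarrow> mor' c d g \<Longrightarrow> code_of M (compf M (elems M (mc c g)) (elems M (mc b f))) = mc b (\<lambda>x. g (f x))"
  unfolding mor'_def by (subst mc, simp, subst mc, simp, subst compf_lam) (auto simp: qe_def mc_def)

text \<open>Conjugation with the enumerations: a map f from p to q becomes a map from |p| to
  |q|.\<close>

definition tr where "tr p q f x = J q (f (E p x))"

lemma mor'_tr: "fin_po M p \<Longrightarrow> fin_po M q \<Longrightarrow> rec f \<Longrightarrow> qe f (elems M p) (elems M q) \<Longrightarrow> mor' (rp p) (rp q) (tr p q f)"
proof -
  assume a: "fin_po M p" "fin_po M q" "rec f" "qe f (elems M p) (elems M q)"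
  have "rec (\<lambda>x. f (E p x))" by (rule rec_comp[OF a(3)]) (intro recs)
  then have "rec (tr p q f)" unfolding tr_def[abs_def] by (intro recs)
  moreover have "qe (tr p q f) (elems M (rp p)) (elems M (rp q))" unfolding tr_def[abs_def]
    using qe_comp[OF qe_comp[OF eh_qe[OF E_eh[OF a(1)]] a(4)] eh_qe[OF J_eh[OF a(2)]]] .
  ultimately show ?thesis using a rp_obj by (simp add: mor'_def)
qed

lemma eh_tr: "fin_po M p \<Longrightarrow> fin_po M q \<Longrightarrow> eh f (elems M p) (elems M q) \<Longrightarrow> eh (tr p q f) (elems M (rp p)) (elems M (rp q))"
  unfolding tr_def[abs_def] using eh_comp[OF eh_comp[OF E_eh] J_eh] by blast

text \<open>The domain \<open>A\<close> may exceed the field of p, since \<open>ind_mor\<close> is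
  applied to functions on all of X, and composing with en_p restricts them.\<close>

lemma ind_mor_eq:
  assumes "fin_po M p" "fin_po M q" "fl p \<subseteq> A" "f ` fl p \<subseteq> fl q"
  shows "ind_mor M K (lam A f) p q = mc (rp p) (tr p q f)"
proof -
  have en: "ap M (enum K) p = en p" "ap M (enum K) q = en q" using assms by (simp_all add: en_def)
  have inv: "invf M (elems M (en q)) = lam (fl q) (J q)"
    unfolding en_lam[OF assms(2)] by (rule invf_lam) (use assms(2) in \<open>auto simp: E_fl J_E E_J J_fl\<close>)
  have sub: "E p ` fl (rp p) \<subseteq> A" using E_image[OF assms(1)] assms(3) by blast
  have "(\<lambda>x. f (E p x)) ` fl (rp p) \<subseteq> fl q" using E_fl[OF assms(1)] assms(4) by blast
  then show ?thesis
    unfolding ind_mor_def en inv mc_def tr_def[abs_def] unfolding en_lam[OF assms(1)] by (simp add: compf_lam[OF sub] compf_lam)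
qed

lemma dec_mor [recs]: "rec c \<Longrightarrow> rec d \<Longrightarrow> rec f \<Longrightarrow> dec (\<lambda>x. mor M K (c x) (d x) (f x))"
  unfolding mor_def by (intro recs sk)

section \<open>Finite suborders\<close>

definition dset where "dset X A = {z \<in> X. \<exists>x\<in>A. \<exists>y\<in>A. z = \<langle>x, y\<rangle>}"

lemma dset_iff [simp]: "\<langle>x, y\<rangle> \<in> dset X A \<longleftrightarrow> \<langle>x, y\<rangle> \<in> X \<and> x \<in> A \<and> y \<in> A"
  by (auto simp: dset_def)

text \<open>The bound \<langle>a, a\<rangle> brings the induced order into the form for which the
  computability of codes has been shown.\<close>

lemma induced_eq: "induced M X a = code_of M {z. z \<prec> \<langle>a, a\<rangle> \<and> (z \<in> X \<and> is_pair z \<and> p1 z \<in> elems M a \<and> p2 z \<in> elems M a)}"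
  "dset X (elems M a) = {z. z \<prec> \<langle>a, a\<rangle> \<and> (z \<in> X \<and> is_pair z \<and> p1 z \<in> elems M a \<and> p2 z \<in> elems M a)}"
proof -
  have "\<langle>x, y\<rangle> \<prec> \<langle>a, a\<rangle>" if "x \<in> elems M a" "y \<in> elems M a" for x y
    using that elems_less by (intro pr_less N.add_strict_mono) auto
  then show *: "dset X (elems M a) = {z. z \<prec> \<langle>a, a\<rangle> \<and> (z \<in> X \<and> is_pair z \<and> p1 z \<in> elems M a \<and> p2 z \<in> elems M a)}"
    by (auto simp: dset_def is_pair_def)
  show "induced M X a = code_of M {z. z \<prec> \<langle>a, a\<rangle> \<and> (z \<in> X \<and> is_pair z \<and> p1 z \<in> elems M a \<and> p2 z \<in> elems M a)}"
    unfolding induced_def *[symmetric] dset_def ..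
qed

lemma rec_induced [recs]: "X \<in> sets M \<Longrightarrow> rec f \<Longrightarrow> rec (\<lambda>x. induced M X (f x))"
  by (rule rec_comp[where g = "induced M X"]) (unfold induced_eq, intro recs)

context
  fixes X a assumes X: "partial_order M X" and aX: "elems M a \<subseteq> fld M X"
begin

lemma induced_elems: "elems M (induced M X a) = dset X (elems M a)" and induced_code: "fin_code M (induced M X a)"
proof -
  have "X \<in> sets M" using X by (simp add: partial_order_def)
  then have "fin (dset X (elems M a))" unfolding induced_eq by (intro fin_Collect[of _ "\<langle>a, a\<rangle>"] recs) auto
  then show "elems M (induced M X a) = dset X (elems M a)" "fin_code M (induced M X a)"
    using code_of by (simp_all add: induced_def dset_def[symmetric])
qed

lemma induced_iff: "\<langle>x, y\<rangle> \<in> elems M (induced M X a) \<longleftrightarrow> \<langle>x, y\<rangle> \<in> X \<and> x \<in> elems M a \<and> y \<in> elems M a"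
  by (simp add: induced_elems)

lemma induced_fl: "fl (induced M X a) = elems M a"
  using aX by (auto simp: fld_iff induced_iff)

lemma induced_fin_po: "fin_po M (induced M X a)"
proof -
  have pX: "po M X" using X by (simp add: partial_order_def)
  have "po M (elems M (induced M X a))"
    unfolding po_def induced_fl
  proof (intro conjI ballI allI impI)
    fix z assume "z \<in> elems M (induced M X a)"
    then show "\<exists>x\<in>elems M a. \<exists>y\<in>elems M a. z = \<langle>x, y\<rangle>" unfolding induced_elems dset_def by blast
  qed (use po_antisym[OF pX] po_trans[OF pX] in \<open>auto simp: induced_iff\<close>)
  then show ?thesis using induced_code by (simp add: fin_po_def)
qed

end

end

section \<open>The action of a dilator on finite orders\<close>

locale dilator = skel M K for M :: "'m l2" and K +
  fixes W :: "'m dil"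
  assumes W: "PO_dilator M K W"
begin

abbreviation "WO c \<equiv> W_ord M W c"
text \<open>Indexing the action by HOL functions instead of codes lets the functor laws be stated
  with ordinary composition.\<close>

definition Wm where "Wm c d h x = ap M (W_map M W c d (mc c h)) x"
abbreviation "sp c x \<equiv> elems M (ap M (W_supp M W c) x)"

lemma W_sets: "d_ord W \<in> sets M" "d_map W \<in> sets M" "d_supp W \<in> sets M"
  and dil: "dil_functor M K W" "preserves_embs M K W" "supp_natural M K W"
  using W by (auto simp: PO_dilator_def)

lemma WO_po: "c \<in> obj K \<Longrightarrow> po M (WO c)" using dil(1) by (simp add: dil_functor_def)

lemma Wm_quasi: "mor' c d h \<Longrightarrow> quasi_emb M (W_map M W c d (mc c h)) (WO c) (WO d)"
  using dil(1) mor'_mor by (simp add: dil_functor_def)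

lemma Wm_qe: "mor' c d h \<Longrightarrow> qe (Wm c d h) (WO c) (WO d)"
  unfolding Wm_def[abs_def] using quasi_embD(2)[OF Wm_quasi] by blast

lemma Wm_eh: assumes "mor' c d h" "eh h (elems M c) (elems M d)" shows "eh (Wm c d h) (WO c) (WO d)"
proof -
  have "emb M (elems M (mc c h)) (elems M c) (elems M d)" using assms by (simp add: mc mor'_def emb_lam)
  then have "emb M (W_map M W c d (mc c h)) (WO c) (WO d)"
    using dil(2) mor'_mor[OF assms(1)] by (simp add: preserves_embs_def)
  then show ?thesis using Wm_qe[OF assms(1)] unfolding eh_def emb_def Wm_def by blast
qed

lemma Wm_id: "c \<in> obj K \<Longrightarrow> x \<in> fld M (WO c) \<Longrightarrow> Wm c c (\<lambda>x. x) x = x"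
  using dil(1) unfolding dil_functor_def Wm_def mc_def idf_lam by blast

lemma Wm_comp: "mor' b c f \<Longrightarrow> mor' c d g \<Longrightarrow> x \<in> fld M (WO b) \<Longrightarrow> Wm c d g (Wm b c f x) = Wm b d (\<lambda>x. g (f x)) x"
  using dil(1) mor'_mor[of b c f] mor'_mor[of c d g] mc_comp[of b c f d g] unfolding dil_functor_def Wm_def by metis

lemma mc_cong: "(\<And>x. x \<in> fl c \<Longrightarrow> f x = g x) \<Longrightarrow> mc c f = mc c g"
  unfolding mc_def by (metis lam_cong)

lemma Wm_cong: "(\<And>x. x \<in> fl c \<Longrightarrow> f x = g x) \<Longrightarrow> Wm c d f = Wm c d g"
  unfolding Wm_def[abs_def] using mc_cong by metis

lemma Wm_supp: "mor' c d h \<Longrightarrow> x \<in> fld M (WO c) \<Longrightarrow> sp d (Wm c d h x) = h ` sp c x"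
proof -
  assume m: "mor' c d h" and x: "x \<in> fld M (WO c)"
  have "c \<in> obj K" using m by (simp add: mor'_def)
  then have "fun_on M (W_supp M W c) (fld M (W_ord M W c)) {s. fin_code M s \<and> elems M s \<subseteq> fld M (elems M c)}"
    using dil(3) unfolding supp_natural_def by blast
  from fun_on_ap[OF this x] have sub: "sp c x \<subseteq> fl c" by simp
  have "sp d (Wm c d h x) = ap M (elems M (mc c h)) ` sp c x"
    using dil(3) mor'_mor[OF m] x unfolding supp_natural_def Wm_def by blast
  also have "\<dots> = h ` sp c x" using sub m by (intro image_cong) (auto simp: mc mor'_def)
  finally show ?thesis .
qed

text \<open>The value of W at a map between finite orders p and q outside the skeleton, read as a
  map from W(|p|) to W(|q|). It is again functorial, and the enumerations stay hidden.\<close>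

definition WT where "WT p q f = Wm (rp p) (rp q) (tr p q f)"

definition fmor where "fmor p q f \<longleftrightarrow> fin_po M p \<and> fin_po M q \<and> rec f \<and> qe f (elems M p) (elems M q)"

lemma fmor_comp: "fmor p q f \<Longrightarrow> fmor q r g \<Longrightarrow> fmor p r (\<lambda>x. g (f x))"
  unfolding fmor_def using qe_comp rec_comp by blast

lemma fmor_tr: "fmor p q f \<Longrightarrow> mor' (rp p) (rp q) (tr p q f)"
  unfolding fmor_def using mor'_tr by blast

lemma WT_qe: "fmor p q f \<Longrightarrow> qe (WT p q f) (WO (rp p)) (WO (rp q))"
  unfolding WT_def using fmor_tr Wm_qe by blast

lemma WT_fld: "fmor p q f \<Longrightarrow> x \<in> fld M (WO (rp p)) \<Longrightarrow> WT p q f x \<in> fld M (WO (rp q))"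
  using WT_qe qe_def by blast

lemma WT_eh: "fmor p q f \<Longrightarrow> eh f (elems M p) (elems M q) \<Longrightarrow> eh (WT p q f) (WO (rp p)) (WO (rp q))"
  unfolding WT_def using fmor_tr Wm_eh eh_tr fmor_def by metis

text \<open>In the composite of the two conjugated maps, \<open>J q\<close> followed by
  \<open>E q\<close> cancels in the middle.\<close>

lemma WT_comp: assumes "fmor p q f" "fmor q r g" "x \<in> fld M (WO (rp p))"
  shows "WT q r g (WT p q f x) = WT p r (\<lambda>x. g (f x)) x"
proof -
  have "WT q r g (WT p q f x) = Wm (rp p) (rp r) (\<lambda>x. tr q r g (tr p q f x)) x"
    unfolding WT_def by (rule Wm_comp[OF fmor_tr[OF assms(1)] fmor_tr[OF assms(2)] assms(3)])
  also have "Wm (rp p) (rp r) (\<lambda>x. tr q r g (tr p q f x)) = Wm (rp p) (rp r) (tr p r (\<lambda>x. g (f x)))"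
  proof (rule Wm_cong)
    fix x assume "x \<in> fl (rp p)"
    then have "f (E p x) \<in> fl q" using E_fl assms(1) unfolding fmor_def qe_def by blast
    then show "tr q r g (tr p q f x) = tr p r (\<lambda>x. g (f x)) x"
      unfolding tr_def using E_J assms(1) fmor_def by simp
  qed
  finally show ?thesis by (simp add: WT_def)
qed

lemma sp_sub: "c \<in> obj K \<Longrightarrow> x \<in> fld M (WO c) \<Longrightarrow> sp c x \<subseteq> fl c"
  using dil(3) fun_on_ap unfolding supp_natural_def by blast

text \<open>Supports are subsets of |p| and |q|; read in p and q through the enumerations, they are
  related by f itself.\<close>

lemma WT_supp: assumes "fmor p q f" "x \<in> fld M (WO (rp p))"
  shows "E q ` sp (rp q) (WT p q f x) = f ` E p ` sp (rp p) x"
proof -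
  have p: "fin_po M p" and q: "fin_po M q" using assms(1) by (auto simp: fmor_def)
  have "sp (rp p) x \<subseteq> fl (rp p)" by (rule sp_sub) (use assms p rp_obj in auto)
  then have "f (E p y) \<in> fl q" if "y \<in> sp (rp p) x" for y
    using E_fl[OF p] assms(1) that unfolding fmor_def qe_def by blast
  then show ?thesis unfolding WT_def Wm_supp[OF fmor_tr[OF assms(1)] assms(2)]
    by (simp add: image_image tr_def E_J[OF q])
qed

lemma W_ind_eq:
  assumes "fin_po M p" "fin_po M q" "fl p \<subseteq> A" "f ` fl p \<subseteq> fl q"
  shows "ap M (W_ind M K W (lam A f) p q) x = WT p q f x"
proof -
  have "ap M (repr K) p = rp p" "ap M (repr K) q = rp q" using assms by (simp_all add: rp_def)
  then show ?thesis unfolding W_ind_def ind_mor_eq[OF assms] by (simp add: WT_def Wm_def)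
qed

end

section \<open>Sequences in well partial orders, and the two added points\<close>

context rca
begin

lemma rec_minus [recs]: assumes "rec f" "rec g" shows "rec (\<lambda>x. f x \<ominus> g x)"
proof (rule rec2[OF _ assms], rule rec_graph[of "\<lambda>z y. p2 z \<preceq> p1 z \<and> p1 z = p2 z \<oplus> y \<or> \<not> p2 z \<preceq> p1 z \<and> y = \<zero>"])
  show "dec (\<lambda>z. p2 (p1 z) \<preceq> p1 (p1 z) \<and> p1 (p1 z) = p2 (p1 z) \<oplus> p2 z \<or> \<not> p2 (p1 z) \<preceq> p1 (p1 z) \<and> p2 z = \<zero>)"
    by (intro recs)
next
  fix z y
  show "(p2 z \<preceq> p1 z \<and> p1 z = p2 z \<oplus> y \<or> \<not> p2 z \<preceq> p1 z \<and> y = \<zero>) \<longleftrightarrow> y = p1 z \<ominus> p2 z"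
  proof (cases "p2 z \<preceq> p1 z")
    case True
    then obtain k where "p1 z = p2 z \<oplus> k" using le_iff by blast
    then show ?thesis by (auto simp: minus_add')
  qed (simp add: minus_0')
qed

lemma rec_lam_UNIV: "rec g \<longleftrightarrow> lam UNIV g \<in> sets M"
  by (simp add: rec_def lam_def)

text \<open>The sequences that exist in the model are exactly those given by a computable
  function.\<close>

lemma wpo_iff: "wpo M X \<longleftrightarrow> partial_order M X \<and>
  (\<forall>g. rec g \<longrightarrow> (\<forall>i. g i \<in> fld M X) \<longrightarrow> (\<exists>i j. i \<prec> j \<and> \<langle>g i, g j\<rangle> \<in> X))"
proof -
  have "(\<forall>F\<in>sets M. fun_on M F UNIV (fld M X) \<longrightarrow> (\<exists>i j. i \<prec> j \<and> \<langle>ap M F i, ap M F j\<rangle> \<in> X)) \<longleftrightarrow>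
    (\<forall>g. rec g \<longrightarrow> (\<forall>i. g i \<in> fld M X) \<longrightarrow> (\<exists>i j. i \<prec> j \<and> \<langle>g i, g j\<rangle> \<in> X))" (is "?l \<longleftrightarrow> ?r")
  proof
    assume l: ?l
    show ?r
    proof (intro allI impI)
      fix g assume "rec g" "\<forall>i. g i \<in> fld M X"
      then show "\<exists>i j. i \<prec> j \<and> \<langle>g i, g j\<rangle> \<in> X"
        using l[rule_format, of "lam UNIV g"] fun_on_lam[of UNIV g "fld M X"] by (simp add: rec_lam_UNIV)
    qed
  next
    assume r: ?r
    show ?l
    proof (intro ballI impI)
      fix F assume F: "F \<in> sets M" "fun_on M F UNIV (fld M X)"
      then have "rec (ap M F)" unfolding rec_lam_UNIV using fun_on_eq_lam by metis
      then show "\<exists>i j. i \<prec> j \<and> \<langle>ap M F i, ap M F j\<rangle> \<in> X" using r fun_on_ap[OF F(2)] by blast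
    qed
  qed
  then show ?thesis unfolding wpo_def by simp
qed

lemma fin_power_iff: "\<langle>s, t\<rangle> \<in> fin_power M X n \<longleftrightarrow> is_seq M (fld M X) n s \<and> is_seq M (fld M X) n t \<and>
     (\<forall>i. i \<prec> n \<longrightarrow> \<langle>ap M (elems M s) i, ap M (elems M t) i\<rangle> \<in> X)"
  by (auto simp: fin_power_def)

lemma fin_power_fld: assumes "po M X" shows "s \<in> fld M (fin_power M X n) \<longleftrightarrow> is_seq M (fld M X) n s"
  unfolding fld_iff[of s] fin_power_iff using po_refl[OF assms] fun_on_ap unfolding is_seq_def by blast

text \<open>Points of \<open>X\<close> get the tag 0; the new points are \<open>(1, 0)\<close> and \<open>(1, 1)\<close>.\<close>

definition add_two where "add_two X = {z. is_pair z \<and> is_pair (p1 z) \<and> is_pair (p2 z) \<and> p1 (p1 z) = p1 (p2 z) \<and>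
  (p1 (p1 z) = \<zero> \<and> \<langle>p2 (p1 z), p2 (p2 z)\<rangle> \<in> X \<or> p1 (p1 z) = \<one> \<and> p2 (p1 z) = p2 (p2 z) \<and> p2 (p1 z) \<preceq> \<one>)}"

lemma add_two_iff: "\<langle>\<langle>u, x\<rangle>, \<langle>v, y\<rangle>\<rangle> \<in> add_two X \<longleftrightarrow> u = v \<and> (u = \<zero> \<and> \<langle>x, y\<rangle> \<in> X \<or> u = \<one> \<and> x = y \<and> x \<preceq> \<one>)"
  by (simp add: add_two_def)

lemma zero_one [simp]: "\<zero> \<noteq> \<one>" "\<one> \<noteq> \<zero>" "\<zero> \<prec> \<one>"
  using N.zero_neq_one by auto

lemma le_one: "x \<preceq> \<one> \<longleftrightarrow> x = \<zero> \<or> x = \<one>"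
  by (simp add: N.le_less)

lemma add_two_fld: "w \<in> fld M (add_two X) \<longleftrightarrow> (\<exists>x\<in>fld M X. w = \<langle>\<zero>, x\<rangle>) \<or> w = \<langle>\<one>, \<zero>\<rangle> \<or> w = \<langle>\<one>, \<one>\<rangle>"
proof -
  have "is_pair w" if "w \<in> fld M (add_two X)" using that by (simp add: fld_iff add_two_def)
  then show ?thesis by (cases "is_pair w") (auto simp: is_pair_def fld_iff add_two_iff le_one)
qed

lemma wpo_add_two:
  assumes "wpo M X" shows "wpo M (add_two X)"
proof -
  have X: "X \<in> sets M" "po M X" using assms by (auto simp: wpo_def partial_order_def)
  have "dec (\<lambda>z. is_pair z \<and> is_pair (p1 z) \<and> is_pair (p2 z) \<and> p1 (p1 z) = p1 (p2 z) \<and>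
  (p1 (p1 z) = \<zero> \<and> \<langle>p2 (p1 z), p2 (p2 z)\<rangle> \<in> X \<or> p1 (p1 z) = \<one> \<and> p2 (p1 z) = p2 (p2 z) \<and> p2 (p1 z) \<preceq> \<one>))"
    by (intro recs X)
  then have sets: "add_two X \<in> sets M" by (simp add: add_two_def dec_def)
  have pair: "\<exists>u x v y. z = \<langle>\<langle>u, x\<rangle>, \<langle>v, y\<rangle>\<rangle>" if "z \<in> add_two X" for z
    using that by (auto simp: add_two_def is_pair_def)
  have fldp: "is_pair x \<and> is_pair y" if "\<langle>x, y\<rangle> \<in> add_two X" for x y
    using that by (auto simp: add_two_def)
  have "po M (add_two X)"
    unfolding po_def
  proof (intro conjI ballI allI impI; (elim conjE)?)
    fix z assume z: "z \<in> add_two X"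
    with pair obtain u x v y where "z = \<langle>\<langle>u, x\<rangle>, \<langle>v, y\<rangle>\<rangle>" by blast
    with z show "\<exists>x\<in>fld M (add_two X). \<exists>y\<in>fld M (add_two X). z = \<langle>x, y\<rangle>"
      by (auto simp: fld_iff[of "\<langle>_, _\<rangle>"] add_two_iff dest: po_fld[OF X(2)] po_refl[OF X(2)])
  next
    fix x y assume xy: "\<langle>x, y\<rangle> \<in> add_two X" "\<langle>y, x\<rangle> \<in> add_two X"
    then show "x = y" using fldp[of x y] po_antisym[OF X(2)] by (auto simp: is_pair_def add_two_iff)
  next
    fix x y z assume "\<langle>x, y\<rangle> \<in> add_two X" "\<langle>y, z\<rangle> \<in> add_two X"
    then show "\<langle>x, z\<rangle> \<in> add_two X" using fldp[of x y] fldp[of y z] po_trans[OF X(2)]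
      by (auto simp: is_pair_def add_two_iff)
  qed
  moreover have "\<exists>i j. i \<prec> j \<and> \<langle>g i, g j\<rangle> \<in> add_two X" if g: "rec g" "\<forall>i. g i \<in> fld M (add_two X)" for g
  proof (rule ccontr)
    assume bad: "\<nexists>i j. i \<prec> j \<and> \<langle>g i, g j\<rangle> \<in> add_two X"
    \<comment> \<open>By reflexivity a bad sequence repeats no value, so each value v is avoided
      from some index on. This is where a pigeonhole principle is dispensed with.\<close>
    have "\<exists>n. \<forall>i. n \<preceq> i \<longrightarrow> g i \<noteq> v" for v
    proof (cases "\<exists>i. g i = v")
      case True
      then obtain i where i: "g i = v" by blast
      then have "g j \<noteq> v" if "i \<oplus> \<one> \<preceq> j" for j
        using bad that g(2) fld_iff unfolding Suc_le by metis
      then show ?thesis by blast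
    qed auto
    then obtain n m where nm: "\<forall>i. n \<preceq> i \<longrightarrow> g i \<noteq> \<langle>\<one>, \<zero>\<rangle>" "\<forall>i. m \<preceq> i \<longrightarrow> g i \<noteq> \<langle>\<one>, \<one>\<rangle>" by metis
    have x: "\<exists>x\<in>fld M X. g (n \<oplus> m \<oplus> i) = \<langle>\<zero>, x\<rangle>" for i
    proof -
      have "n \<preceq> n \<oplus> m \<oplus> i" "m \<preceq> n \<oplus> m \<oplus> i" by (intro le_add1 le_add2, simp)+
      then show ?thesis using nm g(2) add_two_fld by blast
    qed
    \<comment> \<open>Neither new point occurs from index n + m on, so the shifted sequence stays in
      X; dropping the tag 0 gives \<open>h\<close>.\<close>
    define h where "h i = p2 (g (n \<oplus> m \<oplus> i))" for i
    have "rec (\<lambda>i. g (n \<oplus> m \<oplus> i))" by (rule rec_comp[OF g(1)]) (intro recs)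
    then have "rec h" unfolding h_def[abs_def] by (intro recs)
    moreover have gh: "g (n \<oplus> m \<oplus> i) = \<langle>\<zero>, h i\<rangle>" "h i \<in> fld M X" for i using x[of i] by (auto simp: h_def)
    ultimately obtain i j where "i \<prec> j" "\<langle>h i, h j\<rangle> \<in> X" using assms unfolding wpo_iff by blast
    then have "n \<oplus> m \<oplus> i \<prec> n \<oplus> m \<oplus> j" "\<langle>g (n \<oplus> m \<oplus> i), g (n \<oplus> m \<oplus> j)\<rangle> \<in> add_two X"
      by (auto simp: gh add_two_iff)
    then show False using bad by blast
  qed
  ultimately show ?thesis using sets unfolding wpo_iff partial_order_def by blast
qed

end

section \<open>The extension W(X) as a partial order\<close>

context dilator
begin

lemma WO_iff: "\<langle>x, y\<rangle> \<in> WO c \<longleftrightarrow> \<langle>c, \<langle>x, y\<rangle>\<rangle> \<in> d_ord W"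
  by (simp add: W_ord_def col_def)

lemma trace_iff: "\<langle>c, x\<rangle> \<in> trace M K W \<longleftrightarrow> c \<in> obj K \<and> x \<in> fld M (WO c) \<and> sp c x = fl c"
  by (auto simp: trace_def)

text \<open>All data of an application of W are packed into one argument, with value 0 on
  meaningless input. The result is computable because its graph is read off from the set
  \<open>d_map W\<close>.\<close>

definition wv where "wv u = (let c = p1 (p1 u); d = p2 (p1 u); f = p1 (p2 u); x = p2 (p2 u) in
   if mor M K c d f \<and> x \<in> fld M (WO c) then ap M (W_map M W c d f) x else \<zero>)"

lemma rec_wv: assumes "rec f" shows "rec (\<lambda>x. wv (f x))"
proof (rule rec_comp[OF _ assms], rule rec_graph[of "\<lambda>u y.
    (mor M K (p1 (p1 u)) (p2 (p1 u)) (p1 (p2 u)) \<and> p2 (p2 u) \<in> fld M (WO (p1 (p1 u)))) \<and>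
      \<langle>\<langle>\<langle>p1 (p1 u), p2 (p1 u)\<rangle>, p1 (p2 u)\<rangle>, \<langle>p2 (p2 u), y\<rangle>\<rangle> \<in> d_map W \<or>
    \<not> (mor M K (p1 (p1 u)) (p2 (p1 u)) (p1 (p2 u)) \<and> p2 (p2 u) \<in> fld M (WO (p1 (p1 u)))) \<and> y = \<zero>"], goal_cases)
  case 1
  show ?case unfolding fld_iff WO_iff by (intro recs W_sets)
next
  case (2 u y)
  let ?c = "p1 (p1 u)" and ?d = "p2 (p1 u)" and ?f = "p1 (p2 u)" and ?x = "p2 (p2 u)"
  show ?case
  proof (cases "mor M K ?c ?d ?f \<and> ?x \<in> fld M (WO ?c)")
    case True
    then have "fun_on M (W_map M W ?c ?d ?f) (fld M (WO ?c)) (fld M (WO ?d))"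
      using dil(1) unfolding dil_functor_def quasi_emb_def by blast
    from fun_on_iff[OF this, of ?x y] show ?thesis using True by (simp add: wv_def Let_def W_map_def col_def)
  qed (auto simp: wv_def Let_def)
qed

lemma WT_wv: "fmor p q f \<Longrightarrow> x \<in> fld M (WO (rp p)) \<Longrightarrow> WT p q f x = wv \<langle>\<langle>rp p, rp q\<rangle>, \<langle>mc (rp p) (tr p q f), x\<rangle>\<rangle>"
  using mor'_mor[OF fmor_tr] by (simp add: wv_def Let_def WT_def Wm_def)

context
  fixes X assumes X: "partial_order M X"
begin

abbreviation "D \<equiv> induced M X"

lemma X_sets: "X \<in> sets M" using X by (simp add: partial_order_def)

definition sub where "sub a \<longleftrightarrow> elems M a \<subseteq> fld M X"

lemma sub_D: assumes "sub a" shows "fin_po M (D a)" "fl (D a) = elems M a"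
  "\<And>x y. \<langle>x, y\<rangle> \<in> elems M (D a) \<longleftrightarrow> \<langle>x, y\<rangle> \<in> X \<and> x \<in> elems M a \<and> y \<in> elems M a"
  using induced_fin_po[OF X] induced_fl[OF X] induced_iff[OF X] assms unfolding sub_def by blast+

lemma ext_elem_iff: "ext_elem M K W X a \<sigma> \<longleftrightarrow> fin_code M a \<and> sub a \<and> \<sigma> \<in> fld M (WO (rp (D a))) \<and> sp (rp (D a)) \<sigma> = fl (rp (D a))"
proof (cases "sub a")
  case True
  then have "ap M (repr K) (D a) = rp (D a)" using sub_D by (simp add: rp_def)
  then show ?thesis using rp_obj[OF sub_D(1)[OF True]] by (auto simp: ext_elem_def trace_iff sub_def)
qed (simp add: ext_elem_def sub_def)

lemma incl: assumes "sub b" "elems M a \<subseteq> elems M b"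
  shows "sub a" "fmor (D a) (D b) (\<lambda>x. x)" "eh (\<lambda>x. x) (elems M (D a)) (elems M (D b))"
proof -
  show a: "sub a" using assms by (auto simp: sub_def)
  show "eh (\<lambda>x. x) (elems M (D a)) (elems M (D b))"
    using assms(2) unfolding eh_def qe_def sub_D(2)[OF a] sub_D(2)[OF assms(1)] sub_D(3)[OF a] sub_D(3)[OF assms(1)] by auto
  then show "fmor (D a) (D b) (\<lambda>x. x)" using eh_qe sub_D(1)[OF a] sub_D(1)[OF assms(1)] by (auto simp: fmor_def intro: recs)
qed

text \<open>Comparison over an arbitrary finite s that contains a and b. \<open>ext_le\<close> uses
  their union, whereas transitivity calls for a set common to three elements.\<close>

definition Wle where "Wle s a \<sigma> b \<tau> \<longleftrightarrow> \<langle>WT (D a) (D s) (\<lambda>x. x) \<sigma>, WT (D b) (D s) (\<lambda>x. x) \<tau>\<rangle> \<in> WO (rp (D s))"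

abbreviation "un a b \<equiv> code_of M (elems M a \<union> elems M b)"

lemma un_elems [simp]: "elems M (un a b) = elems M a \<union> elems M b"
  by (simp add: fin_un)

lemma sub_un: "sub a \<Longrightarrow> sub b \<Longrightarrow> sub (un a b)" by (simp add: sub_def)

lemma ext_le_iff: assumes "sub a" "sub b" shows "ext_le M K W X a \<sigma> b \<tau> \<longleftrightarrow> Wle (un a b) a \<sigma> b \<tau>"
proof -
  have r: "sub (un a b)" using assms sub_un by blast
  have i: "ap M (W_ind M K W (idf M (fld M X)) (D c) (D (un a b))) x = WT (D c) (D (un a b)) (\<lambda>x. x) x"
    if "sub c" "elems M c \<subseteq> elems M a \<union> elems M b" for c x
    unfolding idf_lam using that sub_D[OF r] sub_D[OF that(1)] by (intro W_ind_eq) (auto simp: sub_def fin_un)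
  show ?thesis unfolding ext_le_def Let_def using i[OF assms(1)] i[OF assms(2)] sub_D[OF r]
    by (simp add: Wle_def rp_def)
qed

text \<open>The inclusion of r in s is an embedding and W preserves embeddings; so the comparison
  does not depend on the finite set over which it is made.\<close>

lemma Wle_super:
  assumes "sub s" "elems M r \<subseteq> elems M s" "elems M a \<subseteq> elems M r" "elems M b \<subseteq> elems M r"
    "\<sigma> \<in> fld M (WO (rp (D a)))" "\<tau> \<in> fld M (WO (rp (D b)))"
  shows "Wle r a \<sigma> b \<tau> \<longleftrightarrow> Wle s a \<sigma> b \<tau>"
proof -
  note rs = incl[OF assms(1,2)] and a = incl[OF incl(1)[OF assms(1,2)] assms(3)] and b = incl[OF incl(1)[OF assms(1,2)] assms(4)]
  have "eh (WT (D r) (D s) (\<lambda>x. x)) (WO (rp (D r))) (WO (rp (D s)))" by (rule WT_eh[OF rs(2,3)])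
  moreover have "WT (D a) (D r) (\<lambda>x. x) \<sigma> \<in> fld M (WO (rp (D r)))" "WT (D b) (D r) (\<lambda>x. x) \<tau> \<in> fld M (WO (rp (D r)))"
    using WT_fld a(2) b(2) assms by blast+
  ultimately have "Wle r a \<sigma> b \<tau> \<longleftrightarrow>
    \<langle>WT (D r) (D s) (\<lambda>x. x) (WT (D a) (D r) (\<lambda>x. x) \<sigma>), WT (D r) (D s) (\<lambda>x. x) (WT (D b) (D r) (\<lambda>x. x) \<tau>)\<rangle> \<in> WO (rp (D s))"
    unfolding Wle_def eh_def qe_def by blast
  then show ?thesis using WT_comp[OF a(2) rs(2)] WT_comp[OF b(2) rs(2)] assms by (simp add: Wle_def)
qed

lemma ext_iff: "\<langle>\<langle>a, \<sigma>\<rangle>, \<langle>b, \<tau>\<rangle>\<rangle> \<in> ext M K W X \<longleftrightarrow> ext_elem M K W X a \<sigma> \<and> ext_elem M K W X b \<tau> \<and> Wle (un a b) a \<sigma> b \<tau>"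
  using ext_le_iff ext_elem_iff by (auto simp: ext_def)

lemma ext_refl: "ext_elem M K W X a \<sigma> \<Longrightarrow> Wle (un a a) a \<sigma> a \<sigma>"
proof -
  assume e: "ext_elem M K W X a \<sigma>"
  then have "fmor (D a) (D (un a a)) (\<lambda>x. x)" "fin_po M (D (un a a))"
    using incl[of "un a a" a] sub_D sub_un unfolding ext_elem_iff by auto
  then show ?thesis unfolding Wle_def using WT_fld e po_refl[OF WO_po] rp_obj unfolding ext_elem_iff by blast
qed

lemma ext_fld: "z \<in> fld M (ext M K W X) \<longleftrightarrow> (\<exists>a \<sigma>. z = \<langle>a, \<sigma>\<rangle> \<and> ext_elem M K W X a \<sigma>)"
proof -
  have "\<exists>a \<sigma>. z = \<langle>a, \<sigma>\<rangle>" if "\<langle>z, z\<rangle> \<in> ext M K W X" using that by (auto simp: ext_def)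
  then show ?thesis unfolding fld_iff using ext_iff ext_refl by metis
qed

lemma ext_po: "po M (ext M K W X)"
proof -
  have pair: "\<exists>a \<sigma> b \<tau>. x = \<langle>a, \<sigma>\<rangle> \<and> y = \<langle>b, \<tau>\<rangle> \<and> ext_elem M K W X a \<sigma> \<and> ext_elem M K W X b \<tau> \<and> Wle (un a b) a \<sigma> b \<tau>"
    if "\<langle>x, y\<rangle> \<in> ext M K W X" for x y
  proof -
    have "\<exists>a \<sigma> b \<tau>. x = \<langle>a, \<sigma>\<rangle> \<and> y = \<langle>b, \<tau>\<rangle>" using that by (auto simp: ext_def)
    then show ?thesis using that ext_iff by blast
  qed
  show ?thesis unfolding po_def
  proof (intro conjI ballI allI impI; (elim conjE)?)
    fix z assume z: "z \<in> ext M K W X"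
    then obtain x y where "z = \<langle>x, y\<rangle>" by (auto simp: ext_def)
    then show "\<exists>x\<in>fld M (ext M K W X). \<exists>y\<in>fld M (ext M K W X). z = \<langle>x, y\<rangle>" using z pair ext_fld by blast
  next
    fix x y assume "\<langle>x, y\<rangle> \<in> ext M K W X" "\<langle>y, x\<rangle> \<in> ext M K W X"
    with pair obtain a \<sigma> b \<tau> where xy: "x = \<langle>a, \<sigma>\<rangle>" "y = \<langle>b, \<tau>\<rangle>" and e: "ext_elem M K W X a \<sigma>" "ext_elem M K W X b \<tau>"
      and le: "Wle (un a b) a \<sigma> b \<tau>" "Wle (un b a) b \<tau> a \<sigma>" by (metis pr_inj)
    let ?r = "un a b"
    have ea: "fin_code M a" "sub a" "\<sigma> \<in> fld M (WO (rp (D a)))" "sp (rp (D a)) \<sigma> = fl (rp (D a))"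
      and eb: "fin_code M b" "sub b" "\<tau> \<in> fld M (WO (rp (D b)))" "sp (rp (D b)) \<tau> = fl (rp (D b))"
      using e by (auto simp: ext_elem_iff)
    have r: "sub ?r" using ea eb sub_un by blast
    have "un b a = un a b" by (simp add: Un_commute)
    then have eq: "WT (D a) (D ?r) (\<lambda>x. x) \<sigma> = WT (D b) (D ?r) (\<lambda>x. x) \<tau>"
      using le po_antisym[OF WO_po[OF rp_obj[OF sub_D(1)[OF r]]]] unfolding Wle_def by metis
    have fa: "fmor (D a) (D ?r) (\<lambda>x. x)" and fb: "fmor (D b) (D ?r) (\<lambda>x. x)" using incl[OF r] by auto
    \<comment> \<open>Both elements have the same image over the union, hence the same support
      there. As their supports are full, this support is both a and b.\<close>
    have "elems M a = E (D a) ` sp (rp (D a)) \<sigma>" using ea sub_D E_image by metis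
    also have "\<dots> = E (D b) ` sp (rp (D b)) \<tau>" using WT_supp[OF fa ea(3)] WT_supp[OF fb eb(3)] eq by simp
    also have "\<dots> = elems M b" using eb sub_D E_image by metis
    finally have ab: "a = b" using ea eb fin_code_unique by blast
    then have "\<sigma> = \<tau>" using qe_inj[OF WT_qe[OF fa] WO_po[OF rp_obj[OF sub_D(1)[OF ea(2)]]]] eq ea eb by blast
    then show "x = y" using xy ab by simp
  next
    fix x y z assume "\<langle>x, y\<rangle> \<in> ext M K W X" "\<langle>y, z\<rangle> \<in> ext M K W X"
    with pair[of x y] pair[of y z] obtain a \<sigma> b \<tau> c \<upsilon> where xyz: "x = \<langle>a, \<sigma>\<rangle>" "y = \<langle>b, \<tau>\<rangle>" "z = \<langle>c, \<upsilon>\<rangle>"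
      and e: "ext_elem M K W X a \<sigma>" "ext_elem M K W X b \<tau>" "ext_elem M K W X c \<upsilon>"
      and le: "Wle (un a b) a \<sigma> b \<tau>" "Wle (un b c) b \<tau> c \<upsilon>" by (metis pr_inj)
    note e' = e[unfolded ext_elem_iff]
    \<comment> \<open>All three elements are compared over one finite set, where the order of W is
      transitive.\<close>
    let ?s = "un (un a b) c"
    have s: "sub ?s" using e' sub_un by blast
    have "Wle ?s a \<sigma> b \<tau>" "Wle ?s b \<tau> c \<upsilon>"
      using le e' Wle_super[OF s, of "un a b" a b \<sigma> \<tau>] Wle_super[OF s, of "un b c" b c \<tau> \<upsilon>] by (auto simp: fin_un)
    then have "Wle ?s a \<sigma> c \<upsilon>" unfolding Wle_def using po_trans[OF WO_po[OF rp_obj[OF sub_D(1)[OF s]]]] by blast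
    then have "Wle (un a c) a \<sigma> c \<upsilon>" using e' Wle_super[OF s, of "un a c" a c \<sigma> \<upsilon>] by (auto simp: fin_un)
    then show "\<langle>x, z\<rangle> \<in> ext M K W X" using e xyz ext_iff by blast
  qed
qed

lemma rec_un: assumes "rec f" "rec g" shows "rec (\<lambda>x. un (f x) (g x))"
proof -
  have "elems M a \<union> elems M b = {y. y \<prec> a \<oplus> b \<and> (y \<in> elems M a \<or> y \<in> elems M b)}" for a b
    by (auto dest: elems_less intro: less_add1 less_add2)
  then have "rec (\<lambda>z. un (p1 z) (p2 z))" by (simp only:) (intro recs)
  then show ?thesis by (rule rec2[OF _ assms])
qed

text \<open>Membership is decided from three sets: the trace tells what the elements are, while
  \<open>d_map W\<close> and \<open>d_ord W\<close> determine the comparison over the computable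
  union of the supports.\<close>

lemma ext_partial_order: assumes "trace M K W \<in> sets M" shows "partial_order M (ext M K W X)"
proof -
  define el where "el a \<sigma> \<longleftrightarrow> fin_code M a \<and> (\<forall>x. x \<prec> a \<longrightarrow> x \<in> elems M a \<longrightarrow> x \<in> fld M X) \<and> \<langle>rp (D a), \<sigma>\<rangle> \<in> trace M K W" for a \<sigma>
  have el: "ext_elem M K W X a \<sigma> \<longleftrightarrow> el a \<sigma>" for a \<sigma>
    unfolding ext_elem_iff el_def trace_iff sub_def using rp_obj sub_D(1) elems_less unfolding sub_def by blast
  have dec_el: "dec (\<lambda>z. el (f z) (g z))" if "rec f" "rec g" for f g
    by (rule dec2[OF _ that]) (unfold el_def, intro recs X_sets assms)
  define wt where "wt a r \<sigma> = wv \<langle>\<langle>rp (D a), rp (D r)\<rangle>, \<langle>mc (rp (D a)) (tr (D a) (D r) (\<lambda>x. x)), \<sigma>\<rangle>\<rangle>" for a r \<sigma>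
  have rec_wt: "rec (\<lambda>z. wt (f z) (g z) (h z))" if "rec f" "rec g" "rec h" for f g h
  proof -
    have "rec (\<lambda>z. wt (p1 (p1 z)) (p2 (p1 z)) (p2 z))"
      unfolding wt_def mc_def tr_def[abs_def] by (intro rec_wv recs X_sets)
    from rec_comp[OF this, of "\<lambda>z. \<langle>\<langle>f z, g z\<rangle>, h z\<rangle>"] show ?thesis using that by (simp add: recs)
  qed
  have "z \<in> ext M K W X \<longleftrightarrow> is_pair z \<and> is_pair (p1 z) \<and> is_pair (p2 z) \<and> el (p1 (p1 z)) (p2 (p1 z)) \<and> el (p1 (p2 z)) (p2 (p2 z)) \<and>
    \<langle>rp (D (un (p1 (p1 z)) (p1 (p2 z)))), \<langle>wt (p1 (p1 z)) (un (p1 (p1 z)) (p1 (p2 z))) (p2 (p1 z)),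
      wt (p1 (p2 z)) (un (p1 (p1 z)) (p1 (p2 z))) (p2 (p2 z))\<rangle>\<rangle> \<in> d_ord W" (is "_ \<longleftrightarrow> ?R z") for z
  proof (cases "\<exists>a \<sigma> b \<tau>. z = \<langle>\<langle>a, \<sigma>\<rangle>, \<langle>b, \<tau>\<rangle>\<rangle>")
    case True
    then obtain a \<sigma> b \<tau> where z: "z = \<langle>\<langle>a, \<sigma>\<rangle>, \<langle>b, \<tau>\<rangle>\<rangle>" by blast
    have "Wle (un a b) a \<sigma> b \<tau> \<longleftrightarrow> \<langle>rp (D (un a b)), \<langle>wt a (un a b) \<sigma>, wt b (un a b) \<tau>\<rangle>\<rangle> \<in> d_ord W"
      if "ext_elem M K W X a \<sigma>" "ext_elem M K W X b \<tau>"
    proof -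
      have "sub (un a b)" using that sub_un ext_elem_iff by blast
      then have "fmor (D a) (D (un a b)) (\<lambda>x. x)" "fmor (D b) (D (un a b)) (\<lambda>x. x)" using incl by auto
      then show ?thesis unfolding Wle_def WO_iff wt_def using WT_wv that ext_elem_iff by simp
    qed
    then show ?thesis unfolding z ext_iff el by auto
  next
    case False
    then have "\<not> (is_pair z \<and> is_pair (p1 z) \<and> is_pair (p2 z))" unfolding is_pair_eq by metis
    then show ?thesis using False by (auto simp: ext_def)
  qed
  moreover have "dec ?R" by (intro recs dec_el rec_un rec_wt X_sets W_sets)
  moreover from calculation(1) have "ext M K W X = {z. ?R z}" by blast
  ultimately have "ext M K W X \<in> sets M" unfolding dec_def by (simp only:)
  then show ?thesis using ext_po by (simp add: partial_order_def)
qed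

end

section \<open>Finite monotone dilators preserve well partial orders\<close>

text \<open>
  The vector \<open>v i\<close> is one-hot on its first half, at the position of the trace element of \<open>g i\<close>; its second
  half lists the enumeration of the support of \<open>g i\<close>. Since the enumeration \<open>E C\<close> of \<open>C\<close> itself may be a nontrivial
  automorphism, \<open>\<sigma>\<close> is the pullback of \<open>s i\<close> along it.
\<close>

lemma wpo_ext:
  assumes fin: "finite_dilator M K W" and mono: "monotone_dilator M K W" and X: "wpo M X"
    and power: "\<And>X n. wpo M X \<Longrightarrow> wpo M (fin_power M X n)"
  shows "wpo M (ext M K W X)"
proof -
  obtain t where t: "elems M t = trace M K W" using fin by (auto simp: finite_dilator_def)
  have pX: "partial_order M X" and sX: "X \<in> sets M" using X by (auto simp: wpo_def partial_order_def)
  have p: "partial_order M (ext M K W X)" using ext_partial_order[OF pX] t elems_sets by metis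
  have "\<exists>i j. i \<prec> j \<and> \<langle>g i, g j\<rangle> \<in> ext M K W X" if g: "rec g" "\<forall>i. g i \<in> fld M (ext M K W X)" for g
  proof -
    define a where "a i = p1 (g i)" for i
    define s where "s i = p2 (g i)" for i
    define c where "c i = rp (induced M X (a i))" for i
    have ga: "g i = \<langle>a i, s i\<rangle>" and ext: "ext_elem M K W X (a i) (s i)" for i
      using g(2) ext_fld[OF pX] unfolding a_def s_def by (metis p1_pr p2_pr)+
    note e = ext[unfolded ext_elem_iff[OF pX]]
    have D: "fin_po M (induced M X (a i))" "fl (induced M X (a i)) = elems M (a i)"
      and D_iff: "\<And>x y. \<langle>x, y\<rangle> \<in> elems M (induced M X (a i)) \<longleftrightarrow> \<langle>x, y\<rangle> \<in> X \<and> x \<in> elems M (a i) \<and> y \<in> elems M (a i)" for i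
      using sub_D[OF pX] e by blast+
    have c: "c i \<in> obj K" for i unfolding c_def by (rule rp_obj[OF D(1)])
    \<comment> \<open>An element is smaller than the code of its set, so \<langle>c i, s i\<rangle>
      is below t and can serve as a position. The points of \<open>c i\<close> are smaller
      still.\<close>
    have ct: "\<langle>c i, s i\<rangle> \<prec> t" for i
      by (rule elems_less) (use e c in \<open>simp add: t trace_iff c_def\<close>)
    have c_less: "x \<prec> t" if "x \<in> fl (c i)" for x i
      using fl_less[OF that] le_pr1 ct N.less_le_trans N.less_trans by blast
    have rec_a: "rec (\<lambda>x. a (f x))" "rec (\<lambda>x. s (f x))" if "rec f" for f
      unfolding a_def s_def using rec_comp[OF g(1) that] by (auto intro: recs)
    have rec_c: "rec (\<lambda>x. c (f x))" if "rec f" for f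
      unfolding c_def by (intro recs sX rec_a that)
    \<comment> \<open>Position l < t stands for the trace element l, marked by (1, 0) against (1, 1)
      elsewhere; position t + x stands for the point x of |a i| and holds its value under the
      enumeration. A number x outside |a i| gets (1, 0) as a default.\<close>
    define v where "v i l = (if l \<prec> t then (if l = \<langle>c i, s i\<rangle> then \<langle>\<one>, \<zero>\<rangle> else \<langle>\<one>, \<one>\<rangle>)
       else (if l \<ominus> t \<in> fl (c i) then \<langle>\<zero>, E (induced M X (a i)) (l \<ominus> t)\<rangle> else \<langle>\<one>, \<zero>\<rangle>))" for i l
    define V where "V i = code_of M (lam {l. l \<prec> t \<oplus> t} (v i))" for i
    have rec_v: "rec (\<lambda>z. v (p1 z) (p2 z))" unfolding v_def by (intro recs rec_a rec_c sX)
    have "rec (v i)" for i by (rule rec2[OF rec_v]) (intro recs)+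
    then have "fin (lam {l. l \<prec> t \<oplus> t} (v i))" for i
      by (intro fin_lam fin_Collect[of _ "t \<oplus> t"] recs) auto
    then have V: "fin_code M (V i)" "elems M (V i) = lam {l. l \<prec> t \<oplus> t} (v i)" for i unfolding V_def using code_of by auto
    have "rec V" unfolding V_def[abs_def] by (rule rec_lam[OF _ _ rec_v, of _ "\<lambda>_. t \<oplus> t"]) (auto intro!: recs)
    moreover have vY: "v i l \<in> fld M (add_two X)" for i l
    proof -
      have "E (induced M X (a i)) x \<in> fld M X" if "x \<in> fl (c i)" for x
        using E_fl[OF D(1), of x i] that e D(2) unfolding c_def sub_def[OF pX] by blast
      then show ?thesis unfolding v_def add_two_fld by auto
    qed
    have Y: "wpo M (add_two X)" by (rule wpo_add_two[OF X])
    then have Yp: "po M (add_two X)" by (simp add: wpo_def partial_order_def)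
    moreover have "V i \<in> fld M (fin_power M (add_two X) (t \<oplus> t))" for i
      unfolding fin_power_fld[OF Yp] is_seq_def V(2) using V(1) vY fun_on_lam by simp
    ultimately obtain i j where ij: "i \<prec> j" and VV: "\<langle>V i, V j\<rangle> \<in> fin_power M (add_two X) (t \<oplus> t)"
      using power[OF Y, of "t \<oplus> t"] unfolding wpo_iff by blast
    have le: "\<langle>v i l, v j l\<rangle> \<in> add_two X" if "l \<prec> t \<oplus> t" for l
      using VV that unfolding fin_power_iff V by simp
    \<comment> \<open>At this position \<open>v i\<close> is (1, 0). As (1, 0) and (1, 1) are
      incomparable, \<open>v j\<close> is (1, 0) too, so both carry their mark at the same trace
      element.\<close>
    have "\<langle>v i \<langle>c i, s i\<rangle>, v j \<langle>c i, s i\<rangle>\<rangle> \<in> add_two X" using le ct less_add1 by blast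
    then have cs: "c i = c j" "s i = s j" using ct[of i] by (auto simp: v_def add_two_iff split: if_splits)
    have pointwise: "\<langle>E (induced M X (a i)) x, E (induced M X (a j)) x\<rangle> \<in> X" if x: "x \<in> fl (c i)" for x
    proof -
      have "t \<oplus> x \<prec> t \<oplus> t" using c_less[OF x] by simp
      then have "\<langle>v i (t \<oplus> x), v j (t \<oplus> x)\<rangle> \<in> add_two X" by (rule le)
      moreover have "t \<oplus> x \<ominus> t = x" by (rule minus_add')
      moreover have "\<not> t \<oplus> x \<prec> t" by (simp add: N.not_less)
      ultimately show ?thesis using x cs by (simp add: v_def add_two_iff)
    qed
    \<comment> \<open>The common representative now serves as a partial order in its own right, and
      the enumerations of \<open>a i\<close> and \<open>a j\<close> as quasi embeddings of it into
      X, to which monotonicity applies. Elements of W(C) are pairs, hence \<open>?b\<close> for the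
      support that exhausts C.\<close>
    define C where "C = c i"
    have C: "C \<in> obj K" "fin_po M C" "rp C = C" "po M (elems M C)" using c sk(4) rp_obj_eq fin_poD unfolding C_def by auto
    let ?b = "code_of M (fl C)"
    have b: "elems M ?b = fl C" "fin_code M ?b" using code_of[OF fin_fl] by auto
    have pC: "partial_order M (elems M C)" using C by (simp add: partial_order_def)
    have DC: "induced M (elems M C) ?b = C"
    proof (rule fin_code_unique)
      show "elems M (induced M (elems M C) ?b) = elems M C"
        unfolding induced_elems[OF pC, of ?b, unfolded b(1), OF subset_refl] dset_def
        using C(4) unfolding po_def by blast
    qed (use induced_code[OF pC, of ?b] b C fin_poD in auto)
    have mJ: "mor' C C (J C)" and mE: "mor' C C (E C)"
      using J_eh[OF C(2)] E_eh[OF C(2)] C eh_qe unfolding mor'_def by (auto intro!: recs)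
    have sC: "s i \<in> fld M (WO C)" "sp C (s i) = fl C" using e[of i] by (auto simp: C_def c_def)
    define \<sigma> where "\<sigma> = Wm C C (J C) (s i)"
    have \<sigma>: "\<sigma> \<in> fld M (WO C)" "sp C \<sigma> = fl C"
      using Wm_qe[OF mJ] sC Wm_supp[OF mJ] J_image[OF C(2)] C(3) by (auto simp: \<sigma>_def qe_def)
    have "ext_elem M K W (elems M C) ?b \<sigma>"
      unfolding ext_elem_iff[OF pC] sub_def[OF pC] DC C(3) using b \<sigma> by simp
    moreover have q: "qe (E (induced M X (a k))) (elems M C) X" if "c k = C" for k
      using E_eh[OF D(1), of k] E_fl[OF D(1), of _ k] D(2)[of k] e[of k] that
      unfolding eh_def qe_def D_iff c_def sub_def[OF pX] by blast
    moreover have "lam (fl C) (E (induced M X (a k))) \<in> sets M" for k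
      using fin_lam[OF fin_fl rec_E[OF rec_const rec_id]] unfolding fin_def by blast
    moreover have "c j = C" using cs C_def by simp
    ultimately have "\<langle>ext_map M K W (elems M C) X (lam (fl C) (E (induced M X (a i)))) ?b \<sigma>,
       ext_map M K W (elems M C) X (lam (fl C) (E (induced M X (a j)))) ?b \<sigma>\<rangle> \<in> ext M K W X"
      using mono[unfolded monotone_dilator_def, rule_format, of "lam (fl C) (E (induced M X (a i)))"
         "lam (fl C) (E (induced M X (a j)))" "elems M C" X ?b \<sigma>] pointwise pC pX
      by (simp add: quasi_emb_lam C_def)
    \<comment> \<open>For k = i and k = j, W applied to the enumeration of \<open>a k\<close> sends
      (\<open>?b\<close>, \<sigma>) to (\<open>a k\<close>, \<open>s i\<close>).\<close>
    moreover have "ext_map M K W (elems M C) X (lam (fl C) (E (induced M X (a k)))) ?b \<sigma> = \<langle>a k, s i\<rangle>" if k: "c k = C" for k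
    proof -
      have "ap M (lam (fl C) (E (induced M X (a k)))) ` elems M ?b = E (induced M X (a k)) ` fl C" by (simp add: b)
      also have "\<dots> = elems M (a k)" using E_image[OF D(1)[of k]] k D(2) unfolding c_def by simp
      finally have im: "code_of M (ap M (lam (fl C) (E (induced M X (a k)))) ` elems M ?b) = a k" using e by simp
      have "ap M (W_ind M K W (lam (fl C) (E (induced M X (a k)))) C (induced M X (a k))) \<sigma>
        = WT C (induced M X (a k)) (E (induced M X (a k))) \<sigma>"
        using E_image[OF D(1)[of k]] k unfolding c_def by (intro W_ind_eq) (auto simp: C D)
      also have "\<dots> = Wm C C (tr C (induced M X (a k)) (E (induced M X (a k)))) \<sigma>" using k C(3) by (simp add: WT_def c_def)
      \<comment> \<open>The two occurrences of the enumeration of \<open>a k\<close>, one as the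
        given map and one inverted in \<open>tr\<close>, cancel; that of C remains, and \<sigma> was
        chosen to undo it.\<close>
      also have "\<dots> = Wm C C (E C) \<sigma>"
        using E_fl[OF C(2)] C(3) J_E[OF D(1)] k by (subst Wm_cong[of C _ "E C"]) (auto simp: tr_def c_def)
      also have "\<dots> = Wm C C (\<lambda>x. E C (J C x)) (s i)" unfolding \<sigma>_def by (rule Wm_comp[OF mJ mE sC(1)])
      also have "\<dots> = Wm C C (\<lambda>x. x) (s i)" using E_J[OF C(2)] by (subst Wm_cong[of C _ "\<lambda>x. x"]) auto
      also have "\<dots> = s i" by (rule Wm_id[OF C(1) sC(1)])
      finally show ?thesis unfolding ext_map_def Let_def im DC by simp
    qed
    ultimately have "\<langle>\<langle>a i, s i\<rangle>, \<langle>a j, s i\<rangle>\<rangle> \<in> ext M K W X" using C_def cs by simp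
    then show ?thesis using ij ga cs by metis
  qed
  then show ?thesis using p unfolding wpo_iff by blast
qed

end

context rca
begin

section \<open>The power functor\<close>

definition seqcode where "seqcode n h = code_of M (lam {i. i \<prec> n} h)"

lemma fin_below [simp]: "fin {i. i \<prec> n}"
  by (rule fin_Collect[of _ n]) (intro recs)

lemma seqcode: assumes "rec h" shows "fin_code M (seqcode n h)" "elems M (seqcode n h) = lam {i. i \<prec> n} h"
  unfolding seqcode_def using code_of[OF fin_lam[OF fin_below assms]] by auto

lemma is_seq_seqcode: "rec h \<Longrightarrow> (\<And>i. i \<prec> n \<Longrightarrow> h i \<in> A) \<Longrightarrow> is_seq M A n (seqcode n h)"
  unfolding is_seq_def by (auto simp: seqcode intro!: fun_on_lam)

lemma seq_fun: "is_seq M A n s \<Longrightarrow> fun_on M (elems M s) {i. i \<prec> n} A"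
  by (simp add: is_seq_def)

lemma seq_ap: "is_seq M A n s \<Longrightarrow> i \<prec> n \<Longrightarrow> ap M (elems M s) i = apc s i"
  using apc_eq[OF seq_fun] by simp

lemma seq_in: "is_seq M A n s \<Longrightarrow> i \<prec> n \<Longrightarrow> apc s i \<in> A"
  using fun_on_ap[OF seq_fun] seq_ap by (metis mem_Collect_eq)

lemma seq_mem: "is_seq M A n s \<Longrightarrow> i \<prec> n \<Longrightarrow> \<langle>i, apc s i\<rangle> \<in> elems M s"
  using fun_on_iff[OF seq_fun] seq_ap by (metis mem_Collect_eq)

lemma apc_seqcode: "rec h \<Longrightarrow> i \<prec> n \<Longrightarrow> apc (seqcode n h) i = h i"
  using seq_ap[OF is_seq_seqcode[of h n UNIV]] by (simp add: seqcode)

lemma seqcode_cong: "(\<And>i. i \<prec> n \<Longrightarrow> f i = g i) \<Longrightarrow> seqcode n f = seqcode n g"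
  unfolding seqcode_def by (metis lam_cong mem_Collect_eq)

lemma seq_elems: "is_seq M A n s \<Longrightarrow> elems M s = lam {i. i \<prec> n} (apc s)"
  using fun_on_eq_lam[OF seq_fun] lam_cong[of "{i. i \<prec> n}"] seq_ap by (metis mem_Collect_eq)

lemma seqcode_apc: "is_seq M A n s \<Longrightarrow> seqcode n (apc s) = s"
  unfolding seqcode_def using seq_elems code_of_elems is_seq_def by metis

lemma rec_seqcode: "rec (\<lambda>z. h (p1 z) (p2 z)) \<Longrightarrow> rec (\<lambda>w. seqcode n (h w))"
  unfolding seqcode_def by (rule rec_lam[of _ "\<lambda>_. n"]) (auto intro!: recs)

lemma dec_is_seq:
  assumes "dec (\<lambda>z. p2 z \<in> A (p1 z))" "rec f" shows "dec (\<lambda>w. is_seq M (A w) n (f w))"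
proof -
  have "dec (\<lambda>z. p2 z \<in> {i. i \<prec> n})" by simp (intro recs)
  then have "dec (\<lambda>w. fun_on M (elems M (f w)) {i. i \<prec> n} (A w))"
    by (rule dec_fun_on[OF _ rec_const[of n] assms(1) _ assms(2)]) simp
  then show ?thesis unfolding is_seq_def by (intro recs assms)
qed

text \<open>The bound s makes the code computable and loses nothing for a sequence s, whose entries
  are smaller than s.\<close>

definition rng where "rng n s = code_of M {y. y \<prec> s \<and> (\<exists>i. i \<prec> n \<and> y = apc s i)}"

lemma rec_rng: "rec f \<Longrightarrow> rec (\<lambda>w. rng n (f w))"
  by (rule rec_comp[where g = "rng n"]) (unfold rng_def, intro recs)

lemma rng_set: assumes "is_seq M A n s" shows "{y. y \<prec> s \<and> (\<exists>i. i \<prec> n \<and> y = apc s i)} = apc s ` {i. i \<prec> n}"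
  using elems_pair_less(2) seq_mem[OF assms] by blast

lemma rng: assumes "is_seq M A n s" shows "fin_code M (rng n s)" "elems M (rng n s) = apc s ` {i. i \<prec> n}"
proof -
  have "fin (apc s ` {i. i \<prec> n})" by (rule fin_image) (auto intro!: recs)
  then show "fin_code M (rng n s)" "elems M (rng n s) = apc s ` {i. i \<prec> n}"
    unfolding rng_def rng_set[OF assms] using code_of by auto
qed

lemma fin_power_apc: "\<langle>s, t\<rangle> \<in> fin_power M X n \<longleftrightarrow> is_seq M (fld M X) n s \<and> is_seq M (fld M X) n t \<and>
     (\<forall>i. i \<prec> n \<longrightarrow> \<langle>apc s i, apc t i\<rangle> \<in> X)"
  unfolding fin_power_iff using seq_ap by (smt (verit, best))

lemma fin_power_po: assumes X: "po M X" shows "po M (fin_power M X n)"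
  unfolding po_def
proof (intro conjI ballI allI impI; (elim conjE)?)
  fix z assume "z \<in> fin_power M X n"
  then show "\<exists>x\<in>fld M (fin_power M X n). \<exists>y\<in>fld M (fin_power M X n). z = \<langle>x, y\<rangle>"
    using fin_power_fld[OF X] unfolding fin_power_def by blast
next
  fix x y assume xy: "\<langle>x, y\<rangle> \<in> fin_power M X n" "\<langle>y, x\<rangle> \<in> fin_power M X n"
  then have "seqcode n (apc x) = seqcode n (apc y)"
    using po_antisym[OF X] by (intro seqcode_cong) (simp add: fin_power_apc)
  then show "x = y" using xy seqcode_apc unfolding fin_power_apc by metis
next
  fix x y z assume "\<langle>x, y\<rangle> \<in> fin_power M X n" "\<langle>y, z\<rangle> \<in> fin_power M X n"
  then show "\<langle>x, z\<rangle> \<in> fin_power M X n" using po_trans[OF X] unfolding fin_power_apc by blast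
qed

lemma dec_fin_power:
  assumes "dec (\<lambda>z. p2 z \<in> X (p1 z))" "rec f" "rec g"
  shows "dec (\<lambda>w. \<langle>f w, g w\<rangle> \<in> fin_power M (X w) n)"
proof -
  have X: "dec (\<lambda>z. g z \<in> X (f z))" if "rec f" "rec g" for f g using dec2[OF assms(1) that] .
  have r: "rec (\<lambda>z. f (h z))" "rec (\<lambda>z. g (h z))" if "rec h" for h using that assms rec_comp by blast+
  have F: "dec (\<lambda>z. g z \<in> fld M (X (f z)))" if "rec f" "rec g" for f g
    unfolding fld_iff by (intro X recs that)
  show ?thesis unfolding fin_power_apc by (intro recs r dec_is_seq F X assms)
qed

lemma fin_power_partial_order: assumes "partial_order M X" shows "partial_order M (fin_power M X n)"
proof -
  have X: "X \<in> sets M" "po M X" using assms by (auto simp: partial_order_def)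
  have "dec (\<lambda>z. is_pair z \<and> \<langle>p1 z, p2 z\<rangle> \<in> fin_power M X n)" by (intro recs dec_fin_power X)
  moreover have "fin_power M X n = {z. is_pair z \<and> \<langle>p1 z, p2 z\<rangle> \<in> fin_power M X n}"
    by (auto simp: fin_power_def is_pair_eq)
  ultimately show ?thesis using fin_power_po[OF X(2)] by (simp add: partial_order_def dec_def)
qed

end

section \<open>The power functor as a coded dilator\<close>

context skel
begin

definition act where "act n f s = seqcode n (\<lambda>i. apc f (apc s i))"

text \<open>
  The columns of \<open>d_map (pw n)\<close> are not restricted to codes of morphisms; the remaining ones carry no meaning.
\<close>

definition pw :: "'m \<Rightarrow> 'm dil" where
  "pw n = \<lparr>d_ord = {z. is_pair z \<and> is_pair (p2 z) \<and> \<langle>p1 (p2 z), p2 (p2 z)\<rangle> \<in> fin_power M (elems M (p1 z)) n},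
     d_map = {z. is_pair z \<and> is_pair (p1 z) \<and> is_pair (p1 (p1 z)) \<and> is_pair (p2 z) \<and>
        is_seq M (fl (p1 (p1 (p1 z)))) n (p1 (p2 z)) \<and> p2 (p2 z) = act n (p2 (p1 z)) (p1 (p2 z))},
     d_supp = {z. is_pair z \<and> is_pair (p2 z) \<and> is_seq M (fl (p1 z)) n (p1 (p2 z)) \<and> p2 (p2 z) = rng n (p1 (p2 z))}\<rparr>"

lemma pw_sets: "d_ord (pw n) \<in> sets M" "d_map (pw n) \<in> sets M" "d_supp (pw n) \<in> sets M"
proof -
  have "dec (\<lambda>z. is_pair z \<and> is_pair (p2 z) \<and> \<langle>p1 (p2 z), p2 (p2 z)\<rangle> \<in> fin_power M (elems M (p1 z)) n)"
    by (intro recs dec_fin_power)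
  then show "d_ord (pw n) \<in> sets M" by (simp add: pw_def dec_def)
  have "rec (\<lambda>z. act n (p1 z) (p2 z))" unfolding act_def by (intro rec_seqcode recs)
  then have r: "rec (\<lambda>z. act n (f z) (g z))" if "rec f" "rec g" for f g using rec2 that by blast
  have "dec (\<lambda>z. is_pair z \<and> is_pair (p1 z) \<and> is_pair (p1 (p1 z)) \<and> is_pair (p2 z) \<and>
        is_seq M (fl (p1 (p1 (p1 z)))) n (p1 (p2 z)) \<and> p2 (p2 z) = act n (p2 (p1 z)) (p1 (p2 z)))"
    by (intro recs dec_is_seq r)
  then show "d_map (pw n) \<in> sets M" by (simp add: pw_def dec_def)
  have "dec (\<lambda>z. is_pair z \<and> is_pair (p2 z) \<and> is_seq M (fl (p1 z)) n (p1 (p2 z)) \<and> p2 (p2 z) = rng n (p1 (p2 z)))"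
    by (intro recs dec_is_seq rec_rng)
  then show "d_supp (pw n) \<in> sets M" by (simp add: pw_def dec_def)
qed

lemma pw_ord: "W_ord M (pw n) c = fin_power M (elems M c) n"
  by (auto simp: W_ord_def col_def pw_def) (auto simp: fin_power_def is_pair_def)

lemma pw_fld: "c \<in> obj K \<Longrightarrow> s \<in> fld M (W_ord M (pw n) c) \<longleftrightarrow> is_seq M (fl c) n s"
  unfolding pw_ord by (intro fin_power_fld fin_poD sk)

lemma pw_map: assumes "c \<in> obj K" shows "W_map M (pw n) c d f = lam (fld M (W_ord M (pw n) c)) (act n f)"
proof -
  have "W_map M (pw n) c d f = {z. is_pair z \<and> is_seq M (fl c) n (p1 z) \<and> p2 z = act n f (p1 z)}"
    by (auto simp: W_map_def col_def pw_def)
  then show ?thesis by (auto simp: lam_def pw_fld[OF assms] is_pair_def)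
qed

lemma pw_supp: assumes "c \<in> obj K" shows "W_supp M (pw n) c = lam (fld M (W_ord M (pw n) c)) (rng n)"
proof -
  have "W_supp M (pw n) c = {z. is_pair z \<and> is_seq M (fl c) n (p1 z) \<and> p2 z = rng n (p1 z)}"
    by (auto simp: W_supp_def col_def pw_def)
  then show ?thesis by (auto simp: lam_def pw_fld[OF assms] is_pair_def)
qed

lemma apc_mc: "rec h \<Longrightarrow> x \<in> fl c \<Longrightarrow> apc (mc c h) x = h x"
  using apc_eq[of "mc c h" "fl c" UNIV x] fun_on_lam[of "fl c" h UNIV] by (simp add: mc)

lemma rec_apc2: "rec (\<lambda>i. apc f (apc s i))" by (intro recs)

lemma act_seq: assumes "is_seq M (fl c) n s" "qe (apc f) (elems M c) (elems M d)"
  shows "is_seq M (fl d) n (act n f s)" "i \<prec> n \<Longrightarrow> apc (act n f s) i = apc f (apc s i)"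
  unfolding act_def using is_seq_seqcode[OF rec_apc2] apc_seqcode[OF rec_apc2] seq_in[OF assms(1)] assms(2)
  by (simp_all add: qe_def)

lemma mor_qe: "mor M K c d f \<Longrightarrow> qe (apc f) (elems M c) (elems M d)"
  using mor_mor'(1) by (simp add: mor'_def)

lemma mor_obj: "mor M K c d f \<Longrightarrow> c \<in> obj K" "mor M K c d f \<Longrightarrow> d \<in> obj K"
  by (simp_all add: mor_def)

lemma act_qe: assumes "mor M K c d f" shows "qe (act n f) (W_ord M (pw n) c) (W_ord M (pw n) d)"
  unfolding qe_def
proof (intro conjI ballI impI)
  fix s assume "s \<in> fld M (W_ord M (pw n) c)"
  then show "act n f s \<in> fld M (W_ord M (pw n) d)"
    using act_seq(1)[OF _ mor_qe[OF assms]] pw_fld mor_obj[OF assms] by blast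
next
  fix s t assume st: "s \<in> fld M (W_ord M (pw n) c)" "t \<in> fld M (W_ord M (pw n) c)"
    and le: "\<langle>act n f s, act n f t\<rangle> \<in> W_ord M (pw n) d"
  have st: "is_seq M (fl c) n s" "is_seq M (fl c) n t" using st pw_fld mor_obj[OF assms] by auto
  show "\<langle>s, t\<rangle> \<in> W_ord M (pw n) c"
    using le st seq_in[OF st(1)] seq_in[OF st(2)] act_seq(2)[OF _ mor_qe[OF assms]] mor_qe[OF assms]
    unfolding pw_ord fin_power_apc qe_def by simp
qed

lemma pw_functor: "dil_functor M K (pw n)"
  unfolding dil_functor_def
proof (intro conjI ballI allI impI; (elim conjE)?)
  fix c assume "c \<in> obj K" then show "po M (W_ord M (pw n) c)" unfolding pw_ord by (intro fin_power_po fin_poD sk)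
next
  fix c d f assume f: "mor M K c d f"
  show "quasi_emb M (W_map M (pw n) c d f) (W_ord M (pw n) c) (W_ord M (pw n) d)"
    unfolding pw_map[OF mor_obj(1)[OF f]] quasi_emb_lam by (rule act_qe[OF f])
next
  fix c s assume c: "c \<in> obj K" and s: "s \<in> fld M (W_ord M (pw n) c)"
  have sq: "is_seq M (fl c) n s" using s pw_fld[OF c] by simp
  have "act n (mc c (\<lambda>x. x)) s = seqcode n (apc s)"
    unfolding act_def using seq_in[OF sq] by (intro seqcode_cong apc_mc recs)
  then show "ap M (W_map M (pw n) c c (code_of M (idf M (fl c)))) s = s"
    unfolding pw_map[OF c] idf_lam using s seqcode_apc[OF sq] by (simp add: mc_def)
next
  fix b c d f g s assume f: "mor M K b c f" and g: "mor M K c d g" and s: "s \<in> fld M (W_ord M (pw n) b)"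
  note b = mor_obj(1)[OF f] and c = mor_obj(1)[OF g]
  have sq: "is_seq M (fl b) n s" using s pw_fld[OF b] by simp
  have "code_of M (compf M (elems M g) (elems M f)) = mc b (\<lambda>x. apc g (apc f x))"
    using mc_comp[OF mor_mor'(1)[OF f] mor_mor'(1)[OF g]] mor_mor'(2)[OF f] mor_mor'(2)[OF g] by simp
  moreover have "act n (mc b (\<lambda>x. apc g (apc f x))) s = seqcode n (\<lambda>i. apc g (apc f (apc s i)))"
    unfolding act_def using seq_in[OF sq] by (intro seqcode_cong apc_mc recs)
  moreover have "act n g (act n f s) = seqcode n (\<lambda>i. apc g (apc f (apc s i)))"
    unfolding act_def[of n g] using act_seq(2)[OF sq mor_qe[OF f]] by (intro seqcode_cong) simp
  moreover have "act n f s \<in> fld M (W_ord M (pw n) c)" using act_seq(1)[OF sq mor_qe[OF f]] pw_fld[OF c] by simp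
  ultimately show "ap M (W_map M (pw n) b d (code_of M (compf M (elems M g) (elems M f)))) s =
       ap M (W_map M (pw n) c d g) (ap M (W_map M (pw n) b c f) s)"
    unfolding pw_map[OF b] pw_map[OF c] using s by simp
qed

lemma pw_embs: "preserves_embs M K (pw n)"
  unfolding preserves_embs_def
proof (intro allI impI; elim conjE)
  fix c d f assume f: "mor M K c d f" and e: "emb M (elems M f) (elems M c) (elems M d)"
  note c = mor_obj(1)[OF f] and d = mor_obj(2)[OF f]
  have l: "elems M f = lam (fl c) (apc f)" using f lam_rec_code unfolding mor_def by blast
  have "eh (apc f) (elems M c) (elems M d)" using e unfolding l emb_lam .
  then have mono: "\<langle>x, y\<rangle> \<in> elems M c \<Longrightarrow> x \<in> fl c \<Longrightarrow> y \<in> fl c \<Longrightarrow> \<langle>apc f x, apc f y\<rangle> \<in> elems M d" for x y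
    unfolding eh_def by blast
  have "eh (act n f) (W_ord M (pw n) c) (W_ord M (pw n) d)"
    unfolding eh_def
  proof (intro conjI ballI impI)
    fix s t assume "\<langle>s, t\<rangle> \<in> W_ord M (pw n) c"
    then have st: "is_seq M (fl c) n s" "is_seq M (fl c) n t" and le: "i \<prec> n \<Longrightarrow> \<langle>apc s i, apc t i\<rangle> \<in> elems M c" for i
      unfolding pw_ord fin_power_apc by auto
    have "\<langle>apc (act n f s) i, apc (act n f t) i\<rangle> \<in> elems M d" if i: "i \<prec> n" for i
      unfolding act_seq(2)[OF st(1) mor_qe[OF f] i] act_seq(2)[OF st(2) mor_qe[OF f] i]
      by (rule mono[OF le[OF i] seq_in[OF st(1) i] seq_in[OF st(2) i]])
    then show "\<langle>act n f s, act n f t\<rangle> \<in> W_ord M (pw n) d"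
      unfolding pw_ord fin_power_apc using act_seq(1)[OF _ mor_qe[OF f]] st by blast
  qed (rule act_qe[OF f])
  then show "emb M (W_map M (pw n) c d f) (W_ord M (pw n) c) (W_ord M (pw n) d)"
    unfolding pw_map[OF c] emb_lam .
qed

lemma pw_sp: "c \<in> obj K \<Longrightarrow> s \<in> fld M (W_ord M (pw n) c) \<Longrightarrow> elems M (ap M (W_supp M (pw n) c) s) = apc s ` {i. i \<prec> n}"
  using rng(2) pw_fld by (simp add: pw_supp)

lemma pw_supp_natural: "supp_natural M K (pw n)"
  unfolding supp_natural_def
proof (intro conjI ballI allI impI)
  fix c assume c: "c \<in> obj K"
  show "fun_on M (W_supp M (pw n) c) (fld M (W_ord M (pw n) c)) {s. fin_code M s \<and> elems M s \<subseteq> fl c}"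
    unfolding pw_supp[OF c]
  proof (rule fun_on_lam)
    fix s assume "s \<in> fld M (W_ord M (pw n) c)"
    then have "is_seq M (fl c) n s" using pw_fld[OF c] by simp
    then show "rng n s \<in> {s. fin_code M s \<and> elems M s \<subseteq> fl c}" using rng seq_in by auto
  qed
next
  fix c d f s assume f: "mor M K c d f" and s: "s \<in> fld M (W_ord M (pw n) c)"
  note c = mor_obj(1)[OF f] and d = mor_obj(2)[OF f]
  have sq: "is_seq M (fl c) n s" using s pw_fld[OF c] by simp
  have fs: "act n f s \<in> fld M (W_ord M (pw n) d)" using act_seq(1)[OF sq mor_qe[OF f]] pw_fld[OF d] by simp
  have "fun_on M (elems M f) (fl c) (fl d)" using f unfolding mor_def quasi_emb_def by blast
  from apc_eq[OF this] have ap: "ap M (elems M f) x = apc f x" if "x \<in> fl c" for x using that by simp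
  have "apc (act n f s) ` {i. i \<prec> n} = ap M (elems M f) ` apc s ` {i. i \<prec> n}"
    unfolding image_image using ap act_seq(2)[OF sq mor_qe[OF f]] seq_in[OF sq] by (intro image_cong) auto
  then show "elems M (ap M (W_supp M (pw n) d) (ap M (W_map M (pw n) c d f) s)) =
          ap M (elems M f) ` elems M (ap M (W_supp M (pw n) c) s)"
    unfolding pw_sp[OF c s] using pw_sp[OF d fs] s by (simp add: pw_map[OF c])
qed

text \<open>A preimage of t is found position by position: the support hypothesis provides a
  preimage of each entry, and \<open>api f\<close> computes it, since f is injective.\<close>

lemma pw_supp_condition: "supp_condition M K (pw n)"
  unfolding supp_condition_def
proof (intro allI ballI impI; elim conjE)
  fix c d f t assume f: "mor M K c d f" and t: "t \<in> fld M (W_ord M (pw n) d)"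
    and sub: "elems M (ap M (W_supp M (pw n) d) t) \<subseteq> ap M (elems M f) ` fl c"
  note c = mor_obj(1)[OF f] and d = mor_obj(2)[OF f]
  have sq: "is_seq M (fl d) n t" using t pw_fld[OF d] by simp
  have fo: "fun_on M (elems M f) (fl c) (fl d)" using f unfolding mor_def quasi_emb_def by blast
  have inj: "x = y" if "x \<in> fl c" "y \<in> fl c" "apc f x = apc f y" for x y
    using qe_inj[OF mor_qe[OF f]] fin_poD sk(4)[OF c] that by blast
  have api: "api f (apc t i) \<in> fl c \<and> apc f (api f (apc t i)) = apc t i" if i: "i \<prec> n" for i
  proof -
    have "apc t i \<in> ap M (elems M f) ` fl c" using sub i unfolding pw_sp[OF d t] by blast
    then obtain x where x: "x \<in> fl c" "apc t i = ap M (elems M f) x" by blast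
    have "api f (ap M (elems M f) x) = x" using api_eq[OF fo x(1)] inj apc_eq[OF fo] x(1) by metis
    then show ?thesis using x apc_eq[OF fo] by simp
  qed
  let ?h = "\<lambda>i. api f (apc t i)"
  have h: "rec ?h" by (intro recs)
  have s: "is_seq M (fl c) n (seqcode n ?h)" using is_seq_seqcode[OF h] api by blast
  have "act n f (seqcode n ?h) = seqcode n (apc t)"
    unfolding act_def using api apc_seqcode[OF h] by (intro seqcode_cong) simp
  then have "act n f (seqcode n ?h) = t" using seqcode_apc[OF sq] by simp
  then show "\<exists>s\<in>fld M (W_ord M (pw n) c). ap M (W_map M (pw n) c d f) s = t"
    using s pw_fld[OF c] by (intro bexI[of _ "seqcode n ?h"]) (simp_all add: pw_map[OF c])
qed

lemma pw_dilator: "PO_dilator M K (pw n)"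
  unfolding PO_dilator_def using pw_sets pw_functor pw_embs pw_supp_natural pw_supp_condition by blast

text \<open>
  An order \<open>c\<close> that is enumerated by \<open>s\<close> is isomorphic to an order on the positions \<open>i < n\<close> at which an element occurs
  for the first time. There are boundedly many codes of such orders, hence boundedly many such \<open>c\<close>.
\<close>

lemma pw_finite: "finite_dilator M K (pw n)"
proof -
  interpret dilator M K "pw n" by unfold_locales (rule pw_dilator)
  have tr_iff: "\<langle>c, s\<rangle> \<in> trace M K (pw n) \<longleftrightarrow> c \<in> obj K \<and> is_seq M (fl c) n s \<and> apc s ` {i. i \<prec> n} = fl c" for c s
    using pw_fld[of c s n] pw_sp[of c s n] by (auto simp: trace_iff)
  \<comment> \<open>Orders on subsets of n consist of pairs below \<langle>n, n\<rangle>, so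
    \<open>b\<close> bounds their codes. Then \<open>b'\<close> bounds their representatives by
    collection, and \<open>b''\<close> the codes of sequences of length n with entries below
    \<open>b'\<close>.\<close>
  obtain b where b: "\<And>A. fin A \<Longrightarrow> \<forall>i\<in>A. i \<prec> \<langle>n, n\<rangle> \<Longrightarrow> code_of M A \<prec> b" using code_bound by blast
  obtain b' where b': "\<And>i. i \<prec> b \<Longrightarrow> rp i \<prec> b'" using bounding[OF rec_rp[OF rec_id]] by blast
  obtain b'' where b'': "\<And>A. fin A \<Longrightarrow> \<forall>i\<in>A. i \<prec> \<langle>n, b'\<rangle> \<Longrightarrow> code_of M A \<prec> b''" using code_bound by blast
  have bound: "c \<prec> b'" "s \<prec> b''" if "\<langle>c, s\<rangle> \<in> trace M K (pw n)" for c s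
  proof -
    have c: "c \<in> obj K" and s: "is_seq M (fl c) n s" and im: "apc s ` {i. i \<prec> n} = fl c" using that tr_iff by auto
    have poc: "po M (elems M c)" using sk(4)[OF c] fin_poD by blast
    \<comment> \<open>On first occurrences \<open>apc s\<close> is injective, and by the least
      number principle it still reaches every point of c. The condition is decidable because the
      search for earlier occurrences is bounded.\<close>
    define I where "I i \<longleftrightarrow> i \<prec> n \<and> (\<forall>j. j \<prec> i \<longrightarrow> apc s j \<noteq> apc s i)" for i
    have dI: "dec (\<lambda>z. I (f z))" if "rec f" for f
      by (rule dec_comp[OF _ that]) (unfold I_def, intro recs)
    have inj: "i = j" if "I i" "I j" "apc s i = apc s j" for i j
      using that N.neq_iff unfolding I_def by metis
    have surj: "\<exists>i. I i \<and> apc s i = x" if x: "x \<in> fl c" for x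
    proof -
      obtain i where i: "i \<prec> n \<and> apc s i = x" using x unfolding im[symmetric] by auto
      have "dec (\<lambda>i. i \<prec> n \<and> apc s i = x)" by (intro recs)
      from dec_least[OF this i] obtain m where m: "m \<prec> n" "apc s m = x"
        and least: "\<And>k. k \<prec> m \<Longrightarrow> k \<prec> n \<Longrightarrow> apc s k \<noteq> x" by blast
      have "I m" unfolding I_def using m least N.less_trans[OF _ m(1)] by simp
      then show ?thesis using m(2) by blast
    qed
    define R where "R = {z. is_pair z \<and> I (p1 z) \<and> I (p2 z) \<and> \<langle>apc s (p1 z), apc s (p2 z)\<rangle> \<in> elems M c}"
    have R_iff: "\<langle>i, j\<rangle> \<in> R \<longleftrightarrow> I i \<and> I j \<and> \<langle>apc s i, apc s j\<rangle> \<in> elems M c" for i j by (simp add: R_def)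
    have R_less: "z \<prec> \<langle>n, n\<rangle>" if "z \<in> R" for z
      using that unfolding R_def is_pair_def by (auto simp: I_def intro!: pr_less N.add_strict_mono)
    have finR: "fin R" unfolding R_def by (rule fin_Collect[of _ "\<langle>n, n\<rangle>"]) (intro recs dI, use R_less R_def in auto)
    have fldR: "x \<in> fld M R \<longleftrightarrow> I x" for x
      unfolding fld_iff[of x] R_iff using seq_in[OF s] po_refl[OF poc] I_def by blast
    let ?r = "code_of M R"
    have r: "elems M ?r = R" "fin_code M ?r" using code_of[OF finR] by auto
    have "po M R"
      unfolding po_def
    proof (intro conjI ballI allI impI; (elim conjE)?)
      fix z assume "z \<in> R" then show "\<exists>x\<in>fld M R. \<exists>y\<in>fld M R. z = \<langle>x, y\<rangle>"
        unfolding Bex_def fldR by (auto simp: R_def is_pair_def)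
    next
      fix i j assume ij: "\<langle>i, j\<rangle> \<in> R" "\<langle>j, i\<rangle> \<in> R"
      then have "apc s i = apc s j" unfolding R_iff by (elim conjE) (rule po_antisym[OF poc])
      then show "i = j" using ij inj unfolding R_iff by blast
    next
      fix i j k assume ijk: "\<langle>i, j\<rangle> \<in> R" "\<langle>j, k\<rangle> \<in> R"
      then have "\<langle>apc s i, apc s k\<rangle> \<in> elems M c" unfolding R_iff by (elim conjE) (rule po_trans[OF poc])
      then show "\<langle>i, k\<rangle> \<in> R" using ijk unfolding R_iff by blast
    qed
    then have fr: "fin_po M ?r" using r by (simp add: fin_po_def)
    have "apc s i \<in> fl c" if "I i" for i using that seq_in[OF s] unfolding I_def by blast
    then have "eh (apc s) R (elems M c)" unfolding eh_def qe_def Ball_def fldR R_iff by blast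
    moreover have "apc s ` fld M R = fl c"
    proof (intro set_eqI iffI)
      fix x assume "x \<in> apc s ` fld M R"
      then show "x \<in> fl c" using fldR seq_in[OF s] unfolding I_def by auto
    next
      fix x assume "x \<in> fl c"
      then show "x \<in> apc s ` fld M R" using surj[of x] fldR by auto
    qed
    ultimately have "rp ?r = rp c" using rp_iso[OF fr sk(4)[OF c], of "apc s"] by (simp add: r recs)
    then have "c = rp ?r" using rp_obj_eq[OF c] by simp
    then show cb: "c \<prec> b'" using b' b[OF finR] R_less by simp
    have "\<langle>i, apc s i\<rangle> \<prec> \<langle>n, b'\<rangle>" if "i \<prec> n" for i
      using that fl_less[OF seq_in[OF s that]] cb N.less_trans by (intro pr_less N.add_strict_mono) auto
    then have "\<forall>z\<in>elems M s. z \<prec> \<langle>n, b'\<rangle>" unfolding seq_elems[OF s] by (auto simp: lam_def)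
    then show "s \<prec> b''" using b''[of "elems M s"] s by (simp add: is_seq_def)
  qed
  have "fin (trace M K (pw n))"
  proof (rule finI[of _ "\<langle>b', b''\<rangle>"])
    fix z assume z: "z \<in> trace M K (pw n)"
    then obtain c s where "z = \<langle>c, s\<rangle>" by (auto simp: trace_def)
    then show "z \<prec> \<langle>b', b''\<rangle>" using bound z by (auto intro!: pr_less N.add_strict_mono)
  next
    \<comment> \<open>Besides being bounded, the trace has to be a set. Only the inclusion of the
      field in the range is tested, since the converse follows from \<open>is_seq\<close>.\<close>
    have d: "dec (\<lambda>z. is_pair z \<and> p1 z \<in> obj K \<and> is_seq M (fl (p1 z)) n (p2 z) \<and>
      (\<forall>x. x \<prec> p1 z \<longrightarrow> x \<in> fl (p1 z) \<longrightarrow> (\<exists>i. i \<prec> n \<and> apc (p2 z) i = x)))"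
      by (intro recs dec_is_seq sk)
    have "z \<in> trace M K (pw n) \<longleftrightarrow> is_pair z \<and> p1 z \<in> obj K \<and> is_seq M (fl (p1 z)) n (p2 z) \<and>
      (\<forall>x. x \<prec> p1 z \<longrightarrow> x \<in> fl (p1 z) \<longrightarrow> (\<exists>i. i \<prec> n \<and> apc (p2 z) i = x))" for z
    proof (cases "is_pair z")
      case True
      then obtain c s where z: "z = \<langle>c, s\<rangle>" by (auto simp: is_pair_def)
      have "apc s ` {i. i \<prec> n} = fl c \<longleftrightarrow> (\<forall>x. x \<prec> c \<longrightarrow> x \<in> fl c \<longrightarrow> (\<exists>i. i \<prec> n \<and> apc s i = x))" if "is_seq M (fl c) n s"
      proof -
        have "apc s ` {i. i \<prec> n} \<subseteq> fl c" using seq_in[OF that] by auto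
        moreover have "fl c \<subseteq> apc s ` {i. i \<prec> n} \<longleftrightarrow> (\<forall>x. x \<prec> c \<longrightarrow> x \<in> fl c \<longrightarrow> (\<exists>i. i \<prec> n \<and> apc s i = x))"
          unfolding subset_iff image_iff Bex_def mem_Collect_eq by (metis fl_less)
        ultimately show ?thesis by (simp add: set_eq_subset)
      qed
      then show ?thesis unfolding z tr_iff by auto
    qed (auto simp: trace_def)
    with d show "dec (\<lambda>z. z \<in> trace M K (pw n))" by (simp only:)
  qed
  then show ?thesis unfolding finite_dilator_def using code_of by blast
qed

end

section \<open>The value of W(F) at an element\<close>

context dilator
begin

text \<open>For any dilator, W(F) sends (a, \<sigma>) to a pair with support f[a] and second
  component \<open>WT\<close> of f at \<sigma>, and naturality of supports makes this pair an
  element of W(Y).\<close>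

lemma ext_map_elem:
  assumes X: "partial_order M X" and Y: "partial_order M Y" and F: "F \<in> sets M" "quasi_emb M F X Y"
    and e: "ext_elem M K W X a \<sigma>" and f: "rec f" "\<And>x. x \<in> fld M X \<Longrightarrow> f x = ap M F x" "F = lam (fld M X) f"
  obtains b where "ext_map M K W X Y F a \<sigma> = \<langle>b, WT (induced M X a) (induced M Y b) f \<sigma>\<rangle>"
    "ext_elem M K W Y b (WT (induced M X a) (induced M Y b) f \<sigma>)"
    "fmor (induced M X a) (induced M Y b) f" "elems M b = f ` elems M a"
proof -
  define b where "b = code_of M (f ` elems M a)"
  note e' = e[unfolded ext_elem_iff[OF X]]
  have aX: "elems M a \<subseteq> fld M X" using e' unfolding sub_def[OF X] by blast
  have b: "elems M b = f ` elems M a" "fin_code M b" unfolding b_def using code_of[OF fin_image[OF fin_elems f(1)]] by auto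
  have q: "qe f X Y" using F(2) unfolding f(3) quasi_emb_lam .
  have sb: "sub Y b" unfolding sub_def[OF Y] b using q aX by (auto simp: qe_def)
  note Da = sub_D[OF X conjunct1[OF conjunct2[OF e']]] and Db = sub_D[OF Y sb]
  have fm: "fmor (induced M X a) (induced M Y b) f"
    unfolding fmor_def qe_def Da(2) Db(2) Da(3) Db(3) using f(1) q aX Da(1) Db(1) unfolding qe_def by (auto simp: b)
  have "ap M F ` elems M a = f ` elems M a" using f(2) aX by (intro image_cong) auto
  then have "ext_map M K W X Y F a \<sigma> = \<langle>b, ap M (W_ind M K W F (induced M X a) (induced M Y b)) \<sigma>\<rangle>"
    unfolding ext_map_def Let_def by (simp add: b_def)
  also have "\<dots> = \<langle>b, WT (induced M X a) (induced M Y b) f \<sigma>\<rangle>"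
    unfolding f(3) using aX by (subst W_ind_eq) (auto simp: Da(1,2) Db(1,2) b)
  finally have em: "ext_map M K W X Y F a \<sigma> = \<langle>b, WT (induced M X a) (induced M Y b) f \<sigma>\<rangle>" .
  let ?q = "induced M Y b" and ?p = "induced M X a"
  have \<tau>: "WT ?p ?q f \<sigma> \<in> fld M (WO (rp ?q))" using WT_fld[OF fm] e' by blast
  \<comment> \<open>Full support is first obtained after applying the enumeration of f[a], and then
    pulled back because the enumeration is injective.\<close>
  have "E ?q ` sp (rp ?q) (WT ?p ?q f \<sigma>) = E ?q ` fl (rp ?q)"
    using WT_supp[OF fm, of \<sigma>] e' E_image[OF Da(1)] E_image[OF Db(1)] Da(2) Db(2) b by simp
  moreover have "sp (rp ?q) (WT ?p ?q f \<sigma>) \<subseteq> fl (rp ?q)" by (rule sp_sub[OF rp_obj[OF Db(1)] \<tau>])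
  moreover have "inj_on (E ?q) (fl (rp ?q))" using E_inj[OF Db(1)] by (auto simp: inj_on_def)
  ultimately have "sp (rp ?q) (WT ?p ?q f \<sigma>) = fl (rp ?q)" by (meson inj_on_image_eq_iff order_refl)
  then have "ext_elem M K W Y b (WT ?p ?q f \<sigma>)" unfolding ext_elem_iff[OF Y] using b sb \<tau> by blast
  then show ?thesis using that em fm b by blast
qed

end

section \<open>Monotonicity of the power functor, and recovery of X^n from it\<close>

context skel
begin

text \<open>Over the union of the two images, the transported values have the entries
  \<open>J ?r (f x)\<close> and \<open>J ?r (g x)\<close> for the same x at each position. These are
  comparable because f x \<le> g x in Y and \<open>J ?r\<close> is an embedding.\<close>

lemma pw_monotone: "monotone_dilator M K (pw n)"
proof -
  interpret dilator M K "pw n" by unfold_locales (rule pw_dilator)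
  show ?thesis unfolding monotone_dilator_def
  proof (intro allI ballI impI; elim conjE)
    fix X Y F G a \<sigma>
    assume F: "F \<in> sets M" "quasi_emb M F X Y" and G: "G \<in> sets M" "quasi_emb M G X Y"
      and X: "partial_order M X" and Y: "partial_order M Y"
      and le: "\<forall>x\<in>fld M X. \<langle>ap M F x, ap M G x\<rangle> \<in> Y" and e: "ext_elem M K (pw n) X a \<sigma>"
    have "X \<in> sets M" using X by (simp add: partial_order_def)
    then have "dec (\<lambda>x. x \<in> fld M X)" by (intro recs)
    then have fX: "fld M X \<in> sets M" by (simp add: dec_def)
    obtain f where f: "rec f" "\<And>x. x \<in> fld M X \<Longrightarrow> f x = ap M F x" "F = lam (fld M X) f"
      using total_ap[OF F(1) _ fX] F(2) unfolding quasi_emb_def by metis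
    obtain g where g: "rec g" "\<And>x. x \<in> fld M X \<Longrightarrow> g x = ap M G x" "G = lam (fld M X) g"
      using total_ap[OF G(1) _ fX] G(2) unfolding quasi_emb_def by metis
    let ?p = "induced M X a"
    obtain b where b: "ext_map M K (pw n) X Y F a \<sigma> = \<langle>b, WT ?p (induced M Y b) f \<sigma>\<rangle>"
      "ext_elem M K (pw n) Y b (WT ?p (induced M Y b) f \<sigma>)" "fmor ?p (induced M Y b) f" "elems M b = f ` elems M a"
      by (rule ext_map_elem[OF X Y F e f])
    obtain c where c: "ext_map M K (pw n) X Y G a \<sigma> = \<langle>c, WT ?p (induced M Y c) g \<sigma>\<rangle>"
      "ext_elem M K (pw n) Y c (WT ?p (induced M Y c) g \<sigma>)" "fmor ?p (induced M Y c) g" "elems M c = g ` elems M a"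
      by (rule ext_map_elem[OF X Y G e g])
    let ?u = "code_of M (elems M b \<union> elems M c)"
    let ?r = "induced M Y ?u"
    have u: "sub Y ?u" using b(2) c(2) sub_un[OF Y] unfolding ext_elem_iff[OF Y] by blast
    have r: "fin_po M ?r" "fl ?r = elems M b \<union> elems M c" using sub_D[OF Y u] by (auto simp: fin_un)
    have p: "fin_po M ?p" "fl ?p = elems M a" and aX: "elems M a \<subseteq> fld M X"
      using sub_D[OF X] e unfolding ext_elem_iff[OF X] sub_def[OF X] by blast+
    have \<sigma>: "\<sigma> \<in> fld M (WO (rp ?p))" using e unfolding ext_elem_iff[OF X] by blast
    then have sq: "is_seq M (fl (rp ?p)) n \<sigma>" using pw_fld rp_obj[OF p(1)] by blast
    have ib: "fmor (induced M Y b) ?r (\<lambda>x. x)" "fmor (induced M Y c) ?r (\<lambda>x. x)"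
      using incl[OF Y u] by (auto simp: fin_un)
    have m: "fmor ?p ?r f" "fmor ?p ?r g" using fmor_comp[OF b(3) ib(1)] fmor_comp[OF c(3) ib(2)] by auto
    have W: "apc (WT ?p ?r h \<sigma>) i = J ?r (h (E ?p (apc \<sigma> i)))" "is_seq M (fl (rp ?r)) n (WT ?p ?r h \<sigma>)"
      if "fmor ?p ?r h" "i \<prec> n" for h i
    proof -
      note t = fmor_tr[OF that(1)]
      have a: "WT ?p ?r h \<sigma> = act n (mc (rp ?p) (tr ?p ?r h)) \<sigma>"
        using \<sigma> rp_obj[OF p(1)] by (simp add: WT_def Wm_def pw_map)
      have "rec (tr ?p ?r h)" using t by (simp add: mor'_def)
      then show "apc (WT ?p ?r h \<sigma>) i = J ?r (h (E ?p (apc \<sigma> i)))"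
        unfolding a act_seq(2)[OF sq mor_qe[OF mor'_mor[OF t]] that(2)] using seq_in[OF sq that(2)] by (simp add: apc_mc tr_def)
      show "is_seq M (fl (rp ?r)) n (WT ?p ?r h \<sigma>)" unfolding a by (rule act_seq(1)[OF sq mor_qe[OF mor'_mor[OF t]]])
    qed
    have "\<langle>J ?r (f x), J ?r (g x)\<rangle> \<in> elems M (rp ?r)" if x: "x \<in> elems M a" for x
    proof -
      have fg: "f x \<in> fl ?r" "g x \<in> fl ?r" using x b(4) c(4) r(2) by auto
      have "\<langle>f x, g x\<rangle> \<in> Y" using x aX le f(2) g(2) by (metis subsetD)
      moreover have "f x \<in> elems M ?u" "g x \<in> elems M ?u"
        unfolding elems_code_of[OF fin_un[OF fin_elems fin_elems]] unfolding b(4) c(4) using x by auto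
      ultimately have "\<langle>f x, g x\<rangle> \<in> elems M ?r" using sub_D(3)[OF Y u] by blast
      then show ?thesis using fg J_eh[OF r(1)] unfolding eh_def by blast
    qed
    moreover have "E ?p (apc \<sigma> i) \<in> elems M a" if "i \<prec> n" for i using E_fl[OF p(1)] seq_in[OF sq that] p(2) by blast
    moreover have "is_seq M (fl (rp ?r)) n (WT ?p ?r h \<sigma>)" if "fmor ?p ?r h" for h
      using WT_fld[OF that \<sigma>] pw_fld[OF rp_obj[OF r(1)]] by simp
    ultimately have "\<langle>WT ?p ?r f \<sigma>, WT ?p ?r g \<sigma>\<rangle> \<in> WO (rp ?r)"
      unfolding pw_ord fin_power_apc using m W(1) by simp
    then have "Wle Y ?u b (WT ?p (induced M Y b) f \<sigma>) c (WT ?p (induced M Y c) g \<sigma>)"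
      unfolding Wle_def[OF Y] WT_comp[OF b(3) ib(1) \<sigma>] WT_comp[OF c(3) ib(2) \<sigma>] .
    then show "\<langle>ext_map M K (pw n) X Y F a \<sigma>, ext_map M K (pw n) X Y G a \<sigma>\<rangle> \<in> ext M K (pw n) Y"
      unfolding b(1) c(1) ext_iff[OF Y] using b(2) c(2) by blast
  qed
qed

text \<open>A sequence over X is presented as an element of the extension: its support is its range,
  and its entries are renamed by \<open>J\<close>. A comparison in the extension renames both
  sequences into one finite suborder, and as the renaming \<open>J ?r\<close> there is a quasi
  embedding, the entries are comparable in X.\<close>

lemma wpo_fin_power:
  assumes X: "wpo M X" and ext: "wpo M (ext M K (pw n) X)" shows "wpo M (fin_power M X n)"
proof -
  interpret dilator M K "pw n" by unfold_locales (rule pw_dilator)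
  have pX: "partial_order M X" "po M X" "X \<in> sets M" using X by (auto simp: wpo_def partial_order_def)
  have "\<exists>i j. i \<prec> j \<and> \<langle>g i, g j\<rangle> \<in> fin_power M X n" if g: "rec g" "\<forall>i. g i \<in> fld M (fin_power M X n)" for g
  proof -
    have sq: "is_seq M (fld M X) n (g i)" for i using g(2) fin_power_fld[OF pX(2)] by blast
    define a where "a i = rng n (g i)" for i
    define D where "D i = induced M X (a i)" for i
    have a: "fin_code M (a i)" "elems M (a i) = apc (g i) ` {i. i \<prec> n}" for i unfolding a_def using rng[OF sq] by blast+
    have sa: "sub X (a i)" for i unfolding sub_def[OF pX(1)] a using seq_in[OF sq] by blast
    note Da = sub_D[OF pX(1) sa, folded D_def]
    have gk: "apc (g i) k \<in> fl (D i)" if "k \<prec> n" for i k using that by (auto simp: Da a)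
    \<comment> \<open>Each entry of \<open>g i\<close> is replaced by its name in |a i|, computably
      in i and k.\<close>
    define h where "h i k = J (D i) (apc (g i) k)" for i k
    have rg: "rec (\<lambda>z. g (f z))" if "rec f" for f by (rule rec_comp[OF g(1) that])
    have rD: "rec (\<lambda>z. D (f z))" "rec (\<lambda>z. a (f z))" if "rec f" for f
      unfolding D_def a_def by (intro recs rec_rng rg that pX)+
    have rh: "rec (\<lambda>z. h (p1 z) (p2 z))" unfolding h_def by (intro recs rg rD)
    have rhi: "rec (h i)" for i using rec2[OF rh rec_const rec_id] .
    define \<sigma> where "\<sigma> i = seqcode n (h i)" for i
    have \<sigma>s: "is_seq M (fl (rp (D i))) n (\<sigma> i)" for i
      unfolding \<sigma>_def using is_seq_seqcode[OF rhi] J_fl[OF Da(1)] gk by (simp add: h_def)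
    have \<sigma>f: "\<sigma> i \<in> fld M (WO (rp (D i)))" for i using \<sigma>s pw_fld[OF rp_obj[OF Da(1)]] by blast
    have \<sigma>k: "apc (\<sigma> i) k = h i k" if "k \<prec> n" for i k unfolding \<sigma>_def using apc_seqcode[OF rhi that] .
    \<comment> \<open>The support is full because the entries of \<open>g i\<close> exhaust
      \<open>a i\<close> by the choice of \<open>a i\<close>.\<close>
    have "sp (rp (D i)) (\<sigma> i) = fl (rp (D i))" for i
    proof -
      have "sp (rp (D i)) (\<sigma> i) = apc (\<sigma> i) ` {k. k \<prec> n}" by (rule pw_sp[OF rp_obj[OF Da(1)] \<sigma>f])
      also have "\<dots> = (\<lambda>k. J (D i) (apc (g i) k)) ` {k. k \<prec> n}" using \<sigma>k by (intro image_cong) (auto simp: h_def)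
      also have "\<dots> = J (D i) ` fl (D i)" unfolding Da(2) a(2) image_image ..
      finally show ?thesis using J_image[OF Da(1)] by simp
    qed
    then have el: "ext_elem M K (pw n) X (a i) (\<sigma> i)" for i
      unfolding ext_elem_iff[OF pX(1)] using a sa \<sigma>f unfolding D_def by blast
    have "rec (\<lambda>i. \<langle>a i, \<sigma> i\<rangle>)" unfolding \<sigma>_def[abs_def] by (intro recs rD rec_seqcode rh)
    moreover have "\<langle>a i, \<sigma> i\<rangle> \<in> fld M (ext M K (pw n) X)" for i using ext_fld[OF pX(1)] el by blast
    ultimately obtain i j where ij: "i \<prec> j" "\<langle>\<langle>a i, \<sigma> i\<rangle>, \<langle>a j, \<sigma> j\<rangle>\<rangle> \<in> ext M K (pw n) X"
      using ext unfolding wpo_iff by blast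
    let ?u = "code_of M (elems M (a i) \<union> elems M (a j))"
    let ?r = "induced M X ?u"
    have u: "sub X ?u" using sub_un[OF pX(1)] sa by blast
    have r: "fin_po M ?r" "fl ?r = elems M (a i) \<union> elems M (a j)" using sub_D[OF pX(1) u] by (auto simp: fin_un)
    have W: "apc (WT (D l) ?r (\<lambda>x. x) (\<sigma> l)) k = J ?r (apc (g l) k)" if "fmor (D l) ?r (\<lambda>x. x)" "k \<prec> n" for l k
    proof -
      note t = fmor_tr[OF that(1)]
      have a: "WT (D l) ?r (\<lambda>x. x) (\<sigma> l) = act n (mc (rp (D l)) (tr (D l) ?r (\<lambda>x. x))) (\<sigma> l)"
        using \<sigma>f rp_obj[OF Da(1)] by (simp add: WT_def Wm_def pw_map)
      have "rec (tr (D l) ?r (\<lambda>x. x))" using t by (simp add: mor'_def)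
      then have "apc (WT (D l) ?r (\<lambda>x. x) (\<sigma> l)) k = J ?r (E (D l) (apc (\<sigma> l) k))"
        unfolding a act_seq(2)[OF \<sigma>s mor_qe[OF mor'_mor[OF t]] that(2)] using seq_in[OF \<sigma>s that(2)] by (simp add: apc_mc tr_def)
      then show ?thesis unfolding \<sigma>k[OF that(2)] h_def using E_J[OF Da(1) gk[OF that(2)]] by simp
    qed
    have m: "fmor (D i) ?r (\<lambda>x. x)" "fmor (D j) ?r (\<lambda>x. x)" unfolding D_def using incl[OF pX(1) u] by (auto simp: fin_un)
    have "Wle X ?u (a i) (\<sigma> i) (a j) (\<sigma> j)" using ij(2) ext_iff[OF pX(1)] by blast
    then have le: "\<langle>WT (D i) ?r (\<lambda>x. x) (\<sigma> i), WT (D j) ?r (\<lambda>x. x) (\<sigma> j)\<rangle> \<in> fin_power M (elems M (rp ?r)) n"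
      unfolding Wle_def[OF pX(1)] D_def pw_ord .
    have "\<langle>apc (g i) k, apc (g j) k\<rangle> \<in> X" if k: "k \<prec> n" for k
    proof -
      have "\<langle>J ?r (apc (g i) k), J ?r (apc (g j) k)\<rangle> \<in> elems M (rp ?r)"
        using le k W[OF m(1) k] W[OF m(2) k] unfolding fin_power_apc by metis
      moreover have "apc (g i) k \<in> fl ?r" "apc (g j) k \<in> fl ?r" unfolding r(2) unfolding a(2) using k by auto
      ultimately have "\<langle>apc (g i) k, apc (g j) k\<rangle> \<in> elems M ?r" using J_eh[OF r(1)] unfolding eh_def qe_def by blast
      then show ?thesis using sub_D(3)[OF pX(1) u] by blast
    qed
    then show ?thesis using ij(1) sq unfolding fin_power_apc by blast
  qed
  then show ?thesis unfolding wpo_iff using fin_power_partial_order[OF pX(1)] by blast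
qed

end

theorem proposition2p2:
  fixes M :: "'m l2" and K :: "'m skel"
  assumes "model_RCA0 M" and "skeleton M K"
  shows "(\<forall>W. PO_dilator M K W \<and> finite_dilator M K W \<and> monotone_dilator M K W \<longrightarrow> WPO_dilator M K W)
     \<longleftrightarrow> (\<forall>X. wpo M X \<longrightarrow> (\<forall>n. wpo M (fin_power M X n)))"
proof -
  interpret skel M K by unfold_locales fact+
  show ?thesis
  proof (intro iffI allI impI; (elim conjE)?)
    fix X n
    assume "\<forall>W. PO_dilator M K W \<and> finite_dilator M K W \<and> monotone_dilator M K W \<longrightarrow> WPO_dilator M K W" and X: "wpo M X"
    then have "WPO_dilator M K (pw n)" using pw_dilator pw_finite pw_monotone by blast
    then show "wpo M (fin_power M X n)" using wpo_fin_power X unfolding WPO_dilator_def by blast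
  next
    fix W assume power: "\<forall>X. wpo M X \<longrightarrow> (\<forall>n. wpo M (fin_power M X n))"
      and hW: "PO_dilator M K W" "finite_dilator M K W" "monotone_dilator M K W"
    interpret dilator M K W by unfold_locales (rule hW)
    have "wpo M (ext M K W X)" if "wpo M X" for X
      by (rule wpo_ext[OF hW(2,3) that]) (rule power[rule_format])
    then show "WPO_dilator M K W" unfolding WPO_dilator_def using hW(1) by simp
  qed
qed

end
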